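(* Let $p\in\{0,1\}$, $n\ge3$, and $d_1,\dots,d_n$ positive integers with $\xi=\sum_{i=1}^n 1/d_i<1$, $K=\max_i d_i$. There exists $s^*>0$ such that for every $s\in(0,s^* )$ and every choice of $a_1,\dots,a_{n-1}$ with the moduli below (arguments arbitrary), the Julia set of $f=f_{p,d_1,\dots,d_n}$ is a Cantor set of circles and, for every McMullen map $g_\eta(z)=z^k+\eta/z^l$ (integers $k,l\ge2$, $\eta\in\mathbb{C}\setminus\{0\}$), there is no homeomorphism $h:J(f)\to J(g_\eta)$ with $h\circ f=g_\eta\circ h$ on $J(f)$. The moduli are: if $p=1$, $|a_{n-1}|=(sK^{-2})^{1/d_n}$ and $|a_i|=(sK^{-5})^{1/d_{i+1}}|a_{i+1}|$ ($1\le i\le n-2$); if $p=0$, $|a_{n-1}|=(s^{1/d_n+(1-\xi)/3})^{1/d_n}$ and $|a_i|=(s^{1+1/d_n+2(1-\xi)/3})^{1/d_{i+1}}|a_{i+1}|$ ($1\le i\le n-2$).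
   Context: For $p\in\{0,1\}$, an integer $n\ge2$, positive integers $d_1,\dots,d_n$ with $\sum_{i=1}^n 1/d_i<1$, and complex numbers $a_1,\dots,a_{n-1}$ with $0<|a_1|<\dots<|a_{n-1}|<1$, define the rational map $$f_{p,d_1,\dots,d_n}(z)=z^{(-1)^{n-p}d_1}\prod_{i=1}^{n-1}\big(z^{d_i+d_{i+1}}-a_i^{d_i+d_{i+1}}\big)^{(-1)^{n-i-p}}.$$ A subset of the Riemann sphere is a Cantor set of circles if it is homeomorphic to $\mathcal{C}\times\mathbb{S}^1$, where $\mathcal{C}$ is the middle-third Cantor set. $J(\cdot)$ denotes the Julia set. *)

theory Defs
  imports "HOL-Analysis.Analysis"
begin

definition S2 :: "(complex \<times> real) set" where
  "S2 = sphere 0 1"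

definition north :: "complex \<times> real" where
  "north = (0, 1)"

definition stereo :: "complex \<Rightarrow> complex \<times> real" where
  "stereo z = (complex_of_real (2 / (1 + (cmod z)^2)) * z,
               ((cmod z)^2 - 1) / ((cmod z)^2 + 1))"

definition unstereo :: "complex \<times> real \<Rightarrow> complex" where
  "unstereo P = fst P / complex_of_real (1 - snd P)"

definition sphere_ext :: "(complex \<Rightarrow> complex) \<Rightarrow> (complex \<times> real) \<Rightarrow> (complex \<times> real)" where
  "sphere_ext f P = Lim (at P within (S2 - {north})) (\<lambda>Q. stereo (f (unstereo Q)))"

definition normal_iterates_on ::
  "((complex \<times> real) \<Rightarrow> (complex \<times> real)) \<Rightarrow> (complex \<times> real) set \<Rightarrow> bool" where
  "normal_iterates_on F U \<longleftrightarrow>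
     (\<forall>r :: nat \<Rightarrow> nat. \<exists>s g. strict_mono s \<and>
        (\<forall>C. compact C \<and> C \<subseteq> U \<longrightarrow>
             uniform_limit C (\<lambda>k. (F ^^ (r (s k)))) g sequentially))"

definition fatou :: "((complex \<times> real) \<Rightarrow> (complex \<times> real)) \<Rightarrow> (complex \<times> real) set" where
  "fatou F = {P \<in> S2. \<exists>U. open U \<and> P \<in> U \<and> normal_iterates_on F (U \<inter> S2)}"

definition julia :: "((complex \<times> real) \<Rightarrow> (complex \<times> real)) \<Rightarrow> (complex \<times> real) set" where
  "julia F = S2 - fatou F"

fun cantor_stage :: "nat \<Rightarrow> real set" where
  "cantor_stage 0 = {0..1}"
| "cantor_stage (Suc n) = (\<lambda>x. x / 3) ` cantor_stage n \<union> (\<lambda>x. 2/3 + x / 3) ` cantor_stage n"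

definition cantor_set :: "real set" where
  "cantor_set = (\<Inter>n. cantor_stage n)"

definition cantor_set_of_circles :: "(complex \<times> real) set \<Rightarrow> bool" where
  "cantor_set_of_circles X \<longleftrightarrow> X homeomorphic (cantor_set \<times> sphere (0::complex) 1)"

definition fmap :: "nat \<Rightarrow> nat \<Rightarrow> (nat \<Rightarrow> nat) \<Rightarrow> (nat \<Rightarrow> complex) \<Rightarrow> complex \<Rightarrow> complex" where
  "fmap p n d a z =
     z powi ((-1) ^ (n - p) * int (d 1)) *
     (\<Prod>i = 1..n-1. (z ^ (d i + d (Suc i)) - a i ^ (d i + d (Suc i))) powi ((-1) ^ (n - i - p)))"

definition mcmullen :: "nat \<Rightarrow> nat \<Rightarrow> complex \<Rightarrow> complex \<Rightarrow> complex" where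
  "mcmullen k l \<eta> z = z ^ k + \<eta> / z ^ l"

definition conjugate_on_julia ::
  "((complex \<times> real) \<Rightarrow> (complex \<times> real)) \<Rightarrow> ((complex \<times> real) \<Rightarrow> (complex \<times> real)) \<Rightarrow> bool" where
  "conjugate_on_julia F G \<longleftrightarrow>
     (\<exists>h h'. homeomorphism (julia F) (julia G) h h' \<and> (\<forall>P \<in> julia F. h (F P) = G (h P)))"

end

theory Submission
  imports Defs "HOL-Complex_Analysis.Great_Picard"
begin

text \<open>In logarithmic coordinates the map is, between two consecutive moduli \<open>|a_(j-1)|\<close> and \<open>|a_j|\<close>, a perturbation
  with small Lipschitz constant of \<open>\<zeta> \<mapsto> e_j \<zeta> + c_j\<close>, where \<open>e_j\<close> is \<open>d_j\<close> or \<open>- d_j\<close>. The moduli are such that points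
  close to some \<open>|a_j|\<close> leave a fixed annulus and then tend to \<open>0\<close> and infinity. The inverse branches \<open>G_j\<close> of the
  lifts are contractions of a strip with disjoint images, so \<open>\<Phi> (x, t) = G_(x_0) (\<Phi> (shift x, e_(x_0) t))\<close> has a solution at
  bounded distance from \<open>i t\<close>, and \<open>exp \<circ> \<Phi>\<close> parametrises the points that never leave the annulus by the Cantor set
  times the circle. The iterates are not equicontinuous on this set and converge off it: it is the Julia set.

  A conjugacy would turn the Julia set of a McMullen map \<open>g\<close> into a Cantor family of Jordan curves, each with \<open>n \<ge> 3\<close>
  preimage curves. Rotations by roots of unity of order \<open>m = k + l > n\<close> permute the curves, and a curve surrounding \<open>0\<close>
  is invariant, whereas one not surrounding \<open>0\<close> has \<open>m\<close> different images. If no curve surrounded \<open>0\<close>, then by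
  Montel's theorem the insides of the curves would be uncountably many disjoint open sets. If one curve
  surrounds \<open>0\<close>, so do its \<open>n\<close> preimages, since there are fewer than \<open>m\<close> of them; as the zeros of \<open>g\<close> form one
  orbit of the rotations, two of these preimages have no zero between them, and the image of the region
  between would be a nonempty bounded open set avoiding \<open>0\<close> with boundary on a single curve around \<open>0\<close>.\<close>

subsection \<open>Preliminaries\<close>

text \<open>The hypothesis \<open>\<xi> < 1\<close> is a budget. An annulus of logarithmic width
  \<open>W\<close> has to hold \<open>n\<close> disjoint rings of widths about
  \<open>W / d j\<close>, each of which covers the whole annulus under the map, and
  \<open>(1 - \<xi>) * W\<close> is what remains. Since \<open>W\<close> is of the order of
  \<open>- ln s\<close>, a small \<open>s\<close> makes this remainder larger than every constant
  that is lost near the moduli; the prescribed moduli distribute it. The lift to logarithms is there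
  because a monomial has many inverse branches on an annulus but a single one on a strip, and
  because it replaces a point of a circle by a real angle that can be multiplied by the degree. A
  conjugacy is only a homeomorphism between the two Julia sets. It need not extend to the sphere, so
  nothing about the complementary regions or the order of the circles can be transported: what
  survives is that each curve has \<open>n\<close> preimage curves and that each is covered with a
  degree of modulus at least 2. The position of the curves in the plane has to be recovered from the
  symmetry of the McMullen map, whence the distinction according to whether a curve surrounds
  \<open>0\<close>.\<close>

lemma continuous_on_funpow:
  assumes "continuous_on S f" "\<And>x. x \<in> S \<Longrightarrow> f x \<in> S"
  shows "continuous_on S (f ^^ k)"
proof (induction k)
  case (Suc k)
  have "(f ^^ k) x \<in> S" if "x \<in> S" for x using that by (induction k) (auto intro: assms(2))
  then show ?case unfolding funpow.simps
    by (intro continuous_on_compose[OF Suc continuous_on_subset[OF assms(1)]]) auto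
qed (simp add: continuous_on_id')

lemma reduce_angle: "\<exists>s \<in> {0..2*pi}. \<exists>q::int. (t::real) = s + 2 * pi * q"
proof -
  define q where "q = \<lfloor>t / (2 * pi)\<rfloor>"
  have "of_int q \<le> t / (2 * pi)" "t / (2 * pi) \<le> of_int q + 1" unfolding q_def by linarith+
  then have "t - 2 * pi * q \<in> {0..2*pi}" by (simp add: field_simps)
  then show ?thesis by (intro bexI[of _ "t - 2 * pi * q"] exI[of _ q]) simp_all
qed

text \<open>A continuous map into the discrete space of natural numbers is locally constant, so near
  each point the choice of the function is frozen.\<close>

lemma continuous_on_discrete_index:
  fixes i :: "'a::topological_space \<Rightarrow> nat"
  assumes i: "continuous_on S i" and f: "\<And>k. k \<in> i ` S \<Longrightarrow> continuous_on S (f k)"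
  shows "continuous_on S (\<lambda>x. f (i x) x)"
  unfolding continuous_on_def
proof
  fix x assume x: "x \<in> S"
  have "(i \<longlongrightarrow> i x) (at x within S)" using i x by (simp add: continuous_on_def)
  then have ev: "eventually (\<lambda>y. i y = i x) (at x within S)"
    by (auto dest!: topological_tendstoD[where S = "{i x}"] simp: open_discrete)
  have "(f (i x) \<longlongrightarrow> f (i x) x) (at x within S)"
    using f[of "i x"] x by (auto simp: continuous_on_def)
  then show "((\<lambda>y. f (i y) y) \<longlongrightarrow> f (i x) x) (at x within S)"
    by (rule Lim_transform_eventually) (use ev in eventually_elim, simp)
qed

subsection \<open>Self-similar decompositions of the Cantor set\<close>

lemma cantor_stage_subset: "cantor_stage k \<subseteq> {0..1}"
  by (induction k) force+

lemma cantor_stage_decreasing: "cantor_stage (Suc k) \<subseteq> cantor_stage k"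
proof (induction k)
  case (Suc k)
  then show ?case unfolding cantor_stage.simps(2)[of "Suc k"] cantor_stage.simps(2)[of k]
    by (meson Un_mono image_mono)
qed force

lemma cantor_set_subset: "cantor_set \<subseteq> {0..1}"
  using cantor_stage_subset[of 0] unfolding cantor_set_def by blast

lemma compact_cantor_set: "compact cantor_set"
proof -
  have "compact (cantor_stage k)" for k
    by (induction k) (auto intro!: compact_Un compact_continuous_image continuous_intros)
  then have "compact (\<Inter>(range cantor_stage))"
    by (intro compact_Inter) auto
  then show ?thesis by (simp add: cantor_set_def)
qed

lemma cantor_stage_Suc_iff:
  "x \<in> cantor_stage (Suc k) \<longleftrightarrow> 3 * x \<in> cantor_stage k \<or> 3 * x - 2 \<in> cantor_stage k"
proof -
  have "x \<in> (\<lambda>x. x / 3) ` cantor_stage k \<longleftrightarrow> 3 * x \<in> cantor_stage k"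
    by (auto simp: image_iff field_simps)
  moreover have "x \<in> (\<lambda>x. 2/3 + x / 3) ` cantor_stage k \<longleftrightarrow> 3 * x - 2 \<in> cantor_stage k"
  proof
    assume "3 * x - 2 \<in> cantor_stage k"
    then show "x \<in> (\<lambda>x. 2/3 + x / 3) ` cantor_stage k"
      by (rule rev_image_eqI) (simp add: field_simps)
  qed (auto simp: field_simps)
  ultimately show ?thesis by simp
qed

lemma cantor_set_iff: "x \<in> cantor_set \<longleftrightarrow> 3 * x \<in> cantor_set \<or> 3 * x - 2 \<in> cantor_set"
proof
  assume x: "x \<in> cantor_set"
  then have x': "x \<in> cantor_stage (Suc k)" for k unfolding cantor_set_def by blast
  show "3 * x \<in> cantor_set \<or> 3 * x - 2 \<in> cantor_set"
  \<comment> \<open>The alternative must not change from stage to stage. The half in which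
    \<open>x\<close> lies excludes one of the two at all stages at once.\<close>
  proof (cases "x \<le> 1/2")
    case True
    then have "3 * x - 2 \<notin> cantor_stage k" for k using cantor_stage_subset[of k] by auto
    then show ?thesis using x' unfolding cantor_stage_Suc_iff cantor_set_def by blast
  next
    case False
    then have "3 * x \<notin> cantor_stage k" for k using cantor_stage_subset[of k] by auto
    then show ?thesis using x' unfolding cantor_stage_Suc_iff cantor_set_def by blast
  qed
next
  assume "3 * x \<in> cantor_set \<or> 3 * x - 2 \<in> cantor_set"
  then have "x \<in> cantor_stage (Suc k)" for k unfolding cantor_stage_Suc_iff cantor_set_def by blast
  then show "x \<in> cantor_set" unfolding cantor_set_def using cantor_stage_decreasing by blast
qed

lemma cantor_set_zero: "0 \<in> cantor_set"
proof -
  have "0 \<in> cantor_stage k" for k by (induction k) (auto simp: image_iff)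
  then show ?thesis by (simp add: cantor_set_def)
qed

text \<open>The middle-third Cantor set in the role of the one-sided shift on \<open>n\<close>
  symbols: \<open>idx\<close> reads the first symbol, \<open>T\<close> is the shift and
  \<open>psi i\<close> prepends the symbol \<open>i\<close>. The contraction by 1/3 makes a point
  determined by its itinerary.\<close>

locale cantor_code =
  fixes n :: nat and psi :: "nat \<Rightarrow> real \<Rightarrow> real" and idx :: "real \<Rightarrow> nat" and T :: "real \<Rightarrow> real"
  assumes psi_in: "i \<in> {1..n} \<Longrightarrow> x \<in> cantor_set \<Longrightarrow> psi i x \<in> cantor_set"
    and idx_in: "x \<in> cantor_set \<Longrightarrow> idx x \<in> {1..n}"
    and T_in: "x \<in> cantor_set \<Longrightarrow> T x \<in> cantor_set"
    and psi_T: "x \<in> cantor_set \<Longrightarrow> psi (idx x) (T x) = x"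
    and idx_psi: "i \<in> {1..n} \<Longrightarrow> x \<in> cantor_set \<Longrightarrow> idx (psi i x) = i"
    and T_psi: "i \<in> {1..n} \<Longrightarrow> x \<in> cantor_set \<Longrightarrow> T (psi i x) = x"
    and psi_contr: "i \<in> {1..n} \<Longrightarrow> \<bar>psi i x - psi i y\<bar> \<le> \<bar>x - y\<bar> / 3"
    and idx_cont: "continuous_on cantor_set idx"
    and T_cont: "continuous_on cantor_set T"

text \<open>If \<open>n\<close> pieces are given, scaling them into the left third and keeping the right third as one piece
  gives \<open>n + 1\<close> pieces.\<close>

lemma cantor_set_pieces:
  assumes "n \<ge> 2"
  shows "\<exists>\<alpha> \<beta> :: nat \<Rightarrow> real. (\<forall>i \<in> {1..n}. 0 < \<alpha> i \<and> \<alpha> i \<le> 1/3) \<and>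
    (\<forall>x. x \<in> cantor_set \<longleftrightarrow> (\<exists>i \<in> {1..n}. (x - \<beta> i) / \<alpha> i \<in> cantor_set)) \<and>
    (\<forall>i \<in> {1..n}. \<forall>j \<in> {1..n}. \<forall>x. (x - \<beta> i) / \<alpha> i \<in> cantor_set \<longrightarrow> (x - \<beta> j) / \<alpha> j \<in> cantor_set \<longrightarrow> i = j)"
  using assms
proof (induction n rule: dec_induct)
  case base
  define \<alpha> \<beta> :: "nat \<Rightarrow> real" where "\<alpha> = (\<lambda>i. 1/3)" and "\<beta> = (\<lambda>i. if i = 1 then 0 else 2/3)"
  have *: "{1..2::nat} = {1, 2}" by auto
  have sub: "(x - \<beta> 1) / \<alpha> 1 = 3 * x" "(x - \<beta> 2) / \<alpha> 2 = 3 * x - 2" for x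
    by (auto simp: \<alpha>_def \<beta>_def field_simps)
  have disj: "\<not> (3 * x \<in> cantor_set \<and> 3 * x - 2 \<in> cantor_set)" for x
    using subsetD[OF cantor_set_subset, of "3 * x"] subsetD[OF cantor_set_subset, of "3 * x - 2"] by auto
  show ?case
    unfolding *
  proof (rule exI[of _ \<alpha>], rule exI[of _ \<beta>], intro conjI allI)
    fix x
    show "x \<in> cantor_set \<longleftrightarrow> (\<exists>i \<in> {1, 2}. (x - \<beta> i) / \<alpha> i \<in> cantor_set)"
      unfolding bex_simps sub using cantor_set_iff[of x] by blast
  next
    show "\<forall>i \<in> {1, 2}. \<forall>j \<in> {1, 2}. \<forall>x. (x - \<beta> i) / \<alpha> i \<in> cantor_set \<longrightarrow>
        (x - \<beta> j) / \<alpha> j \<in> cantor_set \<longrightarrow> i = j"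
      unfolding ball_simps sub using disj by blast
  qed (simp add: \<alpha>_def)
next
  case (step n)
  then obtain \<alpha> \<beta> :: "nat \<Rightarrow> real" where ab: "\<And>i. i \<in> {1..n} \<Longrightarrow> 0 < \<alpha> i \<and> \<alpha> i \<le> 1/3"
    and un: "\<And>x. x \<in> cantor_set \<longleftrightarrow> (\<exists>i \<in> {1..n}. (x - \<beta> i) / \<alpha> i \<in> cantor_set)"
    and dj: "\<And>i j x. i \<in> {1..n} \<Longrightarrow> j \<in> {1..n} \<Longrightarrow> (x - \<beta> i) / \<alpha> i \<in> cantor_set \<Longrightarrow>
       (x - \<beta> j) / \<alpha> j \<in> cantor_set \<Longrightarrow> i = j"
    by metis
  define \<alpha>' where "\<alpha>' = (\<lambda>i. if i = Suc n then 1/3 else \<alpha> i / 3)"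
  define \<beta>' where "\<beta>' = (\<lambda>i. if i = Suc n then 2/3 else \<beta> i / 3)"
  have s1: "(x - \<beta>' (Suc n)) / \<alpha>' (Suc n) = 3 * x - 2" for x
    by (auto simp: \<alpha>'_def \<beta>'_def field_simps)
  have s2: "(x - \<beta>' i) / \<alpha>' i = (3 * x - \<beta> i) / \<alpha> i" if "i \<in> {1..n}" for x i
    using that ab[OF that] by (auto simp: \<alpha>'_def \<beta>'_def field_simps)
  have *: "{1..Suc n} = insert (Suc n) {1..n}" by auto
  have disj: "\<not> (3 * x \<in> cantor_set \<and> 3 * x - 2 \<in> cantor_set)" for x
    using subsetD[OF cantor_set_subset, of "3 * x"] subsetD[OF cantor_set_subset, of "3 * x - 2"] by auto
  have c1: "\<forall>i \<in> {1..Suc n}. 0 < \<alpha>' i \<and> \<alpha>' i \<le> 1/3"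
    using ab unfolding * by (force simp: \<alpha>'_def)
  have c2: "x \<in> cantor_set \<longleftrightarrow> (\<exists>i \<in> {1..Suc n}. (x - \<beta>' i) / \<alpha>' i \<in> cantor_set)" for x
    unfolding * bex_simps s1 using cantor_set_iff[of x] un[of "3 * x"] s2 by auto
  have c3: "i = j" if "i \<in> {1..Suc n}" "j \<in> {1..Suc n}" "(x - \<beta>' i) / \<alpha>' i \<in> cantor_set"
    "(x - \<beta>' j) / \<alpha>' j \<in> cantor_set" for i j x
  proof -
    have "3 * x - 2 \<in> cantor_set" if "i = Suc n \<or> j = Suc n"
      using that s1[of x] \<open>(x - \<beta>' i) / \<alpha>' i \<in> cantor_set\<close> \<open>(x - \<beta>' j) / \<alpha>' j \<in> cantor_set\<close> by metis
    moreover have "3 * x \<in> cantor_set" if "i \<noteq> Suc n \<or> j \<noteq> Suc n"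
    proof -
      have "\<exists>i\<in>{1..n}. (3 * x - \<beta> i) / \<alpha> i \<in> cantor_set"
        using that \<open>i \<in> _\<close> \<open>j \<in> _\<close> \<open>(x - \<beta>' i) / \<alpha>' i \<in> cantor_set\<close> \<open>(x - \<beta>' j) / \<alpha>' j \<in> cantor_set\<close> s2
        unfolding * by (metis insert_iff)
      then show ?thesis using un by blast
    qed
    ultimately consider "i = Suc n" "j = Suc n" | "i \<noteq> Suc n" "j \<noteq> Suc n"
      using disj by blast
    then show ?thesis
    proof cases
      case 2
      then have "i \<in> {1..n}" "j \<in> {1..n}" using that unfolding * by auto
      then show ?thesis using dj[of i j "3 * x"] that s2 by auto
    qed simp
  qed
  show ?case using c1 c2 c3 by blast
qed

lemma cantor_code_exists:
  assumes "n \<ge> 2"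
  shows "\<exists>psi idx T. cantor_code n psi idx T"
proof -
  obtain \<alpha> \<beta> :: "nat \<Rightarrow> real" where ab: "\<And>i. i \<in> {1..n} \<Longrightarrow> 0 < \<alpha> i \<and> \<alpha> i \<le> 1/3"
    and un: "\<And>x. x \<in> cantor_set \<longleftrightarrow> (\<exists>i \<in> {1..n}. (x - \<beta> i) / \<alpha> i \<in> cantor_set)"
    and dj: "\<And>i j x. i \<in> {1..n} \<Longrightarrow> j \<in> {1..n} \<Longrightarrow> (x - \<beta> i) / \<alpha> i \<in> cantor_set \<Longrightarrow>
       (x - \<beta> j) / \<alpha> j \<in> cantor_set \<Longrightarrow> i = j"
    using cantor_set_pieces[OF assms] by metis
  define psi where "psi i x = \<alpha> i * x + \<beta> i" for i x
  define idx where "idx x = (SOME i. i \<in> {1..n} \<and> (x - \<beta> i) / \<alpha> i \<in> cantor_set)" for x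
  define T where "T x = (x - \<beta> (idx x)) / \<alpha> (idx x)" for x
  have idx: "idx x \<in> {1..n} \<and> (x - \<beta> (idx x)) / \<alpha> (idx x) \<in> cantor_set" if "x \<in> cantor_set" for x
    unfolding idx_def by (rule someI_ex) (use un that in blast)
  have inv: "(psi i x - \<beta> i) / \<alpha> i = x" if "i \<in> {1..n}" for i x
    using ab[OF that] by (simp add: psi_def)
  have pin: "psi i x \<in> cantor_set" if "i \<in> {1..n}" "x \<in> cantor_set" for i x
    using un inv that by metis
  have ip: "idx (psi i x) = i" if "i \<in> {1..n}" "x \<in> cantor_set" for i x
    using dj[of "idx (psi i x)" i "psi i x"] idx[OF pin[OF that]] inv that by auto
  have idxc: "continuous_on cantor_set idx"
  \<comment> \<open>Every set of natural numbers is closed. Its preimage is a finite union of the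
    compact pieces, hence closed as well.\<close>
  proof (subst continuous_on_closed_vimage[OF compact_imp_closed[OF compact_cantor_set]], intro allI impI)
    fix B :: "nat set"
    have "idx -` B \<inter> cantor_set = (\<Union>i \<in> B \<inter> {1..n}. psi i ` cantor_set)"
    proof (intro set_eqI iffI)
      fix x assume x: "x \<in> idx -` B \<inter> cantor_set"
      then have "x = psi (idx x) ((x - \<beta> (idx x)) / \<alpha> (idx x))"
        using ab[of "idx x"] idx[of x] by (auto simp: psi_def)
      then show "x \<in> (\<Union>i \<in> B \<inter> {1..n}. psi i ` cantor_set)" using x idx[of x] by blast
    qed (use ip pin in auto)
    moreover have "closed (psi i ` cantor_set)" for i
      unfolding psi_def
      by (intro compact_imp_closed compact_continuous_image compact_cantor_set continuous_intros)
    ultimately show "closed (idx -` B \<inter> cantor_set)" by (auto intro: closed_UN)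
  qed
  have "cantor_code n psi idx T"
  proof
    fix i x y assume "i \<in> {1..n}"
    from ab[OF this] have "\<bar>\<alpha> i * (x - y)\<bar> \<le> 1/3 * \<bar>x - y\<bar>"
      unfolding abs_mult by (intro mult_right_mono) auto
    then show "\<bar>psi i x - psi i y\<bar> \<le> \<bar>x - y\<bar> / 3"
      by (simp add: psi_def right_diff_distrib)
  next
    show "continuous_on cantor_set T" unfolding T_def
    proof (rule continuous_on_discrete_index[OF idxc])
      fix k assume "k \<in> idx ` cantor_set"
      then have "\<alpha> k \<noteq> 0" using ab idx by force
      then show "continuous_on cantor_set (\<lambda>x. (x - \<beta> k) / \<alpha> k)" by (auto intro!: continuous_intros)
    qed
  next
    fix x assume "x \<in> cantor_set"
    then show "psi (idx x) (T x) = x" using idx[of x] ab[of "idx x"] by (simp add: psi_def T_def)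
  next
    fix x assume "x \<in> cantor_set"
    then show "idx x \<in> {1..n}" "T x \<in> cantor_set" using idx[of x] by (simp_all only: T_def)
  next
    fix i x assume i: "i \<in> {1..n}" and x: "x \<in> cantor_set"
    show "psi i x \<in> cantor_set" "idx (psi i x) = i" using pin[OF i x] ip[OF i x] .
    show "T (psi i x) = x" unfolding T_def ip[OF i x] by (rule inv[OF i])
  qed (rule idxc)
  then show ?thesis by (intro exI)
qed

lemma (in cantor_code) code_exists:
  assumes "x \<in> cantor_set" "\<And>j. w j \<in> {1..n}"
  shows "\<exists>y. y \<in> cantor_set \<and> (\<forall>j < k. idx ((T ^^ j) y) = w j) \<and> (T ^^ k) y = x"
  using assms(2)
proof (induction k arbitrary: w)
  case 0
  show ?case using assms(1) by (intro exI[of _ x]) simp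
next
  case (Suc k)
  from Suc.IH[of "\<lambda>j. w (Suc j)", OF Suc.prems] obtain y where
    y: "y \<in> cantor_set" "\<forall>j < k. idx ((T ^^ j) y) = w (Suc j)" "(T ^^ k) y = x" by (elim exE conjE)
  define z where "z = psi (w 0) y"
  have z: "T z = y" "idx z = w 0" "z \<in> cantor_set"
    unfolding z_def using T_psi[OF Suc.prems y(1)] idx_psi[OF Suc.prems y(1)] psi_in[OF Suc.prems y(1)] .
  have "idx ((T ^^ j) z) = w j" if "j < Suc k" for j
  proof (cases j)
    case (Suc i)
    then show ?thesis using that y(2) z by (simp del: funpow.simps(2) add: funpow_Suc_right)
  qed (simp add: z)
  moreover have "(T ^^ Suc k) z = x"
    using y(3) z by (simp del: funpow.simps(2) add: funpow_Suc_right)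
  ultimately show ?case using z(3) by (intro exI[of _ z]) simp
qed

lemma (in cantor_code) T_funpow_in: "x \<in> cantor_set \<Longrightarrow> (T ^^ k) x \<in> cantor_set"
  by (induction k) (auto intro: T_in)

lemma (in cantor_code) dist_same_code:
  assumes "x \<in> cantor_set" "y \<in> cantor_set" "\<And>j. j < k \<Longrightarrow> idx ((T ^^ j) x) = idx ((T ^^ j) y)"
  shows "\<bar>x - y\<bar> \<le> (1/3) ^ k"
  using assms
proof (induction k arbitrary: x y)
  case 0
  then show ?case
    using subsetD[OF cantor_set_subset, of x] subsetD[OF cantor_set_subset, of y] by auto
next
  case (Suc k)
  have "\<bar>T x - T y\<bar> \<le> (1/3) ^ k"
  proof (rule Suc.IH)
    fix j assume "j < k"
    then show "idx ((T ^^ j) (T x)) = idx ((T ^^ j) (T y))"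
      using Suc.prems(3)[of "Suc j"] by (simp del: funpow.simps(2) add: funpow_Suc_right)
  qed (use Suc.prems(1,2) T_in in blast)+
  moreover have "x = psi (idx x) (T x)" "y = psi (idx x) (T y)"
    using psi_T[of x] psi_T[of y] Suc.prems(1,2) Suc.prems(3)[of 0] by simp_all
  ultimately show ?case
    using psi_contr[OF idx_in[OF Suc.prems(1)], of "T x" "T y"] by simp
qed

subsection \<open>Skew products over the Cantor set\<close>

text \<open>\<open>G i\<close> is the lift to a vertical strip of an inverse branch of a covering of
  degree \<open>e i\<close>: \<open>G_per\<close> is the deck relation, and \<open>G_lin\<close>
  keeps the branch at bounded distance from the division by \<open>e i\<close>. Disjointness is
  required of the real parts, that is, of the radii.\<close>

locale circle_ifs = cantor_code n psi idx T for n psi idx T +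
  fixes e :: "nat \<Rightarrow> int" and G :: "nat \<Rightarrow> complex \<Rightarrow> complex" and lo hi \<kappa> B :: real
  assumes lo_le_hi: "lo \<le> hi"
    and G_in: "i \<in> {1..n} \<Longrightarrow> Re w \<in> {lo..hi} \<Longrightarrow> Re (G i w) \<in> {lo..hi}"
    and \<kappa>: "0 \<le> \<kappa>" "\<kappa> < 1"
    and G_contr: "i \<in> {1..n} \<Longrightarrow> Re w \<in> {lo..hi} \<Longrightarrow> Re w' \<in> {lo..hi} \<Longrightarrow>
       cmod (G i w - G i w') \<le> \<kappa> * cmod (w - w')"
    and G_inj: "i \<in> {1..n} \<Longrightarrow> Re w \<in> {lo..hi} \<Longrightarrow> Re w' \<in> {lo..hi} \<Longrightarrow> G i w = G i w' \<Longrightarrow> w = w'"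
    and G_per: "i \<in> {1..n} \<Longrightarrow> Re w \<in> {lo..hi} \<Longrightarrow> G i (w + of_int (e i) * (2 * pi * \<i>)) = G i w + 2 * pi * \<i>"
    and G_disj: "i \<in> {1..n} \<Longrightarrow> j \<in> {1..n} \<Longrightarrow> Re w \<in> {lo..hi} \<Longrightarrow> Re w' \<in> {lo..hi} \<Longrightarrow>
       Re (G i w) = Re (G j w') \<Longrightarrow> i = j"
    and G_lin: "i \<in> {1..n} \<Longrightarrow> Re w \<in> {lo..hi} \<Longrightarrow> cmod (G i w - w / of_int (e i)) \<le> B"
    and e_ge: "i \<in> {1..n} \<Longrightarrow> \<bar>e i\<bar> \<ge> 2"
begin

text \<open>Picard iterates of the functional equation, started from the boundary line of the
  strip.\<close>

primrec Phi_approx :: "nat \<Rightarrow> real \<Rightarrow> real \<Rightarrow> complex" where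
  "Phi_approx 0 x t = Complex lo t"
| "Phi_approx (Suc k) x t = G (idx x) (Phi_approx k (T x) (real_of_int (e (idx x)) * t))"

text \<open>Chosen so that it bounds the initial distance \<open>\<bar>lo\<bar>\<close> from the
  imaginary axis and satisfies \<open>B + Bd / 2 \<le> Bd\<close>, since division by
  \<open>e i\<close> at least halves an error.\<close>

definition "Bd = 2 * B + \<bar>lo\<bar>"

lemma n_pos: "1 \<in> {1..n}"
  using idx_in[OF cantor_set_zero] by auto

lemma B_nonneg: "B \<ge> 0"
  by (rule order.trans[OF norm_ge_zero G_lin[OF n_pos, of "complex_of_real lo"]]) (use lo_le_hi in simp)

lemma Bd_nonneg: "Bd \<ge> 0"
  using B_nonneg by (simp add: Bd_def)

lemma Phi_approx_in: "x \<in> cantor_set \<Longrightarrow> Re (Phi_approx k x t) \<in> {lo..hi}"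
proof (induction k arbitrary: x t)
  case (Suc k)
  then show ?case using G_in[OF idx_in] T_in by simp
qed (use lo_le_hi in simp)

lemma Phi_approx_bound: "x \<in> cantor_set \<Longrightarrow> cmod (Phi_approx k x t - \<i> * t) \<le> Bd"
proof (induction k arbitrary: x t)
  case 0
  have "Complex lo t - \<i> * t = complex_of_real lo" by (simp add: complex_eq_iff)
  then show ?case using B_nonneg by (simp add: Bd_def)
next
  case (Suc k)
  define i w where "i = idx x" and "w = Phi_approx k (T x) (real_of_int (e i) * t)"
  have i: "i \<in> {1..n}" using idx_in Suc.prems by (simp add: i_def)
  have e: "\<bar>real_of_int (e i)\<bar> \<ge> 2" using e_ge[OF i] by linarith
  have w: "Re w \<in> {lo..hi}" unfolding w_def by (rule Phi_approx_in[OF T_in[OF Suc.prems]])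
  have "G i w - \<i> * t = (G i w - w / of_int (e i)) + (w - \<i> * (real_of_int (e i) * t)) / of_int (e i)"
    using e by (auto simp: field_simps)
  also have "cmod \<dots> \<le> B + cmod (w - \<i> * (real_of_int (e i) * t)) / \<bar>real_of_int (e i)\<bar>"
    by (rule order.trans[OF norm_triangle_ineq])
       (use G_lin[OF i w] in \<open>simp add: norm_divide\<close>)
  also have "cmod (w - \<i> * (real_of_int (e i) * t)) / \<bar>real_of_int (e i)\<bar> \<le> Bd / 2"
    using Suc.IH[OF T_in[OF Suc.prems], of "real_of_int (e i) * t"] e
    by (intro frac_le) (simp_all add: w_def Bd_nonneg)
  finally show ?case unfolding Bd_def Phi_approx.simps i_def[symmetric] w_def[symmetric]
    by (simp add: field_simps)
qed

text \<open>Both iterates begin with the same \<open>k\<close> branches, dictated by the code of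
  \<open>x\<close>. Behind these the two points are at most \<open>2 * Bd\<close> apart, because
  they are compared with the same point of the imaginary axis.\<close>

lemma Phi_approx_Cauchy:
  "x \<in> cantor_set \<Longrightarrow> cmod (Phi_approx (k + j) x t - Phi_approx k x t) \<le> \<kappa> ^ k * (2 * Bd)"
proof (induction k arbitrary: x t)
  case 0
  have "Phi_approx j x t - Phi_approx 0 x t = (Phi_approx j x t - \<i> * t) - (Phi_approx 0 x t - \<i> * t)"
    by simp
  then show ?case using Phi_approx_bound[OF 0, of j t] Phi_approx_bound[OF 0, of 0 t]
      norm_triangle_ineq4[of "Phi_approx j x t - \<i> * t" "Phi_approx 0 x t - \<i> * t"] by auto
next
  case (Suc k)
  have "cmod (Phi_approx (Suc k + j) x t - Phi_approx (Suc k) x t) \<le>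
     \<kappa> * cmod (Phi_approx (k + j) (T x) (real_of_int (e (idx x)) * t) - Phi_approx k (T x) (real_of_int (e (idx x)) * t))"
    using G_contr[OF idx_in[OF Suc.prems] Phi_approx_in[OF T_in[OF Suc.prems]] Phi_approx_in[OF T_in[OF Suc.prems]]]
    by simp
  also have "\<dots> \<le> \<kappa> * (\<kappa> ^ k * (2 * Bd))"
    using Suc.IH[OF T_in[OF Suc.prems]] \<kappa> by (intro mult_left_mono)
  finally show ?case by simp
qed

definition Phi :: "real \<Rightarrow> real \<Rightarrow> complex" where
  "Phi x t = lim (\<lambda>k. Phi_approx k x t)"

lemma Phi_approx_tendsto:
  assumes x: "x \<in> cantor_set"
  shows "(\<lambda>k. Phi_approx k x t) \<longlonglongrightarrow> Phi x t"
proof -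
  have lim0: "(\<lambda>k. \<kappa> ^ k * (2 * Bd)) \<longlonglongrightarrow> 0"
    using \<kappa> by (intro tendsto_mult_left_zero LIMSEQ_power_zero) auto
  have "Cauchy (\<lambda>k. Phi_approx k x t)"
  proof (rule metric_CauchyI)
    fix \<epsilon> :: real assume "\<epsilon> > 0"
    then have "eventually (\<lambda>k. \<kappa> ^ k * (2 * Bd) < \<epsilon> / 2) sequentially"
      by (intro order_tendstoD(2)[OF lim0]) simp
    then obtain N where N: "\<kappa> ^ N * (2 * Bd) < \<epsilon> / 2" by (auto simp: eventually_sequentially)
    have "dist (Phi_approx k x t) (Phi_approx N x t) < \<epsilon> / 2" if "k \<ge> N" for k
      using Phi_approx_Cauchy[OF x, of N "k - N" t] that N by (simp add: dist_norm)
    then show "\<exists>M. \<forall>m\<ge>M. \<forall>n\<ge>M. dist (Phi_approx m x t) (Phi_approx n x t) < \<epsilon>"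
      by (meson dist_triangle_half_l)
  qed
  then show ?thesis unfolding Phi_def by (simp add: Cauchy_convergent_iff convergent_LIMSEQ_iff)
qed

lemma Phi_approx_dist:
  assumes x: "x \<in> cantor_set"
  shows "cmod (Phi x t - Phi_approx k x t) \<le> \<kappa> ^ k * (2 * Bd)"
proof (rule tendsto_upperbound)
  show "(\<lambda>j. cmod (Phi_approx (k + j) x t - Phi_approx k x t)) \<longlonglongrightarrow> cmod (Phi x t - Phi_approx k x t)"
    using LIMSEQ_ignore_initial_segment[OF Phi_approx_tendsto[OF x, of t], of k]
    by (intro tendsto_intros) (simp add: add.commute)
qed (use Phi_approx_Cauchy[OF x] in auto)

lemma Phi_in: assumes "x \<in> cantor_set" shows "Re (Phi x t) \<in> {lo..hi}"
proof -
  have "(\<lambda>k. Re (Phi_approx k x t)) \<longlonglongrightarrow> Re (Phi x t)"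
    by (intro tendsto_intros Phi_approx_tendsto assms)
  then show ?thesis
    by (rule closed_sequentially[OF closed_atLeastAtMost, rotated]) (rule Phi_approx_in[OF assms])
qed

lemma Phi_bound: assumes "x \<in> cantor_set" shows "cmod (Phi x t - \<i> * t) \<le> Bd"
  by (rule tendsto_upperbound[OF tendsto_norm[OF tendsto_diff[OF Phi_approx_tendsto[OF assms] tendsto_const]]])
     (use Phi_approx_bound[OF assms] in auto)

lemma G_cont: "i \<in> {1..n} \<Longrightarrow> continuous_on {w. Re w \<in> {lo..hi}} (G i)"
  by (rule lipschitz_on_continuous_on[of \<kappa>])
     (use G_contr \<kappa> in \<open>auto simp: lipschitz_on_def dist_norm\<close>)

lemma Phi_eq:
  assumes x: "x \<in> cantor_set"
  shows "Phi x t = G (idx x) (Phi (T x) (real_of_int (e (idx x)) * t))"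
proof -
  have "(\<lambda>k. Phi_approx (Suc k) x t) \<longlonglongrightarrow> G (idx x) (Phi (T x) (real_of_int (e (idx x)) * t))"
    unfolding Phi_approx.simps
    by (rule continuous_on_tendsto_compose[OF G_cont[OF idx_in[OF x]] Phi_approx_tendsto[OF T_in[OF x]]])
       (use Phi_in[OF T_in[OF x]] Phi_approx_in[OF T_in[OF x]] in auto)
  moreover have "(\<lambda>k. Phi_approx (Suc k) x t) \<longlonglongrightarrow> Phi x t"
    by (rule LIMSEQ_Suc[OF Phi_approx_tendsto[OF x]])
  ultimately show ?thesis using LIMSEQ_unique by blast
qed

lemma Phi_approx_cont:
  "continuous_on (cantor_set \<times> UNIV) (\<lambda>p. Phi_approx k (fst p) (snd p))"
proof (induction k)
  case 0
  then show ?case by (auto simp: Complex_eq intro!: continuous_intros)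
next
  case (Suc k)
  have idxc: "continuous_on (cantor_set \<times> UNIV) (\<lambda>p::real \<times> real. idx (fst p))"
    by (rule continuous_on_compose2[OF idx_cont]) (auto intro!: continuous_intros)
  have Tc: "continuous_on (cantor_set \<times> UNIV) (\<lambda>p::real \<times> real. T (fst p))"
    by (rule continuous_on_compose2[OF T_cont]) (auto intro!: continuous_intros)
  show ?case unfolding Phi_approx.simps
  proof (rule continuous_on_discrete_index[OF idxc, where f = "\<lambda>i p. G i (Phi_approx k (T (fst p)) (real_of_int (e i) * snd p))"])
    fix i assume "i \<in> (\<lambda>p::real \<times> real. idx (fst p)) ` (cantor_set \<times> UNIV)"
    then have i: "i \<in> {1..n}" using idx_in by auto
    have "continuous_on (cantor_set \<times> UNIV) (\<lambda>p::real \<times> real. (T (fst p), real_of_int (e i) * snd p))"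
      by (intro continuous_intros Tc)
    then have "continuous_on (cantor_set \<times> UNIV) (\<lambda>p. Phi_approx k (T (fst p)) (real_of_int (e i) * snd p))"
      using continuous_on_compose2[OF Suc.IH, of "cantor_set \<times> UNIV" "\<lambda>p. (T (fst p), real_of_int (e i) * snd p)"] T_in
      by fastforce
    then show "continuous_on (cantor_set \<times> UNIV) (\<lambda>p. G i (Phi_approx k (T (fst p)) (real_of_int (e i) * snd p)))"
      by (rule continuous_on_compose2[OF G_cont[OF i]]) (use Phi_approx_in T_in in force)
  qed
qed

lemma Phi_cont: "continuous_on (cantor_set \<times> UNIV) (\<lambda>p. Phi (fst p) (snd p))"
proof (rule uniform_limit_theorem)
  have lim0: "(\<lambda>k. \<kappa> ^ k * (2 * Bd)) \<longlonglongrightarrow> 0"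
    using \<kappa> by (intro tendsto_mult_left_zero LIMSEQ_power_zero) auto
  show "uniform_limit (cantor_set \<times> UNIV) (\<lambda>k p. Phi_approx k (fst p) (snd p)) (\<lambda>p. Phi (fst p) (snd p)) sequentially"
  proof (rule uniform_limitI)
    fix \<epsilon> :: real assume "\<epsilon> > 0"
    then have "eventually (\<lambda>k. \<kappa> ^ k * (2 * Bd) < \<epsilon>) sequentially"
      using order_tendstoD(2)[OF lim0] by simp
    then show "\<forall>\<^sub>F k in sequentially. \<forall>p\<in>cantor_set \<times> UNIV.
        dist (Phi_approx k (fst p) (snd p)) (Phi (fst p) (snd p)) < \<epsilon>"
    proof eventually_elim
      case (elim k)
      have "dist (Phi_approx k x t) (Phi x t) < \<epsilon>" if "x \<in> cantor_set" for x t
        using Phi_approx_dist[OF that, of t k] elim by (simp add: dist_norm norm_minus_commute)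
      then show ?case by auto
    qed
  qed
qed (use Phi_approx_cont in auto)

lemma G_per_int:
  assumes i: "i \<in> {1..n}" and w: "Re w \<in> {lo..hi}"
  shows "G i (w + of_int (e i * q) * (2 * pi * \<i>)) = G i w + of_int q * (2 * pi * \<i>)"
proof (induction q rule: int_induct[where k = 0])
  case (step1 q)
  have "Re (w + of_int (e i * q) * (2 * pi * \<i>)) \<in> {lo..hi}" using w by simp
  from G_per[OF i this] step1 show ?case by (simp add: algebra_simps)
next
  case (step2 q)
  have "Re (w + of_int (e i * (q - 1)) * (2 * pi * \<i>)) \<in> {lo..hi}" using w by simp
  from G_per[OF i this] step2 show ?case by (simp add: algebra_simps)
qed simp

lemma Phi_approx_period:
  "x \<in> cantor_set \<Longrightarrow> Phi_approx k x (t + 2 * pi * of_int q) = Phi_approx k x t + of_int q * (2 * pi * \<i>)"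
proof (induction k arbitrary: x t q)
  case (Suc k)
  have *: "real_of_int (e i) * (t + 2 * pi * of_int q) = real_of_int (e i) * t + 2 * pi * of_int (e i * q)" for i
    by (simp add: algebra_simps)
  show ?case unfolding Phi_approx.simps * Suc.IH[OF T_in[OF Suc.prems]]
    by (rule G_per_int[OF idx_in[OF Suc.prems] Phi_approx_in[OF T_in[OF Suc.prems]]])
qed (simp add: complex_eq_iff)

lemma Phi_period:
  assumes x: "x \<in> cantor_set"
  shows "Phi x (t + 2 * pi * of_int q) = Phi x t + of_int q * (2 * pi * \<i>)"
proof (rule LIMSEQ_unique[OF Phi_approx_tendsto[OF x]])
  show "(\<lambda>k. Phi_approx k x (t + 2 * pi * of_int q)) \<longlonglongrightarrow> Phi x t + of_int q * (2 * pi * \<i>)"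
    unfolding Phi_approx_period[OF x] by (intro tendsto_intros Phi_approx_tendsto x)
qed

text \<open>Equal values have equal first symbols because the images of the branches are disjoint,
  and then equal arguments because the branch is injective. Each such round gains a factor 1/3 in
  \<open>x\<close> and, as \<open>\<bar>e i\<bar> \<ge> 2\<close>, a factor 1/2 in \<open>t\<close>;
  the distance from the imaginary axis bounds the start.\<close>

lemma Phi_inj_approx:
  "\<lbrakk>x \<in> cantor_set; x' \<in> cantor_set; Phi x t = Phi x' t'\<rbrakk> \<Longrightarrow> \<bar>x - x'\<bar> \<le> (1/3) ^ k \<and> \<bar>t - t'\<bar> \<le> 2 * Bd / 2 ^ k"
proof (induction k arbitrary: x x' t t')
  case 0
  have "\<i> * (t - t') = (Phi x' t' - \<i> * t') - (Phi x t - \<i> * t)"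
    using 0 by (simp add: algebra_simps)
  then have "cmod (\<i> * complex_of_real (t - t')) \<le> 2 * Bd"
    using norm_triangle_ineq4[of "Phi x' t' - \<i> * t'" "Phi x t - \<i> * t"] Phi_bound[OF 0(1), of t] Phi_bound[OF 0(2), of t']
    by simp
  then have "\<bar>t - t'\<bar> \<le> 2 * Bd" unfolding norm_mult norm_of_real by simp
  then show ?case
    using subsetD[OF cantor_set_subset 0(1)] subsetD[OF cantor_set_subset 0(2)] by auto
next
  case (Suc k)
  define i w w' where "i = idx x" and "w = Phi (T x) (real_of_int (e (idx x)) * t)" and "w' = Phi (T x') (real_of_int (e (idx x')) * t')"
  have w: "Re w \<in> {lo..hi}" "Re w' \<in> {lo..hi}" unfolding w_def w'_def using Phi_in T_in Suc.prems by auto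
  have eq: "G (idx x) w = G (idx x') w'" using Suc.prems Phi_eq[of x t] Phi_eq[of x' t'] by (simp add: w_def w'_def)
  then have i': "idx x' = i"
    using G_disj[OF idx_in[OF Suc.prems(1)] idx_in[OF Suc.prems(2)] w] by (simp add: i_def)
  have i: "i \<in> {1..n}" using idx_in Suc.prems i_def by blast
  have "w = w'" using G_inj[OF i w] eq i' i_def by simp
  then have IH: "\<bar>T x - T x'\<bar> \<le> (1/3) ^ k" "\<bar>real_of_int (e i) * t - real_of_int (e i) * t'\<bar> \<le> 2 * Bd / 2 ^ k"
    using Suc.IH[OF T_in[OF Suc.prems(1)] T_in[OF Suc.prems(2)], of "real_of_int (e i) * t" "real_of_int (e i) * t'"] i'
    by (simp_all add: w_def w'_def i_def)
  have "x = psi i (T x)" "x' = psi i (T x')" using psi_T Suc.prems i' i_def by metis+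
  then have 1: "\<bar>x - x'\<bar> \<le> (1/3) ^ Suc k" using psi_contr[OF i, of "T x" "T x'"] IH(1) by simp
  have "2 * \<bar>t - t'\<bar> \<le> \<bar>real_of_int (e i)\<bar> * \<bar>t - t'\<bar>" using e_ge[OF i] by (intro mult_right_mono) linarith+
  also have "\<dots> = \<bar>real_of_int (e i) * t - real_of_int (e i) * t'\<bar>" by (simp add: abs_mult[symmetric] right_diff_distrib)
  finally have "\<bar>t - t'\<bar> \<le> 2 * Bd / 2 ^ Suc k" using IH(2) by simp
  with 1 show ?case by simp
qed

lemma Phi_inj:
  assumes "x \<in> cantor_set" "x' \<in> cantor_set" "Phi x t = Phi x' t'"
  shows "x = x'" "t = t'"
proof -
  have "(\<lambda>k. (1/3 :: real) ^ k) \<longlonglongrightarrow> 0" by (intro LIMSEQ_power_zero) auto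
  then have "\<bar>x - x'\<bar> \<le> 0"
    by (rule tendsto_lowerbound) (use Phi_inj_approx[OF assms] in auto)
  then show "x = x'" by simp
  have "(\<lambda>k. 2 * Bd * (1/2 :: real) ^ k) \<longlonglongrightarrow> 0"
    by (intro tendsto_mult_right_zero LIMSEQ_power_zero) auto
  then have "\<bar>t - t'\<bar> \<le> 0"
    by (rule tendsto_lowerbound) (use Phi_inj_approx[OF assms] in \<open>auto simp: power_divide\<close>)
  then show "t = t'" by simp
qed

definition theta :: "real \<Rightarrow> real \<Rightarrow> complex" where "theta x t = exp (Phi x t)"

lemma theta_eq_iff:
  assumes "x \<in> cantor_set" "x' \<in> cantor_set"
  shows "theta x t = theta x' t' \<longleftrightarrow> x = x' \<and> (\<exists>q::int. t = t' + 2 * pi * q)"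
proof
  assume "theta x t = theta x' t'"
  then obtain q :: int where "Phi x t = Phi x' t' + of_int q * (2 * pi * \<i>)"
    unfolding theta_def exp_eq by (auto simp: mult_ac)
  then have "Phi x t = Phi x' (t' + 2 * pi * of_int q)" using Phi_period assms by simp
  then show "x = x' \<and> (\<exists>q::int. t = t' + 2 * pi * q)" using Phi_inj assms by blast
next
  assume "x = x' \<and> (\<exists>q::int. t = t' + 2 * pi * q)"
  then show "theta x t = theta x' t'"
    using Phi_period[OF assms(2)] by (auto simp: theta_def exp_add exp_integer_2pi mult_ac)
qed

lemma theta_cont: "continuous_on (cantor_set \<times> UNIV) (\<lambda>p. theta (fst p) (snd p))"
  unfolding theta_def by (intro continuous_intros Phi_cont)

end

text \<open>\<open>f_G\<close> makes the branches sections of \<open>f\<close>;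
  \<open>f_stay\<close> is the converse that ties them to the dynamics: a point of the annulus whose
  image is again in the annulus comes from one of the branches. The point \<open>w'\<close> only
  expresses that the image is there.\<close>

locale circle_dyn = circle_ifs +
  fixes f :: "complex \<Rightarrow> complex"
  assumes f_G: "i \<in> {1..n} \<Longrightarrow> Re w \<in> {lo..hi} \<Longrightarrow> f (exp (G i w)) = exp w"
    and f_stay: "Re w \<in> {lo..hi} \<Longrightarrow> f (exp w) = exp w' \<Longrightarrow> Re w' \<in> {lo..hi} \<Longrightarrow>
       \<exists>i \<in> {1..n}. \<exists>v. Re v \<in> {lo..hi} \<and> w = G i v \<and> exp v = f (exp w)"
begin

lemma f_theta: "x \<in> cantor_set \<Longrightarrow> f (theta x t) = theta (T x) (real_of_int (e (idx x)) * t)"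
  unfolding theta_def using Phi_eq[of x t] f_G[OF idx_in Phi_in[OF T_in]] by simp

text \<open>The degree along an orbit of circles is a product of factors of modulus at least 2. Its
  growth is what later destroys equicontinuity.\<close>

lemma f_funpow_theta:
  assumes "x \<in> cantor_set"
  shows "\<exists>E::int. \<bar>E\<bar> \<ge> 2 ^ k \<and> (\<forall>t. (f ^^ k) (theta x t) = theta ((T ^^ k) x) (of_int E * t))"
proof (induction k)
  case (Suc k)
  then obtain E :: int where E: "\<bar>E\<bar> \<ge> 2 ^ k" "\<And>t. (f ^^ k) (theta x t) = theta ((T ^^ k) x) (of_int E * t)" by blast
  let ?e = "e (idx ((T ^^ k) x))"
  have "\<bar>?e\<bar> \<ge> 2" using e_ge[OF idx_in[OF T_funpow_in[OF assms]]] .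
  then have "\<bar>?e * E\<bar> \<ge> 2 ^ Suc k" unfolding abs_mult power_Suc using E(1) by (intro mult_mono) auto
  moreover have "(f ^^ Suc k) (theta x t) = theta ((T ^^ Suc k) x) (of_int (?e * E) * t)" for t
    using E(2) f_theta[OF T_funpow_in[OF assms]] by (simp add: mult.assoc)
  ultimately show ?case by (intro exI[of _ "?e * E"]) simp
qed (simp, rule exI[of _ 1], simp)

definition "Lam = (\<lambda>p. theta (fst p) (snd p)) ` (cantor_set \<times> UNIV)"

lemma Lam_eq: "Lam = (\<lambda>p. theta (fst p) (snd p)) ` (cantor_set \<times> {0..2*pi})"
proof -
  have "theta x t \<in> (\<lambda>p. theta (fst p) (snd p)) ` (cantor_set \<times> {0..2*pi})" if "x \<in> cantor_set" for x t
  proof -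
    obtain s and q :: int where s: "s \<in> {0..2*pi}" "t = s + 2 * pi * q" using reduce_angle[of t] by blast
    then have "theta x t = theta x s" unfolding theta_eq_iff[OF that that] by blast
    then show ?thesis using that s(1) by (intro image_eqI[of _ _ "(x, s)"]) auto
  qed
  then show ?thesis unfolding Lam_def by (intro equalityI image_mono subsetI) auto
qed

lemma compact_Lam: "compact Lam"
  unfolding Lam_eq
  by (intro compact_continuous_image continuous_on_subset[OF theta_cont] compact_Times compact_cantor_set compact_Icc) auto

lemma Lam_nonzero: "0 \<notin> Lam"
  by (auto simp: Lam_def theta_def)

text \<open>A point that never leaves the annulus is approximated by the points of \<open>Lam\<close> that share a longer and
  longer initial piece of its itinerary.\<close>

lemma survivor_approx:
  assumes "x \<in> cantor_set"
    and "\<And>j. j \<le> k \<Longrightarrow> Re (w j) \<in> {lo..hi}"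
    and "\<And>j. j < k \<Longrightarrow> i j \<in> {1..n} \<and> w j = G (i j) (w (Suc j))"
  shows "\<exists>y t. y \<in> cantor_set \<and> cmod (w 0 - Phi y t) \<le> \<kappa> ^ k * (Bd + \<bar>hi\<bar> + \<bar>lo\<bar>)"
  using assms(2,3)
proof (induction k arbitrary: w i)
  case 0
  have *: "w 0 - Phi x (Im (w 0)) = complex_of_real (Re (w 0)) - (Phi x (Im (w 0)) - \<i> * Im (w 0))"
    by (simp add: complex_eq_iff)
  have "cmod (w 0 - Phi x (Im (w 0))) \<le> \<bar>Re (w 0)\<bar> + Bd"
    unfolding * by (rule order.trans[OF norm_triangle_ineq4]) (use Phi_bound[OF assms(1), of "Im (w 0)"] in simp)
  also have "\<dots> \<le> Bd + \<bar>hi\<bar> + \<bar>lo\<bar>" using 0(1)[of 0] by auto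
  finally show ?case using assms(1) by auto
next
  case (Suc k)
  obtain y t where y: "y \<in> cantor_set" "cmod (w 1 - Phi y t) \<le> \<kappa> ^ k * (Bd + \<bar>hi\<bar> + \<bar>lo\<bar>)"
  proof -
    have "\<exists>y t. y \<in> cantor_set \<and> cmod (w (Suc 0) - Phi y t) \<le> \<kappa> ^ k * (Bd + \<bar>hi\<bar> + \<bar>lo\<bar>)"
      by (rule Suc.IH[of "\<lambda>j. w (Suc j)" "\<lambda>j. i (Suc j)"]) (simp_all only: Suc.prems Suc_le_mono Suc_less_eq)
    then show ?thesis using that unfolding One_nat_def by (elim exE conjE)
  qed
  have i: "i 0 \<in> {1..n}" "w 0 = G (i 0) (w 1)" using Suc.prems(2)[of 0] by simp_all
  \<comment> \<open>The functional equation used backwards: prepending the symbol \<open>i 0\<close>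
    and dividing the angle by \<open>e (i 0)\<close> turns an approximation of \<open>w 1\<close>
    into one of \<open>w 0\<close>, improved by the factor \<open>\<kappa>\<close>.\<close>
  define y' where "y' = psi (i 0) y"
  have y': "y' \<in> cantor_set" "T y' = y" "idx y' = i 0"
    unfolding y'_def using psi_in[OF i(1) y(1)] T_psi[OF i(1) y(1)] idx_psi[OF i(1) y(1)] .
  have e: "e (i 0) \<noteq> 0" using e_ge[OF i(1)] by auto
  have "Phi y' (t / e (i 0)) = G (i 0) (Phi y t)" using Phi_eq[OF y'(1), of "t / e (i 0)"] y' e by simp
  then have "cmod (w 0 - Phi y' (t / e (i 0))) \<le> \<kappa> * cmod (w 1 - Phi y t)"
    using G_contr[OF i(1) Suc.prems(1)[of 1] Phi_in[OF y(1)]] i(2) by simp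
  also have "\<dots> \<le> \<kappa> * (\<kappa> ^ k * (Bd + \<bar>hi\<bar> + \<bar>lo\<bar>))" using y(2) \<kappa> by (intro mult_left_mono)
  finally show ?case using y'(1) by (intro exI[of _ y'] exI[of _ "t / e (i 0)"]) (simp add: mult.assoc)
qed

lemma survivor_in_Lam:
  assumes "\<And>k. \<exists>w. Re w \<in> {lo..hi} \<and> (f ^^ k) z = exp w"
  shows "z \<in> Lam"
proof -
  obtain w0 where w0: "Re w0 \<in> {lo..hi}" "z = exp w0" using assms[of 0] unfolding funpow_0 by (elim exE conjE)
  have step: "\<exists>v i. i \<in> {1..n} \<and> Re v \<in> {lo..hi} \<and> w = G i v \<and> exp v = (f ^^ Suc k) z"
    if "Re w \<in> {lo..hi}" "exp w = (f ^^ k) z" for w k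
  proof -
    obtain w' where "Re w' \<in> {lo..hi}" "f (exp w) = exp w'" 
    proof -
      obtain w' where "Re w' \<in> {lo..hi}" "(f ^^ Suc k) z = exp w'" using assms[of "Suc k"] by (elim exE conjE)
      then show ?thesis using that(1)[of w'] \<open>exp w = (f ^^ k) z\<close> by simp
    qed
    from f_stay[OF that(1) this(2,1)] obtain i v where
      "i \<in> {1..n}" "Re v \<in> {lo..hi}" "w = G i v" "exp v = f (exp w)" by (elim bexE exE conjE)
    then show ?thesis using that(2) by (intro exI[of _ v] exI[of _ i]) simp
  qed
  \<comment> \<open>Arbitrary logarithms of the orbit would satisfy the branch relation only up to
    multiples of the period. The logarithms are therefore chosen one after the other, each as the
    argument that the branch through its predecessor prescribes.\<close>
  have "\<exists>w. \<forall>k. (Re (w k) \<in> {lo..hi} \<and> exp (w k) = (f ^^ k) z) \<and> (\<exists>i \<in> {1..n}. w k = G i (w (Suc k)))"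
  proof (rule dependent_nat_choice)
    show "\<exists>w. Re w \<in> {lo..hi} \<and> exp w = (f ^^ 0) z" using w0 by (intro exI[of _ w0]) simp
  next
    fix w k assume "Re w \<in> {lo..hi} \<and> exp w = (f ^^ k) z"
    then show "\<exists>v. (Re v \<in> {lo..hi} \<and> exp v = (f ^^ Suc k) z) \<and> (\<exists>i \<in> {1..n}. w = G i v)"
      using step[of w k] by (elim conjE) blast
  qed
  then obtain w where w': "\<And>k. (Re (w k) \<in> {lo..hi} \<and> exp (w k) = (f ^^ k) z) \<and> (\<exists>i \<in> {1..n}. w k = G i (w (Suc k)))"
    by blast
  have w: "\<And>k. Re (w k) \<in> {lo..hi}" "exp (w 0) = z" using w'[of 0] w' by simp_all
  have "\<forall>k. \<exists>i. i \<in> {1..n} \<and> w k = G i (w (Suc k))" using w' by blast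
  then obtain i where i: "\<And>k. i k \<in> {1..n} \<and> w k = G (i k) (w (Suc k))" unfolding choice_iff by blast
  have "\<exists>y t. y \<in> cantor_set \<and> cmod (w 0 - Phi y t) \<le> \<kappa> ^ k * (Bd + \<bar>hi\<bar> + \<bar>lo\<bar>)" for k
    by (rule survivor_approx[of 0 k w i]) (rule cantor_set_zero w(1) i)+
  then have "\<forall>k. \<exists>p. fst p \<in> cantor_set \<and> cmod (w 0 - Phi (fst p) (snd p)) \<le> \<kappa> ^ k * (Bd + \<bar>hi\<bar> + \<bar>lo\<bar>)"
    by (metis fst_conv snd_conv)
  then obtain p where "\<forall>k. fst (p k) \<in> cantor_set \<and> cmod (w 0 - Phi (fst (p k)) (snd (p k))) \<le> \<kappa> ^ k * (Bd + \<bar>hi\<bar> + \<bar>lo\<bar>)"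
    unfolding choice_iff ..
  then obtain y t where y: "\<And>k. y k \<in> cantor_set" "\<And>k. cmod (w 0 - Phi (y k) (t k)) \<le> \<kappa> ^ k * (Bd + \<bar>hi\<bar> + \<bar>lo\<bar>)"
    using that[of "\<lambda>k. fst (p k)" "\<lambda>k. snd (p k)"] by simp
  have lim0: "(\<lambda>k. \<kappa> ^ k * (Bd + \<bar>hi\<bar> + \<bar>lo\<bar>)) \<longlonglongrightarrow> 0"
    using \<kappa> by (intro tendsto_mult_left_zero LIMSEQ_power_zero) auto
  have "(\<lambda>k. Phi (y k) (t k) - w 0) \<longlonglongrightarrow> 0"
    by (rule tendsto_0_le[OF lim0, of _ 1]) (use y(2) \<kappa> Bd_nonneg in \<open>auto simp: norm_minus_commute\<close>)
  then have "(\<lambda>k. exp (Phi (y k) (t k))) \<longlonglongrightarrow> exp (w 0)"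
    by (intro tendsto_intros) (simp add: LIM_zero_iff)
  then have "exp (w 0) \<in> Lam"
    by (rule closed_sequentially[OF compact_imp_closed[OF compact_Lam], rotated])
       (use y(1) in \<open>force simp: Lam_def theta_def\<close>)
  then show ?thesis using w by simp
qed

end

subsection \<open>Rational maps on the sphere\<close>

lemma mem_S2_iff: "P \<in> S2 \<longleftrightarrow> (cmod (fst P))\<^sup>2 + (snd P)\<^sup>2 = 1"
  by (cases P) (auto simp: S2_def norm_Pair real_sqrt_eq_1_iff)

lemma stereo_in_S2: "stereo z \<in> S2"
proof -
  define r where "r = (cmod z)\<^sup>2"
  have r: "1 + r > 0" by (simp add: r_def add_pos_nonneg)
  have "(cmod (fst (stereo z)))\<^sup>2 = (2 / (1 + r))\<^sup>2 * r"
    unfolding stereo_def fst_conv norm_mult norm_of_real power_mult_distrib r_def by simp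
  moreover have "snd (stereo z) = (r - 1) / (1 + r)" by (simp add: stereo_def r_def add.commute)
  moreover have "(2 / (1 + r))\<^sup>2 * r + ((r - 1) / (1 + r))\<^sup>2 = 1"
  proof -
    have "(2 / (1 + r))\<^sup>2 * r + ((r - 1) / (1 + r))\<^sup>2 = (4 * r + (r - 1)\<^sup>2) / (1 + r)\<^sup>2"
      by (simp add: power_divide add_divide_distrib)
    also have "4 * r + (r - 1)\<^sup>2 = (1 + r)\<^sup>2" by (simp add: power2_eq_square algebra_simps)
    finally show ?thesis using r by simp
  qed
  ultimately show ?thesis by (simp add: mem_S2_iff)
qed

lemma stereo_snd_less: "snd (stereo z) < 1"
proof -
  have "(cmod z)\<^sup>2 + 1 > 0" by (simp add: add_nonneg_pos)
  then show ?thesis by (simp add: stereo_def)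
qed

lemma stereo_neq_north: "stereo z \<noteq> north"
  using stereo_snd_less[of z] by (auto simp: north_def)

lemma north_in_S2: "north \<in> S2"
  by (simp add: mem_S2_iff north_def)

lemma unstereo_stereo [simp]: "unstereo (stereo z) = z"
proof -
  have r: "(cmod z)\<^sup>2 + 1 > 0" by (simp add: add_nonneg_pos)
  then have "1 - snd (stereo z) = 2 / (1 + (cmod z)\<^sup>2)" by (simp add: stereo_def field_simps)
  then have "unstereo (stereo z) = (complex_of_real (2 / (1 + (cmod z)\<^sup>2)) * z) / complex_of_real (2 / (1 + (cmod z)\<^sup>2))"
    by (simp add: unstereo_def stereo_def)
  moreover have "complex_of_real (2 / (1 + (cmod z)\<^sup>2)) \<noteq> 0"
    unfolding of_real_eq_0_iff using r by (auto simp: add.commute)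
  ultimately show ?thesis by simp
qed

lemma S2_snd_less: assumes "P \<in> S2" "P \<noteq> north" shows "snd P < 1"
proof (rule ccontr)
  assume *: "\<not> snd P < 1"
  have "(snd P)\<^sup>2 \<ge> 1" using * by simp
  then have "snd P = 1" "fst P = 0" using assms(1) * unfolding mem_S2_iff
    by (smt (verit) power2_eq_square mult_left_le_imp_le zero_le_power2 power2_eq_imp_eq one_power2,
        smt (verit) zero_less_norm_iff zero_less_power)
  then show False using assms(2) by (simp add: north_def prod_eq_iff)
qed

lemma cmod_unstereo:
  assumes "P \<in> S2" "P \<noteq> north" shows "(cmod (unstereo P))\<^sup>2 = (1 + snd P) / (1 - snd P)"
proof -
  have "(cmod (unstereo P))\<^sup>2 = (cmod (fst P))\<^sup>2 / (1 - snd P)\<^sup>2"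
    unfolding unstereo_def norm_divide norm_of_real power_divide by simp
  also have "(cmod (fst P))\<^sup>2 = (1 + snd P) * (1 - snd P)"
    using assms(1) unfolding mem_S2_iff by (simp add: algebra_simps power2_eq_square)
  finally show ?thesis using S2_snd_less[OF assms] by (simp add: power2_eq_square)
qed

lemma stereo_unstereo: assumes "P \<in> S2" "P \<noteq> north" shows "stereo (unstereo P) = P"
proof -
  define t where "t = snd P"
  have t: "t < 1" using S2_snd_less[OF assms] by (simp add: t_def)
  have n: "(cmod (unstereo P))\<^sup>2 = (1 + t) / (1 - t)" using cmod_unstereo[OF assms] by (simp add: t_def)
  have 1: "1 + (1 + t) / (1 - t) = 2 / (1 - t)" "(1 + t) / (1 - t) + 1 = 2 / (1 - t)"
    "(1 + t) / (1 - t) - 1 = 2 * t / (1 - t)" using t by (simp_all add: field_simps)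
  have "fst (stereo (unstereo P)) = complex_of_real (1 - t) * (fst P / complex_of_real (1 - t))"
    unfolding stereo_def fst_conv n 1 using t by (simp add: unstereo_def t_def)
  moreover have "snd (stereo (unstereo P)) = t" unfolding stereo_def snd_conv n 1 using t by simp
  ultimately show ?thesis using t by (simp add: prod_eq_iff t_def)
qed

lemma S2_cases:
  assumes "P \<in> S2"
  obtains "P = north" | z where "P = stereo z"
  using stereo_unstereo[OF assms] by metis

lemma stereo_inject: "stereo z = stereo w \<longleftrightarrow> z = w"
  by (metis unstereo_stereo)

lemma continuous_on_stereo: "continuous_on A stereo"
proof -
  have "1 + (cmod z)\<^sup>2 \<noteq> 0" "(cmod z)\<^sup>2 + 1 \<noteq> 0" for z
    using add_nonneg_pos[OF zero_le_power2[of "cmod z"], of 1] by linarith+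
  then show ?thesis unfolding stereo_def by (intro continuous_intros) auto
qed

lemma isCont_stereo: "isCont stereo z"
  using continuous_on_stereo[of UNIV] by (simp add: continuous_on_eq_continuous_at)

lemma isCont_unstereo: "snd P \<noteq> 1 \<Longrightarrow> isCont unstereo P"
proof -
  assume "snd P \<noteq> 1"
  then have "complex_of_real (1 - snd P) \<noteq> 0" unfolding of_real_eq_0_iff by simp
  then show ?thesis unfolding unstereo_def by (intro continuous_intros)
qed

lemma continuous_on_unstereo: "continuous_on (S2 - {north}) unstereo"
  by (intro continuous_at_imp_continuous_on ballI isCont_unstereo) (use S2_snd_less in force)

lemma stereo_tendsto_north: "(stereo \<longlongrightarrow> north) at_infinity"
proof -
  have "filterlim (\<lambda>z::complex. 1 + (cmod z)\<^sup>2) at_top at_infinity"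
    by (rule filterlim_tendsto_add_at_top[OF tendsto_const]) (intro filterlim_pow_at_top filterlim_norm_at_top, simp)
  then have inf: "filterlim (\<lambda>z::complex. (cmod z)\<^sup>2 + 1) at_top at_infinity" by (simp add: add.commute)
  have a: "((\<lambda>z::complex. 1 - 2 / ((cmod z)\<^sup>2 + 1)) \<longlongrightarrow> 1 - 0) at_infinity"
    by (intro tendsto_intros real_tendsto_divide_at_top[OF tendsto_const inf])
  have eq: "snd (stereo z) = 1 - 2 / ((cmod z)\<^sup>2 + 1)" for z
  proof -
    have "(cmod z)\<^sup>2 + 1 > 0" by (simp add: add_nonneg_pos)
    then show ?thesis by (simp add: stereo_def field_simps)
  qed
  have s: "((\<lambda>z. snd (stereo z)) \<longlongrightarrow> 1) at_infinity" using a unfolding eq by simp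
  have f2: "(cmod (fst (stereo z)))\<^sup>2 = 1 - (snd (stereo z))\<^sup>2" for z
    using stereo_in_S2[of z] unfolding mem_S2_iff by simp
  have "((\<lambda>z. sqrt (1 - (snd (stereo z))\<^sup>2)) \<longlongrightarrow> sqrt (1 - 1\<^sup>2)) at_infinity"
    by (intro tendsto_intros s)
  then have "((\<lambda>z. cmod (fst (stereo z))) \<longlongrightarrow> 0) at_infinity"
    unfolding f2[symmetric] by simp
  then have "((\<lambda>z. fst (stereo z)) \<longlongrightarrow> 0) at_infinity" by (simp add: tendsto_norm_zero_iff)
  from tendsto_Pair[OF this s] show ?thesis by (simp add: north_def)
qed

lemma filterlim_unstereo_at_infinity: "filterlim unstereo at_infinity (at north within S2)"
proof (rule filterlim_at_infinity[THEN iffD2, rule_format, of 0])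
  fix r :: real assume r: "r > 0"
  have "((\<lambda>P. snd P) \<longlongrightarrow> snd north) (at north within S2)" by (intro tendsto_intros)
  moreover have "(r\<^sup>2 - 1) / (r\<^sup>2 + 1) < snd north"
    using add_nonneg_pos[OF zero_le_power2[of r], of 1] by (simp add: north_def)
  ultimately have "\<forall>\<^sub>F P in at north within S2. (r\<^sup>2 - 1) / (r\<^sup>2 + 1) < snd P" by (rule order_tendstoD(1))
  moreover have "\<forall>\<^sub>F P in at north within S2. P \<in> S2 \<and> P \<noteq> north" by (simp add: eventually_at_filter)
  ultimately show "\<forall>\<^sub>F P in at north within S2. r \<le> cmod (unstereo P)"
  proof eventually_elim
    case (elim P)
    have l: "snd P < 1" using S2_snd_less elim by blast
    have "(r\<^sup>2 - 1) < snd P * (r\<^sup>2 + 1)"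
      using elim(1) add_nonneg_pos[OF zero_le_power2[of r], of 1] by (simp add: pos_divide_less_eq)
    then have "r\<^sup>2 * (1 - snd P) \<le> 1 + snd P" by (simp add: algebra_simps)
    then have "r\<^sup>2 \<le> (cmod (unstereo P))\<^sup>2"
      using cmod_unstereo[of P] elim l by (simp add: pos_le_divide_eq)
    then show ?case by (rule power2_le_imp_le) simp
  qed
qed simp

lemma filterlim_stereo_at: "filterlim stereo (at (stereo z) within (S2 - {north})) (at z)"
  using isCont_stereo[of z] stereo_in_S2 stereo_neq_north
  by (simp add: filterlim_at isCont_def eventually_at_filter stereo_inject)

lemma filterlim_unstereo_at: "filterlim unstereo (at z) (at (stereo z) within (S2 - {north}))"
proof -
  have "isCont unstereo (stereo z)" using isCont_unstereo stereo_snd_less by (metis less_irrefl)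
  then have "(unstereo \<longlongrightarrow> z) (at (stereo z) within (S2 - {north}))"
    unfolding isCont_def unstereo_stereo by (rule tendsto_within_subset) simp
  moreover have "\<forall>\<^sub>F P in at (stereo z) within (S2 - {north}). unstereo P \<noteq> z"
    unfolding eventually_at_filter
    by (rule always_eventually) (metis DiffD1 DiffD2 insertI1 stereo_unstereo)
  ultimately show ?thesis by (simp add: filterlim_at)
qed

lemma at_north_within: "at north within (S2 - {north}) = at north within S2"
  by (simp add: at_within_def)

lemma at_S2_neq_bot: assumes "P \<in> S2" shows "at P within (S2 - {north}) \<noteq> bot"
proof (cases rule: S2_cases[OF assms])
  case 1
  have "filterlim stereo (at north within (S2 - {north})) at_infinity"
    using stereo_tendsto_north stereo_neq_north stereo_in_S2 by (simp add: filterlim_at)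
  then show ?thesis unfolding 1 by (metis filterlim_def bot_unique filtermap_bot_iff trivial_limit_at_infinity)
next
  case (2 z)
  show ?thesis using filterlim_stereo_at[of z] unfolding 2 by (metis filterlim_def bot_unique filtermap_bot_iff at_neq_bot)
qed

lemma sphere_ext_stereo_limit:
  assumes "((\<lambda>z. stereo (f z)) \<longlongrightarrow> l) (at z)"
  shows "sphere_ext f (stereo z) = l"
  unfolding sphere_ext_def
  by (rule tendsto_Lim[OF at_S2_neq_bot[OF stereo_in_S2] filterlim_compose[OF assms filterlim_unstereo_at]])

lemma sphere_ext_stereo: "isCont f z \<Longrightarrow> sphere_ext f (stereo z) = stereo (f z)"
  using isCont_tendsto_compose[OF isCont_stereo] by (intro sphere_ext_stereo_limit) (auto simp: isCont_def)

lemma sphere_ext_pole: "filterlim f at_infinity (at z) \<Longrightarrow> sphere_ext f (stereo z) = north"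
  by (intro sphere_ext_stereo_limit filterlim_compose[OF stereo_tendsto_north])

lemma sphere_ext_north_limit:
  assumes "((\<lambda>z. stereo (f z)) \<longlongrightarrow> l) at_infinity"
  shows "sphere_ext f north = l"
  unfolding sphere_ext_def at_north_within
  using at_S2_neq_bot[OF north_in_S2] unfolding at_north_within
  by (rule tendsto_Lim[OF _ filterlim_compose[OF assms filterlim_unstereo_at_infinity]])

lemma sphere_ext_north: "(f \<longlongrightarrow> w) at_infinity \<Longrightarrow> sphere_ext f north = stereo w"
  by (intro sphere_ext_north_limit isCont_tendsto_compose[OF isCont_stereo])

lemma sphere_ext_north_pole: "filterlim f at_infinity at_infinity \<Longrightarrow> sphere_ext f north = north"
  by (intro sphere_ext_north_limit filterlim_compose[OF stereo_tendsto_north])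

text \<open>\<open>sphere_ext\<close> is defined by limits, so what is used of a rational map is
  that these exist at every point of the sphere: finite values off \<open>X\<close>, infinity on
  \<open>X\<close>, and either kind at infinity.\<close>

locale sphere_map =
  fixes f :: "complex \<Rightarrow> complex" and X :: "complex set"
  assumes finite_poles: "finite X"
    and regular: "z \<notin> X \<Longrightarrow> isCont f z"
    and pole: "z \<in> X \<Longrightarrow> filterlim f at_infinity (at z)"
    and at_inf: "(\<exists>w. (f \<longlongrightarrow> w) at_infinity) \<or> filterlim f at_infinity at_infinity"
begin

lemma sphere_ext_regular: "z \<notin> X \<Longrightarrow> sphere_ext f (stereo z) = stereo (f z)"
  by (rule sphere_ext_stereo[OF regular])

lemma sphere_ext_X: "z \<in> X \<Longrightarrow> sphere_ext f (stereo z) = north"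
  by (rule sphere_ext_pole[OF pole])

lemma sphere_ext_limit:
  assumes "P \<in> S2"
  shows "((\<lambda>Q. stereo (f (unstereo Q))) \<longlongrightarrow> sphere_ext f P) (at P within (S2 - {north}))"
proof (cases rule: S2_cases[OF assms])
  case 1
  have "\<exists>l. ((\<lambda>z. stereo (f z)) \<longlongrightarrow> l) at_infinity"
    using at_inf isCont_tendsto_compose[OF isCont_stereo] filterlim_compose[OF stereo_tendsto_north] by blast
  then obtain l where l: "((\<lambda>z. stereo (f z)) \<longlongrightarrow> l) at_infinity" by blast
  show ?thesis unfolding 1 sphere_ext_north_limit[OF l] at_north_within
    by (rule filterlim_compose[OF l filterlim_unstereo_at_infinity])
next
  case (2 z)
  have "\<exists>l. ((\<lambda>z. stereo (f z)) \<longlongrightarrow> l) (at z)"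
  proof (cases "z \<in> X")
    case True
    then show ?thesis using pole filterlim_compose[OF stereo_tendsto_north] by blast
  next
    case False
    then show ?thesis using regular isCont_tendsto_compose[OF isCont_stereo] unfolding isCont_def by blast
  qed
  then obtain l where l: "((\<lambda>z. stereo (f z)) \<longlongrightarrow> l) (at z)" by blast
  show ?thesis unfolding 2 sphere_ext_stereo_limit[OF l]
    by (rule filterlim_compose[OF l filterlim_unstereo_at])
qed

lemma sphere_ext_in_S2: "P \<in> S2 \<Longrightarrow> sphere_ext f P \<in> S2"
proof -
  assume P: "P \<in> S2"
  have "closed S2" by (simp add: S2_def)
  then show ?thesis
    by (rule Lim_in_closed_set[OF _ _ at_S2_neq_bot[OF P] sphere_ext_limit[OF P]]) (simp add: stereo_in_S2)
qed

lemma continuous_on_sphere_ext: "continuous_on S2 (sphere_ext f)"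
  unfolding continuous_on_def
proof
  fix P assume P: "P \<in> S2"
  have fin: "finite (stereo ` X \<union> {P})" using finite_poles by simp
  \<comment> \<open>Poles are isolated: near \<open>P\<close>, apart from \<open>P\<close> itself,
    the extension is given by the formula, and the limit of the formula is the value at
    \<open>P\<close> by definition.\<close>
  have "\<forall>\<^sub>F Q in at P within (S2 - {north}). Q \<notin> stereo ` X \<union> {P}"
  proof -
    have "open (- (stereo ` X - {P}))" using finite_poles by (intro open_Compl finite_imp_closed) simp
    then have "\<forall>\<^sub>F Q in nhds P. Q \<in> - (stereo ` X - {P})" by (rule eventually_nhds_in_open) simp
    then show ?thesis unfolding eventually_at_filter by eventually_elim auto
  qed
  moreover have "\<forall>\<^sub>F Q in at P within (S2 - {north}). Q \<in> S2 - {north}" by (simp add: eventually_at_filter)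
  ultimately have "\<forall>\<^sub>F Q in at P within (S2 - {north}). stereo (f (unstereo Q)) = sphere_ext f Q"
  proof eventually_elim
    case (elim Q)
    then have "Q = stereo (unstereo Q)" using stereo_unstereo by simp
    then show ?case using sphere_ext_regular[of "unstereo Q"] elim(1) by (metis UnCI image_eqI)
  qed
  with sphere_ext_limit[OF P] have *: "(sphere_ext f \<longlongrightarrow> sphere_ext f P) (at P within (S2 - {north}))"
    by (rule Lim_transform_eventually)
  show "(sphere_ext f \<longlongrightarrow> sphere_ext f P) (at P within S2)"
  proof (cases "P = north")
    case True
    then show ?thesis using * at_north_within by simp
  next
    case False
    then have "at P within (S2 - {north}) = at P within S2"
      by (intro at_within_nhd[where S = "- {north}"]) auto
    then show ?thesis using * by simp
  qed
qed

lemma funpow_sphere_ext_in_S2: "P \<in> S2 \<Longrightarrow> (sphere_ext f ^^ k) P \<in> S2"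
  by (induction k) (auto intro: sphere_ext_in_S2)

lemma continuous_on_funpow_sphere_ext: "continuous_on S2 (sphere_ext f ^^ k)"
  by (rule continuous_on_funpow[OF continuous_on_sphere_ext sphere_ext_in_S2])

end

subsection \<open>Fatou and Julia sets\<close>

text \<open>The index sequences in the definition of normality are arbitrary, not increasing, so
  repetitions have to be treated. For a bounded sequence only the first alternative is
  possible.\<close>

lemma constant_or_divergent_subseq:
  fixes r :: "nat \<Rightarrow> nat"
  shows "(\<exists>v. \<exists>s :: nat \<Rightarrow> nat. strict_mono s \<and> (\<forall>k. r (s k) = v)) \<or> filterlim r at_top sequentially"
proof (cases "\<exists>v. infinite {k. r k = v}")
  case True
  then obtain v where "infinite {k. r k = v}" by blast
  from infinite_enumerate[OF this] obtain s :: "nat \<Rightarrow> nat" where "strict_mono s" "\<forall>k. r (s k) = v" by auto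
  then show ?thesis by (intro disjI1 exI conjI)
next
  case False
  have "\<forall>\<^sub>F k in sequentially. r k > v" for v
  proof -
    have "finite (\<Union>u\<in>{..v}. {k. r k = u})" using False by auto
    then have "finite {k. r k \<le> v}" by (rule rev_finite_subset) auto
    then show ?thesis by (simp add: eventually_cofinite not_less flip: cofinite_eq_sequentially)
  qed
  then have "filterlim r at_top sequentially"
    unfolding filterlim_at_top by (meson eventually_mono less_imp_le)
  then show ?thesis ..
qed

text \<open>The compactness of the sphere makes the constants \<open>p k\<close> converge along a
  subsequence. They may vary with \<open>k\<close> because an escaping orbit can alternate between
  neighbourhoods of \<open>0\<close> and infinity.\<close>

lemma fatouI:
  assumes P: "P \<in> S2" "P \<in> U" and U: "open U"
    and conv: "\<And>Q k. Q \<in> U \<inter> S2 \<Longrightarrow> k \<ge> N \<Longrightarrow> dist ((F ^^ k) Q) (p k) \<le> b k"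
    and b: "b \<longlonglongrightarrow> (0::real)" and p: "\<And>k. p k \<in> S2"
  shows "P \<in> fatou F"
proof -
  have "\<exists>s g. strict_mono s \<and> (\<forall>C. compact C \<and> C \<subseteq> U \<inter> S2 \<longrightarrow>
          uniform_limit C (\<lambda>k. F ^^ r (s k)) g sequentially)" for r :: "nat \<Rightarrow> nat"
    using constant_or_divergent_subseq[of r]
  proof
    assume "\<exists>v. \<exists>s :: nat \<Rightarrow> nat. strict_mono s \<and> (\<forall>k. r (s k) = v)"
    then obtain v and s :: "nat \<Rightarrow> nat" where "strict_mono s" "\<forall>k. r (s k) = v" by (elim exE conjE)
    then show ?thesis by (intro exI[of _ s] exI[of _ "F ^^ v"]) (simp add: uniform_limit_const)
  next
    assume r: "filterlim r at_top sequentially"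
    have "compact S2" by (simp add: S2_def)
    moreover have "\<forall>k. p (r k) \<in> S2" using p by blast
    ultimately obtain q s where s: "strict_mono s" "((\<lambda>k. p (r k)) \<circ> s) \<longlonglongrightarrow> q"
      unfolding compact_def by metis
    have rs: "filterlim (\<lambda>k. r (s k)) at_top sequentially"
      by (rule filterlim_compose[OF r filterlim_subseq[OF s(1)]])
    have ul: "uniform_limit C (\<lambda>k. F ^^ r (s k)) (\<lambda>_. q) sequentially" if C: "C \<subseteq> U \<inter> S2" for C
    proof (rule uniform_limitI)
      fix \<epsilon> :: real assume \<epsilon>: "\<epsilon> > 0"
      have "(\<lambda>k. b (r (s k))) \<longlonglongrightarrow> 0" by (rule filterlim_compose[OF b rs])
      then have "\<forall>\<^sub>F k in sequentially. b (r (s k)) < \<epsilon> / 2" by (rule order_tendstoD(2)) (use \<epsilon> in simp)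
      moreover have "\<forall>\<^sub>F k in sequentially. dist (p (r (s k))) q < \<epsilon> / 2"
        using s(2) \<epsilon> unfolding o_def by (intro tendstoD) auto
      moreover have "\<forall>\<^sub>F k in sequentially. r (s k) \<ge> N"
        using rs by (auto simp: filterlim_at_top)
      ultimately show "\<forall>\<^sub>F k in sequentially. \<forall>x\<in>C. dist ((F ^^ r (s k)) x) q < \<epsilon>"
      proof eventually_elim
        case (elim k)
        show ?case
        proof
          fix x assume "x \<in> C"
          then have "dist ((F ^^ r (s k)) x) (p (r (s k))) \<le> b (r (s k))" using conv C elim by blast
          then show "dist ((F ^^ r (s k)) x) q < \<epsilon>"
            using elim dist_triangle[of "(F ^^ r (s k)) x" q "p (r (s k))"] by linarith
        qed
      qed
    qed
    show ?thesis using s(1) ul by blast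
  qed
  then have "normal_iterates_on F (U \<inter> S2)" unfolding normal_iterates_on_def by blast
  then show ?thesis unfolding fatou_def using P U by blast
qed

lemma open_fatou: "openin (top_of_set S2) (fatou F)"
proof (subst openin_subopen, intro ballI)
  fix P assume "P \<in> fatou F"
  then obtain U where U: "P \<in> S2" "open U" "P \<in> U" "normal_iterates_on F (U \<inter> S2)" by (auto simp: fatou_def)
  then show "\<exists>T. openin (top_of_set S2) T \<and> P \<in> T \<and> T \<subseteq> fatou F"
    by (intro exI[of _ "S2 \<inter> U"]) (auto simp: fatou_def)
qed

lemma closed_julia: "closed (julia F)"
proof -
  have "closedin (top_of_set S2) (julia F)"
    unfolding julia_def using open_fatou by (intro closedin_diff) auto
  moreover have "closed S2" by (simp add: S2_def)
  ultimately show ?thesis using closedin_closed_trans by blast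
qed

lemma julia_subset: "julia F \<subseteq> S2"
  by (auto simp: julia_def)

section \<open>The family of circles on the sphere, and expansion along them\<close>

lemma cis_Arg_unit: "cmod u = 1 \<Longrightarrow> cis (Arg u) = u"
  by (cases "u = 0") (simp_all add: cis_Arg sgn_eq)

context circle_ifs
begin

definition circ :: "real \<Rightarrow> complex \<Rightarrow> complex" where
  "circ x u = theta x (Arg u)"

lemma circ_cis: "x \<in> cantor_set \<Longrightarrow> circ x (cis t) = theta x t"
proof -
  assume x: "x \<in> cantor_set"
  have "cis (Arg (cis t)) = cis t" by (simp add: cis_Arg)
  then have "exp (\<i> * Arg (cis t)) = exp (\<i> * t)" by (simp add: cis_conv_exp)
  then obtain q :: int where "\<i> * Arg (cis t) = \<i> * t + of_int (2 * q) * pi * \<i>"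
    unfolding exp_eq by auto
  then have "Im (\<i> * Arg (cis t)) = Im (\<i> * t + of_int (2 * q) * pi * \<i>)" by simp
  then have "Arg (cis t) = t + 2 * pi * q" by (simp add: algebra_simps)
  then show ?thesis unfolding circ_def theta_eq_iff[OF x x] by blast
qed

text \<open>\<open>Arg\<close> jumps at the negative axis. Near a unit vector \<open>u0\<close> of
  argument \<open>t0\<close> it is replaced by \<open>t0 + Im (Ln (u / u0))\<close>, which is
  continuous there and differs from it by a period of \<open>theta\<close>.\<close>

lemma circ_cont: "continuous_on (cantor_set \<times> sphere 0 1) (\<lambda>p. circ (fst p) (snd p))"
  unfolding continuous_on_eq_continuous_within
proof
  fix p assume p: "p \<in> cantor_set \<times> sphere (0::complex) 1"
  define u0 t0 where "u0 = snd p" and "t0 = Arg (snd p)"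
  have u0: "cmod u0 = 1" "u0 = cis t0" using p cis_Arg_unit[of u0] by (auto simp: u0_def t0_def)
  let ?g = "\<lambda>p. theta (fst p) (t0 + Im (Ln (snd p / u0)))"
  have eq: "circ (fst q) (snd q) = ?g q" if q: "q \<in> cantor_set \<times> sphere 0 1" for q
  proof -
    have n: "cmod (snd q / u0) = 1" using q u0 by (auto simp: norm_divide)
    then have "Arg (snd q / u0) = Im (Ln (snd q / u0))" by (auto simp: Arg_def)
    then have "cis (Im (Ln (snd q / u0))) = snd q / u0" using cis_Arg_unit[OF n] by simp
    then have "cis (t0 + Im (Ln (snd q / u0))) = snd q" using u0 by (auto simp: cis_mult[symmetric])
    then show ?thesis using circ_cis[of "fst q" "t0 + Im (Ln (snd q / u0))"] q by (auto simp: mem_Times_iff)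
  qed
  have cl: "continuous (at p within (cantor_set \<times> sphere 0 1)) (\<lambda>p. t0 + Im (Ln (snd p / u0)))"
  proof -
    have "snd p / u0 \<notin> \<real>\<^sub>\<le>\<^sub>0" using u0 unfolding u0_def[symmetric] by (auto simp: complex_nonpos_Reals_iff)
    moreover have "isCont (\<lambda>p :: real \<times> complex. snd p / u0) p"
      using u0(1) by (intro continuous_intros) auto
    ultimately have "isCont (\<lambda>p :: real \<times> complex. t0 + Im (Ln (snd p / u0))) p"
      by (intro continuous_add continuous_const isCont_Im isCont_Ln')
    then show ?thesis by (rule continuous_at_imp_continuous_at_within)
  qed
  have "continuous (at p within (cantor_set \<times> sphere 0 1)) ?g"
  proof -
    have 1: "continuous (at p within (cantor_set \<times> sphere 0 1)) (\<lambda>p. (fst p, t0 + Im (Ln (snd p / u0))))"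
      by (intro continuous_intros cl)
    have 3: "continuous (at (fst p, t0 + Im (Ln (snd p / u0))) within (cantor_set \<times> UNIV)) (\<lambda>p. theta (fst p) (snd p))"
      using theta_cont p unfolding continuous_on_eq_continuous_within by (simp add: mem_Times_iff)
    have 2: "continuous (at (fst p, t0 + Im (Ln (snd p / u0))) within
       (\<lambda>p. (fst p, t0 + Im (Ln (snd p / u0)))) ` (cantor_set \<times> sphere 0 1)) (\<lambda>p. theta (fst p) (snd p))"
      by (rule continuous_within_subset[OF 3]) auto
    show ?thesis using continuous_within_compose[OF 1 2] by (simp add: o_def)
  qed
  then show "continuous (at p within (cantor_set \<times> sphere 0 1)) (\<lambda>p. circ (fst p) (snd p))"
    by (rule continuous_transform_within[OF _ zero_less_one p]) (simp add: eq)
qed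

lemma theta_image_homeomorphic:
  "stereo ` (\<lambda>p. theta (fst p) (snd p)) ` (cantor_set \<times> UNIV) homeomorphic (cantor_set \<times> sphere (0::complex) 1)"
proof -
  let ?h = "\<lambda>p. stereo (circ (fst p) (snd p))"
  have ang: "\<exists>t. u = cis t" if "u \<in> sphere 0 1" for u :: complex
    using that cis_Arg_unit[of u] by (intro exI[of _ "Arg u"]) simp
  have inj: "inj_on ?h (cantor_set \<times> sphere 0 1)"
  proof (rule inj_onI)
    fix p q :: "real \<times> complex"
    assume p: "p \<in> cantor_set \<times> sphere 0 1" and q: "q \<in> cantor_set \<times> sphere 0 1" and eq: "?h p = ?h q"
    obtain t t' where t: "snd p = cis t" "snd q = cis t'" using ang p q by (metis mem_Times_iff)
    have "theta (fst p) t = theta (fst q) t'"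
      using eq circ_cis p q t unfolding stereo_inject by (metis mem_Times_iff)
    then obtain k :: int where "fst p = fst q" "t = t' + 2 * pi * k"
      using theta_eq_iff[of "fst p" "fst q" t t'] p q unfolding mem_Times_iff by blast
    then show "p = q" using t by (simp add: prod_eq_iff cis_mult[symmetric] cis_multiple_2pi)
  qed
  have im: "?h ` (cantor_set \<times> sphere 0 1) = stereo ` (\<lambda>p. theta (fst p) (snd p)) ` (cantor_set \<times> UNIV)"
  proof
    show "?h ` (cantor_set \<times> sphere 0 1) \<subseteq> stereo ` (\<lambda>p. theta (fst p) (snd p)) ` (cantor_set \<times> UNIV)"
    proof
      fix P assume "P \<in> ?h ` (cantor_set \<times> sphere 0 1)"
      then obtain p where "p \<in> cantor_set \<times> sphere 0 1" "P = ?h p" by blast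
      then show "P \<in> stereo ` (\<lambda>p. theta (fst p) (snd p)) ` (cantor_set \<times> UNIV)"
        unfolding circ_def by (intro image_eqI[of _ _ "theta (fst p) (Arg (snd p))"] image_eqI[of _ _ "(fst p, Arg (snd p))"]) auto
    qed
    have "stereo (theta x t) \<in> ?h ` (cantor_set \<times> sphere 0 1)" if "x \<in> cantor_set" for x t
      using circ_cis[OF that, of t] that by (intro image_eqI[of _ _ "(x, cis t)"]) auto
    then show "stereo ` (\<lambda>p. theta (fst p) (snd p)) ` (cantor_set \<times> UNIV) \<subseteq> ?h ` (cantor_set \<times> sphere 0 1)"
      by auto
  qed
  have "(cantor_set \<times> sphere (0::complex) 1) homeomorphic stereo ` (\<lambda>p. theta (fst p) (snd p)) ` (cantor_set \<times> UNIV)"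
  proof (rule homeomorphic_compact[OF _ _ im inj])
    show "compact (cantor_set \<times> sphere (0::complex) 1)"
      by (intro compact_Times compact_cantor_set compact_sphere)
    show "continuous_on (cantor_set \<times> sphere 0 1) ?h"
      by (rule continuous_on_compose2[OF continuous_on_stereo[of UNIV] circ_cont]) simp
  qed
  then show ?thesis by (rule homeomorphic_sym[THEN iffD1])
qed

text \<open>Points half a turn apart on one circle are different, and by compactness their distance
  has a positive minimum over all circles.\<close>

lemma antipodal_separation:
  "\<exists>\<epsilon> > 0. \<forall>x \<in> cantor_set. \<forall>t. dist (stereo (theta x t)) (stereo (theta x (t + pi))) \<ge> \<epsilon>"
proof -
  let ?d = "\<lambda>p. dist (stereo (theta (fst p) (snd p))) (stereo (theta (fst p) (snd p + pi)))"
  have c1: "continuous_on (cantor_set \<times> {0..2*pi}) (\<lambda>p. stereo (theta (fst p) (snd p)))"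
    by (rule continuous_on_compose2[OF continuous_on_stereo continuous_on_subset[OF theta_cont]]) auto
  have c2: "continuous_on (cantor_set \<times> {0..2*pi}) (\<lambda>p. stereo (theta (fst p) (snd p + pi)))"
  proof (rule continuous_on_compose2[OF continuous_on_stereo[of UNIV]])
    have "continuous_on (cantor_set \<times> {0..2*pi}) (\<lambda>p. (fst p, snd p + pi))" by (intro continuous_intros)
    note * = continuous_on_compose2[OF theta_cont this]
    show "continuous_on (cantor_set \<times> {0..2*pi}) (\<lambda>p. theta (fst p) (snd p + pi))"
      by (rule *[unfolded fst_conv snd_conv]) auto
  qed simp
  have "\<exists>p \<in> cantor_set \<times> {0..2*pi}. \<forall>q \<in> cantor_set \<times> {0..2*pi}. ?d p \<le> ?d q"
  proof (rule continuous_attains_inf)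
    show "cantor_set \<times> {0..2*pi} \<noteq> {}" using cantor_set_zero by force
  qed (intro compact_Times compact_cantor_set compact_Icc continuous_on_dist c1 c2)+
  then obtain p where p: "p \<in> cantor_set \<times> {0..2*pi}" "\<And>q. q \<in> cantor_set \<times> {0..2*pi} \<Longrightarrow> ?d p \<le> ?d q" by blast
  have "theta (fst p) (snd p) \<noteq> theta (fst p) (snd p + pi)"
  proof
    assume "theta (fst p) (snd p) = theta (fst p) (snd p + pi)"
    then obtain q :: int where "snd p = snd p + pi + 2 * pi * q"
      using theta_eq_iff[of "fst p" "fst p" "snd p" "snd p + pi"] p unfolding mem_Times_iff by blast
    then have "pi * (1 + 2 * of_int q) = 0" by (simp add: algebra_simps)
    then have "1 + 2 * real_of_int q = 0" by simp
    then have "1 + 2 * q = 0" by linarith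
    then show False by presburger
  qed
  then have pos: "?d p > 0" by (simp add: stereo_inject)
  have "?d p \<le> dist (stereo (theta x t)) (stereo (theta x (t + pi)))" if x: "x \<in> cantor_set" for x t
  proof -
    obtain s and q :: int where s: "s \<in> {0..2*pi}" "t = s + 2 * pi * q" using reduce_angle[of t] by blast
    have "?d p \<le> ?d (x, s)" using x s(1) by (intro p(2)) auto
    moreover have "theta x t = theta x s" "theta x (t + pi) = theta x (s + pi)"
      unfolding theta_eq_iff[OF x x] using s(2) by (auto intro!: exI[of _ q])
    ultimately show ?thesis by simp
  qed
  with pos show ?thesis by blast
qed

end

context circle_dyn
begin

text \<open>An iterate of degree \<open>E\<close> turns a shift of the angle by
  \<open>pi / E\<close> into a half turn. As the degrees grow, points arbitrarily close to
  \<open>P\<close> are thus thrown to a fixed distance from the image of \<open>P\<close>, whereas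
  normality would give a subsequence of iterates with a uniform, hence continuous, limit near
  \<open>P\<close>.\<close>

lemma stereo_Lam_subset_julia:
  assumes F_in: "\<And>P. P \<in> S2 \<Longrightarrow> F P \<in> S2" and F_cont: "continuous_on S2 F"
    and F_f: "\<And>z. z \<in> Lam \<Longrightarrow> F (stereo z) = stereo (f z)"
  shows "stereo ` Lam \<subseteq> julia F"
proof
  fix P assume "P \<in> stereo ` Lam"
  then obtain x t where x: "x \<in> cantor_set" and P: "P = stereo (theta x t)" by (auto simp: Lam_def)
  have Fk: "(F ^^ k) (stereo (theta x t)) = stereo ((f ^^ k) (theta x t)) \<and> (f ^^ k) (theta x t) \<in> Lam" for k t
  proof (induction k)
    case (Suc k)
    obtain E :: int where "(f ^^ Suc k) (theta x t) = theta ((T ^^ Suc k) x) (E * t)" using f_funpow_theta[OF x] by blast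
    then have "(f ^^ Suc k) (theta x t) \<in> Lam"
      using T_funpow_in[OF x, of "Suc k"] unfolding Lam_def by (intro image_eqI[of _ _ "((T ^^ Suc k) x, E * t)"]) auto
    then show ?case using Suc F_f by simp
  next
    case 0
    show ?case using x unfolding Lam_def by (intro conjI image_eqI[of _ _ "(x, t)"]) auto
  qed
  have Fk_cont: "continuous_on S2 (F ^^ k)" for k by (rule continuous_on_funpow[OF F_cont F_in])
  obtain \<epsilon> where \<epsilon>: "\<epsilon> > 0" "\<And>x t. x \<in> cantor_set \<Longrightarrow> dist (stereo (theta x t)) (stereo (theta x (t + pi))) \<ge> \<epsilon>"
    using antipodal_separation by blast
  have "P \<notin> fatou F"
  proof
    assume "P \<in> fatou F"
    then obtain U where U: "open U" "P \<in> U" "normal_iterates_on F (U \<inter> S2)" by (auto simp: fatou_def)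
    then obtain \<delta> where \<delta>: "\<delta> > 0" "cball P \<delta> \<subseteq> U" using open_contains_cball by blast
    let ?C = "cball P \<delta> \<inter> S2"
    have C: "compact ?C" by (simp add: S2_def compact_Int)
    have PC: "P \<in> ?C" using \<delta> P stereo_in_S2 by simp
    obtain s g where s: "strict_mono s" "uniform_limit ?C (\<lambda>k. F ^^ s k) g sequentially"
    proof -
      obtain s g where s: "strict_mono s" "\<forall>C. compact C \<and> C \<subseteq> U \<inter> S2 \<longrightarrow>
          uniform_limit C (\<lambda>k. F ^^ id (s k)) g sequentially"
        using U(3)[unfolded normal_iterates_on_def, rule_format, of id] by (elim exE conjE)
      have "uniform_limit ?C (\<lambda>k. F ^^ id (s k)) g sequentially" using s(2) C \<delta>(2) by blast
      then show ?thesis using that[of s g] s(1) by simp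
    qed
    have g_cont: "continuous_on ?C g"
      by (rule uniform_limit_theorem[OF _ s(2)]) (simp_all add: continuous_on_subset[OF Fk_cont])
    have "\<forall>k. \<exists>E::int. \<bar>E\<bar> \<ge> (2::int) ^ k \<and> (\<forall>t. (f ^^ k) (theta x t) = theta ((T ^^ k) x) (real_of_int E * t))"
      using f_funpow_theta[OF x] by blast
    then obtain E :: "nat \<Rightarrow> int" where E: "\<And>k. \<bar>E k\<bar> \<ge> (2::int) ^ k"
      "\<And>k t. (f ^^ k) (theta x t) = theta ((T ^^ k) x) (real_of_int (E k) * t)" unfolding choice_iff by blast
    have E0: "E k \<noteq> 0" for k
    proof
      assume "E k = 0"
      then have "(2::int) ^ k \<le> 0" using E(1)[of k] by simp
      then show False by (simp add: not_le[symmetric])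
    qed
    define Q where "Q k = stereo (theta x (t + pi / E (s k)))" for k
    have "(\<lambda>k. pi / real_of_int (E (s k))) \<longlonglongrightarrow> 0"
    proof (rule Lim_null_comparison)
      have "\<bar>pi / real_of_int (E (s k))\<bar> \<le> pi * (1/2) ^ k" for k
      proof -
        have "(2::int) ^ k \<le> 2 ^ s k" using seq_suble[OF s(1), of k] by (intro power_increasing) auto
        then have "real_of_int (2 ^ k) \<le> real_of_int \<bar>E (s k)\<bar>" using E(1)[of "s k"] by linarith
        then have "pi / \<bar>real_of_int (E (s k))\<bar> \<le> pi / 2 ^ k"
          by (intro divide_left_mono) (use E0[of "s k"] in simp_all)
        then show ?thesis by (simp add: power_divide abs_divide)
      qed
      then show "\<forall>\<^sub>F k in sequentially. norm (pi / real_of_int (E (s k))) \<le> pi * (1/2) ^ k" by simp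
      show "(\<lambda>k. pi * (1/2) ^ k) \<longlonglongrightarrow> (0::real)"
        by (intro tendsto_mult_right_zero LIMSEQ_power_zero) auto
    qed
    then have lim: "(\<lambda>k. (x, t + pi / real_of_int (E (s k)))) \<longlonglongrightarrow> (x, t + 0)"
      by (intro tendsto_intros)
    have "(\<lambda>k. theta x (t + pi / E (s k))) \<longlonglongrightarrow> theta x t"
      using continuous_on_tendsto_compose[OF theta_cont lim] x by simp
    then have QP: "Q \<longlonglongrightarrow> P" unfolding Q_def P by (rule isCont_tendsto_compose[OF isCont_stereo])
    have QS: "Q k \<in> S2" for k by (simp add: Q_def stereo_in_S2)
    have evC: "\<forall>\<^sub>F k in sequentially. Q k \<in> ?C"
      using tendstoD[OF QP \<delta>(1)] by eventually_elim (use QS in \<open>auto simp: dist_commute\<close>)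
    have gQ: "(\<lambda>k. g (Q k)) \<longlonglongrightarrow> g P"
      by (rule continuous_on_tendsto_compose[OF g_cont QP PC evC])
    have far: "dist ((F ^^ s k) P) ((F ^^ s k) (Q k)) \<ge> \<epsilon>" for k
    proof -
      have "real_of_int (E (s k)) * (t + pi / E (s k)) = E (s k) * t + pi"
        using E0[of "s k"] by (simp add: distrib_left)
      then show ?thesis unfolding P Q_def using Fk E(2) \<epsilon>(2)[OF T_funpow_in[OF x]] by simp
    qed
    have "\<forall>\<^sub>F k in sequentially. \<forall>y\<in>?C. dist ((F ^^ s k) y) (g y) < \<epsilon> / 3"
      by (rule uniform_limitD[OF s(2)]) (use \<epsilon> in simp)
    moreover have "\<forall>\<^sub>F k in sequentially. dist (g (Q k)) (g P) < \<epsilon> / 3"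
      by (rule tendstoD[OF gQ]) (use \<epsilon> in simp)
    ultimately have "\<forall>\<^sub>F k in sequentially. False" using evC
    proof eventually_elim
      case (elim k)
      have "dist ((F ^^ s k) P) (g P) < \<epsilon> / 3" "dist ((F ^^ s k) (Q k)) (g (Q k)) < \<epsilon> / 3" using elim PC by blast+
      then show False using far[of k] elim(2) dist_triangle[of "(F ^^ s k) P" "(F ^^ s k) (Q k)" "g P"]
          dist_triangle[of "g P" "(F ^^ s k) (Q k)" "g (Q k)"] by (simp add: dist_commute)
    qed
    then show False by simp
  qed
  then show "P \<in> julia F" using P stereo_in_S2 by (simp add: julia_def)
qed

end

subsection \<open>Logarithmic lifts\<close>

text \<open>\<open>\<sigma> (Suc i)\<close> is the exponent of the factor belonging to
  \<open>a i\<close>, and \<open>\<sigma> j\<close> the sign of the degree in the ring below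
  \<open>\<bar>a j\<bar>\<close>. The alternation of the signs makes the two readings compatible,
  see \<open>e_eq\<close>.\<close>

locale ring_map =
  fixes n :: nat and d :: "nat \<Rightarrow> nat" and \<sigma> :: "nat \<Rightarrow> int" and a :: "nat \<Rightarrow> complex"
    and lo hi :: real and K :: nat
  assumes n_ge: "n \<ge> 2"
    and d_ge: "i \<in> {1..n} \<Longrightarrow> d i \<ge> 2"
    and d_le: "i \<in> {1..n} \<Longrightarrow> d i \<le> K"
    and \<sigma>_0: "\<sigma> 0 \<in> {1, -1}"
    and \<sigma>_Suc: "\<sigma> (Suc i) = - \<sigma> i"
    and a_nz: "i \<in> {1..<n} \<Longrightarrow> a i \<noteq> 0"
begin

definition m :: "nat \<Rightarrow> nat" where "m i = d i + d (Suc i)"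

definition e :: "nat \<Rightarrow> int" where "e j = \<sigma> j * int (d j)"

text \<open>The two bounding radii are treated as additional moduli, with indices \<open>0\<close> and \<open>n\<close>.\<close>

definition rho :: "nat \<Rightarrow> real" where
  "rho i = (if i = 0 then lo else if i = n then hi else ln (cmod (a i)))"

text \<open>Between the radii \<open>rho (j - 1)\<close> and \<open>rho j\<close> the map is close to a monomial of exponent \<open>e j\<close>, and
  \<open>h j\<close> is the logarithm of its modulus as a function of the logarithm of the radius.\<close>

definition c :: "nat \<Rightarrow> real" where "c j = (\<Sum>i = j..<n. real_of_int (\<sigma> (Suc i)) * real (m i) * rho i)"

definition h :: "nat \<Rightarrow> real \<Rightarrow> real" where "h j \<tau> = real_of_int (e j) * \<tau> + c j"

text \<open>The value of the model for the logarithm of the modulus at the radius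
  \<open>rho i\<close>. It is read off from the ring outside this radius, except at the last radius,
  which has no further ring.\<close>

definition V :: "nat \<Rightarrow> real" where "V i = (if i = n then h n hi else h (Suc i) (rho i))"

text \<open>Distance to be kept from \<open>rho i\<close>, measured after multiplication by the
  local degree: at \<open>ln 8\<close> the disturbing term of the factor has relative size at most
  1/8. The two boundary circles carry no factor.\<close>

definition tol :: "nat \<Rightarrow> real" where "tol i = (if i = 0 \<or> i = n then 0 else ln 8)"

text \<open>The amount by which the model overshoots the annulus at \<open>rho i\<close>. At an
  inner radius, \<open>ln 8\<close> pays for moving within the tolerance, \<open>ln 2\<close> for a
  factor of modulus at most 2, and the last \<open>ln 2\<close>, as at the boundary circles, for the
  errors of all other factors and some gain.\<close>

definition marg :: "nat \<Rightarrow> real" where "marg i = (if i = 0 \<or> i = n then ln 2 else ln 32)"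

definition f :: "complex \<Rightarrow> complex" where
  "f z = z powi (e 1) * (\<Prod>i = 1..<n. (z ^ m i - a i ^ m i) powi (\<sigma> (Suc i)))"

lemma \<sigma>_pm: "\<sigma> i = 1 \<or> \<sigma> i = -1"
  using \<sigma>_0 \<sigma>_Suc by (induction i) auto

lemma e_eq: "e (Suc i) - e i = \<sigma> (Suc i) * int (m i)"
  using \<sigma>_Suc[of i] by (simp add: e_def m_def algebra_simps)

lemma abs_e: "\<bar>e i\<bar> = int (d i)"
  using \<sigma>_pm[of i] by (auto simp: e_def)

text \<open>The piecewise affine model is continuous: at \<open>rho i\<close> the slope jumps by
  \<open>\<sigma> (Suc i) * m i\<close>, and the intercept drops by this amount times
  \<open>rho i\<close>.\<close>

lemma h_rho: assumes "i \<in> {1..n}" shows "h i (rho i) = V i"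
proof (cases "i = n")
  case True
  then show ?thesis using n_ge by (simp add: V_def rho_def)
next
  case False
  then have "c i = real_of_int (\<sigma> (Suc i)) * real (m i) * rho i + c (Suc i)"
    using assms unfolding c_def by (subst sum.atLeast_Suc_lessThan) auto
  moreover have e: "real_of_int (e (Suc i)) = real_of_int (e i) + real_of_int (\<sigma> (Suc i)) * real (m i)"
    using e_eq[of i, THEN arg_cong[of _ _ real_of_int]] by simp
  ultimately show ?thesis using False unfolding V_def h_def e by (simp add: algebra_simps)
qed

lemma V_diff: assumes "i < n" shows "V (Suc i) - V i = real_of_int (e (Suc i)) * (rho (Suc i) - rho i)"
proof -
  have "V (Suc i) = h (Suc i) (rho (Suc i))" using h_rho[of "Suc i"] assms by simp
  moreover have "V i = h (Suc i) (rho i)" using assms by (simp add: V_def)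
  ultimately show ?thesis by (simp add: h_def algebra_simps)
qed

end

text \<open>If the factor of \<open>a i\<close> stands in the denominator, the model must exceed
  \<open>hi\<close> at \<open>rho i\<close>, and otherwise stay below \<open>lo\<close>. The cases
  \<open>0\<close> and \<open>n\<close> say the same for the behaviour at \<open>0\<close> and at
  infinity: the boundary circles leave the annulus. \<open>small\<close> bounds the influence of all
  factors that do not belong to the ends of the ring under consideration.\<close>

locale ring_map_bounds = ring_map +
  assumes lo_less_hi: "lo < hi"
    and V_pole: "i \<le> n \<Longrightarrow> \<sigma> (Suc i) = -1 \<Longrightarrow> V i \<ge> hi + marg i"
    and V_zero: "i \<le> n \<Longrightarrow> \<sigma> (Suc i) = 1 \<Longrightarrow> V i \<le> lo - marg i"
    and small: "real n * real K * exp (- (hi - lo)) \<le> 1/100"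
begin

definition "eps = exp (- (hi - lo))"

lemma ln8: "ln 8 \<ge> (2 :: real)" and ln32: "ln 32 = ln 8 + 2 * ln (2 :: real)" and ln2: "ln (2 :: real) \<ge> 2/3"
proof -
  show l2: "ln (2 :: real) \<ge> 2/3" by (rule ln2_ge_two_thirds)
  have l8: "ln 8 = 3 * ln (2 :: real)" using ln_realpow[of "2::real" 3] by simp
  show "ln 32 = ln 8 + 2 * ln (2 :: real)" using ln_realpow[of "2::real" 5] l8 by simp
  show "ln 8 \<ge> (2 :: real)" using l2 l8 by simp
qed

lemma marg_tol: "marg i \<ge> tol i + ln 2" "tol i \<ge> 0" "marg i > 0" "tol i \<le> ln 8"
  using ln8 ln32 ln2 by (auto simp: marg_def tol_def)

text \<open>Across a ring the model runs with slope of modulus \<open>d (Suc i)\<close> from beyond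
  one end of the annulus to beyond the other. That the radii increase is a consequence of
  this.\<close>

lemma gap_width:
  assumes "i < n"
  shows "d (Suc i) * (rho (Suc i) - rho i) \<ge> (hi - lo) + marg i + marg (Suc i)"
proof -
  have *: "V (Suc i) - V i = real_of_int (\<sigma> (Suc i)) * (real (d (Suc i)) * (rho (Suc i) - rho i))"
    using V_diff[OF assms] by (simp add: e_def)
  have s2: "\<sigma> (Suc (Suc i)) = - \<sigma> (Suc i)" by (rule \<sigma>_Suc)
  consider "\<sigma> (Suc i) = 1" | "\<sigma> (Suc i) = -1" using \<sigma>_pm by blast
  then show ?thesis
  proof cases
    case 1
    then show ?thesis using * V_zero[of i] V_pole[of "Suc i"] s2 assms by simp
  next
    case 2
    then show ?thesis using * V_pole[of i] V_zero[of "Suc i"] s2 assms by simp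
  qed
qed

lemma rho_Suc: "i < n \<Longrightarrow> rho i < rho (Suc i)"
  using gap_width[of i] lo_less_hi marg_tol(3)[of i] marg_tol(3)[of "Suc i"]
  by (smt (verit) mult_nonneg_nonpos of_nat_0_le_iff)

lemma rho_less: "i < j \<Longrightarrow> j \<le> n \<Longrightarrow> rho i < rho j"
proof (induction j)
  case (Suc j)
  then show ?case using rho_Suc[of j] by (cases "i = j") auto
qed simp

lemma rho_le: "i \<le> j \<Longrightarrow> j \<le> n \<Longrightarrow> rho i \<le> rho j"
  using rho_less[of i j] by (cases "i = j") auto

lemma rho_range: "i \<le> n \<Longrightarrow> rho i \<in> {lo..hi}"
  using rho_le[of 0 i] rho_le[of i n] n_ge by (auto simp: rho_def split: if_splits)

lemma far_right: assumes "i \<in> {1..<n}" "\<tau> \<le> rho (i - 1)" shows "m i * (rho i - \<tau>) \<ge> hi - lo"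
proof -
  have "hi - lo \<le> d i * (rho i - rho (i - 1))"
    using gap_width[of "i - 1"] assms marg_tol(3)[of i] marg_tol(3)[of "i - 1"] by (cases i) auto
  also have "\<dots> \<le> m i * (rho i - \<tau>)"
    using rho_less[of "i - 1" i] assms by (intro mult_mono) (auto simp: m_def)
  finally show ?thesis .
qed

lemma far_left: assumes "i \<in> {1..<n}" "\<tau> \<ge> rho (Suc i)" shows "m i * (\<tau> - rho i) \<ge> hi - lo"
proof -
  have "hi - lo \<le> d (Suc i) * (rho (Suc i) - rho i)"
    using gap_width[of i] assms marg_tol(3)[of i] marg_tol(3)[of "Suc i"] by auto
  also have "\<dots> \<le> m i * (\<tau> - rho i)"
    using rho_less[of i "Suc i"] assms by (intro mult_mono) (auto simp: m_def)
  finally show ?thesis .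
qed

text \<open>The quotient of the smaller by the larger term in \<open>z ^ m i - a i ^ m i\<close> for
  \<open>z = exp \<zeta>\<close> in the ring \<open>j\<close>: the power of \<open>z\<close>
  dominates for the moduli inside this ring, the constant for those outside.\<close>

definition X :: "nat \<Rightarrow> nat \<Rightarrow> complex \<Rightarrow> complex" where
  "X j i \<zeta> = (if i < j then a i ^ m i * exp (- (of_nat (m i) * \<zeta>)) else exp (of_nat (m i) * \<zeta>) / a i ^ m i)"

lemma cmod_a: "i \<in> {1..<n} \<Longrightarrow> cmod (a i) = exp (rho i)"
  using a_nz[of i] by (simp add: rho_def)

lemma cmod_X: assumes "i \<in> {1..<n}"
  shows "cmod (X j i \<zeta>) = (if i < j then exp (- (m i * (Re \<zeta> - rho i))) else exp (- (m i * (rho i - Re \<zeta>))))"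
  using cmod_a[OF assms]
  by (simp add: X_def norm_mult norm_power norm_divide exp_of_nat_mult[symmetric] exp_add[symmetric] exp_diff[symmetric] algebra_simps)

lemma eps_bounds: "eps > 0" "real n * eps \<le> 1/200" "real n * (real K * eps) \<le> 1/100" "eps \<le> 1/100"
proof -
  show "eps > 0" by (simp add: eps_def)
  show 1: "real n * (real K * eps) \<le> 1/100" using small by (simp add: eps_def mult.assoc)
  have "K \<ge> 2" using d_le[of 1] d_ge[of 1] n_ge by simp
  then have "2 * (real n * eps) \<le> real K * (real n * eps)" by (intro mult_right_mono) (auto simp: eps_def)
  also have "\<dots> \<le> 1/100" using 1 by (simp add: mult_ac)
  finally show 2: "real n * eps \<le> 1/200" by simp
  have "1 * eps \<le> real n * eps" using n_ge by (intro mult_right_mono) (auto simp: eps_def)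
  then show "eps \<le> 1/100" using 2 by simp
qed

text \<open>Complex counterpart of the intercept \<open>c j\<close>, collecting the dominant
  constants of the factors outside the ring.\<close>

definition C :: "nat \<Rightarrow> complex" where "C j = (\<Sum>i = j..<n. of_int (\<sigma> (Suc i)) * Ln (- (a i ^ m i)))"

lemma Re_C: assumes "j \<in> {1..n}" shows "Re (C j) = c j"
proof -
  have "Re (Ln (- (a i ^ m i))) = m i * rho i" if "i \<in> {j..<n}" for i
  proof -
    have i: "i \<in> {1..<n}" using that assms by auto
    then show ?thesis using a_nz[OF i] cmod_a[OF i] by (simp add: norm_power ln_realpow)
  qed
  then show ?thesis unfolding C_def c_def by (simp add: mult.assoc)
qed

lemma e_telescope: "j \<ge> 1 \<Longrightarrow> e j = e 1 + (\<Sum>i = 1..<j. \<sigma> (Suc i) * int (m i))"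
proof (induction j rule: dec_induct)
  case (step j)
  then show ?case using e_eq[of j] by simp
qed simp

text \<open>\<open>I\<close> consists of the factors whose correction is written as a principal
  logarithm in the exponent. The remaining ones are kept as powers, because close to some modulus
  \<open>\<bar>a i\<bar>\<close> the factor may vanish.\<close>

lemma f_exp_factor:
  assumes j: "j \<in> {1..n}" and I: "I \<subseteq> {1..<n}" and ne: "\<And>i. i \<in> I \<Longrightarrow> X j i \<zeta> \<noteq> 1"
  shows "f (exp \<zeta>) = exp (of_int (e j) * \<zeta> + C j + (\<Sum>i\<in>I. of_int (\<sigma> (Suc i)) * Ln (1 - X j i \<zeta>))) *
     (\<Prod>i\<in>{1..<n} - I. (1 - X j i \<zeta>) powi \<sigma> (Suc i))"
proof -
  have fac: "(exp \<zeta> ^ m i - a i ^ m i) powi \<sigma> (Suc i) =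
      exp (if i < j then of_int (\<sigma> (Suc i) * int (m i)) * \<zeta> else of_int (\<sigma> (Suc i)) * Ln (- (a i ^ m i))) *
      (1 - X j i \<zeta>) powi \<sigma> (Suc i)" if i: "i \<in> {1..<n}" for i
  proof (cases "i < j")
    case True
    have "exp \<zeta> ^ m i - a i ^ m i = exp (of_nat (m i) * \<zeta>) * (1 - X j i \<zeta>)"
      using True by (simp add: X_def exp_of_nat_mult exp_of_nat2_mult exp_minus field_simps)
    then show ?thesis using True by (simp add: power_int_mult_distrib exp_power_int mult.assoc)
  next
    case False
    have nz: "- (a i ^ m i) \<noteq> 0" using a_nz[OF i] by simp
    have "exp \<zeta> ^ m i - a i ^ m i = - (a i ^ m i) * (1 - X j i \<zeta>)"
      using False a_nz[OF i] by (simp add: X_def exp_of_nat_mult exp_of_nat2_mult field_simps)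
    also have "\<dots> = exp (Ln (- (a i ^ m i))) * (1 - X j i \<zeta>)" using exp_Ln[OF nz] by simp
    finally show ?thesis using False by (simp only: power_int_mult_distrib exp_power_int if_False)
  qed
  have "(\<Prod>i = 1..<n. (exp \<zeta> ^ m i - a i ^ m i) powi \<sigma> (Suc i)) =
     exp (\<Sum>i = 1..<n. if i < j then of_int (\<sigma> (Suc i) * int (m i)) * \<zeta> else of_int (\<sigma> (Suc i)) * Ln (- (a i ^ m i))) *
     (\<Prod>i = 1..<n. (1 - X j i \<zeta>) powi \<sigma> (Suc i))"
    by (simp add: fac prod.distrib exp_sum)
  also have "(\<Sum>i = 1..<n. if i < j then of_int (\<sigma> (Suc i) * int (m i)) * \<zeta> else of_int (\<sigma> (Suc i)) * Ln (- (a i ^ m i))) =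
      (\<Sum>i = 1..<j. of_int (\<sigma> (Suc i) * int (m i)) * \<zeta>) + C j"
  proof -
    have s: "{1..<n} = {1..<j} \<union> {j..<n}" using j by auto
    show ?thesis unfolding C_def s by (subst sum.union_disjoint) (auto intro!: sum.cong arg_cong2[of _ _ _ _ "(+)"])
  qed
  also have "(\<Sum>i = 1..<j. of_int (\<sigma> (Suc i) * int (m i)) * \<zeta>) = of_int (e j - e 1) * \<zeta>"
    using e_telescope[of j] j by (simp add: sum_distrib_right[symmetric])
  also have "(\<Prod>i = 1..<n. (1 - X j i \<zeta>) powi \<sigma> (Suc i)) =
      (\<Prod>i\<in>{1..<n} - I. (1 - X j i \<zeta>) powi \<sigma> (Suc i)) * (\<Prod>i\<in>I. (1 - X j i \<zeta>) powi \<sigma> (Suc i))"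
    using I by (intro prod.subset_diff) auto
  also have "(\<Prod>i\<in>I. (1 - X j i \<zeta>) powi \<sigma> (Suc i)) = exp (\<Sum>i\<in>I. of_int (\<sigma> (Suc i)) * Ln (1 - X j i \<zeta>))"
  proof -
    have "(1 - X j i \<zeta>) powi \<sigma> (Suc i) = exp (of_int (\<sigma> (Suc i)) * Ln (1 - X j i \<zeta>))" if "i \<in> I" for i
      using ne[OF that] exp_Ln[of "1 - X j i \<zeta>"] by (metis eq_iff_diff_eq_0 exp_power_int)
    then show ?thesis using finite_subset[OF I] by (simp add: exp_sum)
  qed
  finally have P: "(\<Prod>i = 1..<n. (exp \<zeta> ^ m i - a i ^ m i) powi \<sigma> (Suc i)) =
     exp (of_int (e j - e 1) * \<zeta> + C j) * ((\<Prod>i\<in>{1..<n} - I. (1 - X j i \<zeta>) powi \<sigma> (Suc i)) *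
       exp (\<Sum>i\<in>I. of_int (\<sigma> (Suc i)) * Ln (1 - X j i \<zeta>)))" .
  have E: "of_int (e j) * \<zeta> + C j + S = of_int (e 1) * \<zeta> + (of_int (e j - e 1) * \<zeta> + C j) + S" for S
    by (simp add: algebra_simps)
  show ?thesis unfolding f_def P exp_power_int E exp_add by (simp only: mult_ac)
qed

definition u :: "nat \<Rightarrow> complex \<Rightarrow> complex" where
  "u j \<zeta> = (\<Sum>i = 1..<n. of_int (\<sigma> (Suc i)) * Ln (1 - X j i \<zeta>))"

text \<open>The tolerances are measured in the image, where logarithmic distances are larger by the
  factor \<open>d j\<close>; hence the division.\<close>

definition strip :: "nat \<Rightarrow> complex set" where
  "strip j = {\<zeta>. rho (j - 1) + tol (j - 1) / d j \<le> Re \<zeta> \<and> Re \<zeta> \<le> rho j - tol j / d j}"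

lemma tol_div: assumes "j \<in> {1..n}" shows "tol i / d j \<ge> 0" "d j > 0"
  using marg_tol(2)[of i] d_ge[OF assms] by auto

lemma strip_between: assumes "j \<in> {1..n}" "\<zeta> \<in> strip j" shows "rho (j - 1) \<le> Re \<zeta>" "Re \<zeta> \<le> rho j"
  using assms tol_div(1)[OF assms(1), of j] tol_div(1)[OF assms(1), of "j - 1"] by (auto simp: strip_def)

lemma X_far:
  assumes "i \<in> {1..<n}" and "i < j \<Longrightarrow> m i * (Re \<zeta> - rho i) \<ge> hi - lo" and "\<not> i < j \<Longrightarrow> m i * (rho i - Re \<zeta>) \<ge> hi - lo"
  shows "cmod (X j i \<zeta>) \<le> eps"
  unfolding cmod_X[OF assms(1)] eps_def using assms(2,3) by auto

lemma X_far_between: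
  assumes i: "i \<in> {1..<n}" and j: "j \<in> {1..n}" and b: "j = 1 \<or> rho (j - 1) \<le> Re \<zeta>" "j = n \<or> Re \<zeta> \<le> rho j" and ij: "i \<noteq> j" "Suc i \<noteq> j"
  shows "cmod (X j i \<zeta>) \<le> eps"
proof (rule X_far[OF i])
  assume "i < j"
  then have "rho (Suc i) \<le> rho (j - 1)" "j \<noteq> 1" using ij j i by (auto intro!: rho_le)
  then have "Re \<zeta> \<ge> rho (Suc i)" using b(1) by linarith
  then show "m i * (Re \<zeta> - rho i) \<ge> hi - lo" by (rule far_left[OF i])
next
  assume "\<not> i < j"
  then have "rho j \<le> rho (i - 1)" "j \<noteq> n" using ij j i by (auto intro!: rho_le)
  then have "Re \<zeta> \<le> rho (i - 1)" using b(2) by linarith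
  then show "m i * (rho i - Re \<zeta>) \<ge> hi - lo" by (rule far_right[OF i])
qed

text \<open>With \<open>q = m / d \<ge> 1\<close> and \<open>y = d * s\<close>, the product \<open>m * exp (- m * s) = d * q * exp (- q * y)\<close> is at most
  \<open>d * exp (- y)\<close> as soon as \<open>y \<ge> 1\<close>.\<close>

lemma mult_exp_bound:
  fixes dd mm s :: real
  assumes "dd > 0" "mm \<ge> dd" "dd * s \<ge> ln 8"
  shows "mm * exp (- (mm * s)) \<le> dd / 8" "exp (- (mm * s)) \<le> 1/8"
proof -
  have s: "s > 0" using assms ln8 by (smt (verit) zero_less_mult_pos)
  have "exp (- (dd * s)) \<le> exp (- ln 8)" using assms(3) by simp
  then have e8: "exp (- (dd * s)) \<le> 1/8" by (simp add: exp_minus)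
  have "(mm - dd) * s \<ge> (mm - dd) / dd"
  proof -
    have "1 \<le> dd * s" using assms(3) ln8 by linarith
    then have "(mm - dd) / dd * 1 \<le> (mm - dd) / dd * (dd * s)" using assms by (intro mult_left_mono) auto
    then show ?thesis using assms(1) by simp
  qed
  then have "mm / dd \<le> 1 + (mm - dd) * s" using assms(1) by (simp add: diff_divide_distrib)
  also have "\<dots> \<le> exp ((mm - dd) * s)" by (rule exp_ge_add_one_self)
  finally have "mm / dd * exp (- (mm * s)) \<le> exp ((mm - dd) * s) * exp (- (mm * s))" by (intro mult_right_mono) auto
  also have "\<dots> = exp (- (dd * s))" by (simp add: exp_add[symmetric] algebra_simps)
  finally have "mm / dd * exp (- (mm * s)) \<le> 1/8" using e8 by linarith
  then show "mm * exp (- (mm * s)) \<le> dd / 8" using assms(1) by (simp add: field_simps)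
  have "exp (- (mm * s)) \<le> exp (- (dd * s))" using s assms by simp
  then show "exp (- (mm * s)) \<le> 1/8" using e8 by linarith
qed

lemma X_near:
  assumes i: "i \<in> {1..<n}" and j: "j \<in> {1..n}" and z: "\<zeta> \<in> strip j" and ij: "i = j \<or> Suc i = j"
  shows "m i * cmod (X j i \<zeta>) \<le> d j / 8" "cmod (X j i \<zeta>) \<le> 1/8"
proof -
  define s where "s = (if i < j then Re \<zeta> - rho i else rho i - Re \<zeta>)"
  have X: "cmod (X j i \<zeta>) = exp (- (m i * s))" unfolding cmod_X[OF i] s_def by simp
  have tol: "tol i = ln 8" using i by (simp add: tol_def)
  have "d j * s \<ge> ln 8"
  proof (cases "i = j")
    case True
    then have "s \<ge> ln 8 / d j" using z tol by (auto simp: s_def strip_def)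
    then show ?thesis using tol_div[OF j] by (simp add: field_simps)
  next
    case False
    then have "i = j - 1" "i < j" using ij by auto
    then have "s \<ge> ln 8 / d j" using z tol by (auto simp: s_def strip_def)
    then show ?thesis using tol_div[OF j] by (simp add: field_simps)
  qed
  moreover have "real (m i) \<ge> d j" using ij by (auto simp: m_def)
  ultimately show "m i * cmod (X j i \<zeta>) \<le> d j / 8" "cmod (X j i \<zeta>) \<le> 1/8"
    using mult_exp_bound[of "d j" "m i" s] tol_div[OF j] unfolding X by auto
qed

lemma m_le: "i \<in> {1..<n} \<Longrightarrow> m i \<le> 2 * K"
  using d_le[of i] d_le[of "Suc i"] by (simp add: m_def)

text \<open>Only the two moduli at the ends of the ring \<open>j\<close>, those with index
  \<open>j\<close> and \<open>j - 1\<close>, exceed the common bound \<open>A\<close>.\<close>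

lemma sum_bound:
  fixes g :: "nat \<Rightarrow> real" and A B :: real
  assumes "\<And>i. i \<in> {1..<n} \<Longrightarrow> g i \<le> A + (if i = j then B else 0) + (if Suc i = j then B else 0)"
    and "A \<ge> 0" "B \<ge> 0"
  shows "(\<Sum>i = 1..<n. g i) \<le> n * A + 2 * B"
proof -
  have "(\<Sum>i = 1..<n. g i) \<le> (\<Sum>i = 1..<n. A + (if i = j then B else 0) + (if Suc i = j then B else 0))"
    by (rule sum_mono) (rule assms(1))
  also have "\<dots> = (\<Sum>i = 1..<n. A) + (\<Sum>i = 1..<n. if i = j then B else 0) + (\<Sum>i = 1..<n. if Suc i = j then B else 0)"
    by (simp only: sum.distrib)
  also have "(\<Sum>i = 1..<n. A) \<le> n * A" using assms(2) by (simp add: mult_right_mono)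
  also have "(\<Sum>i = 1..<n. if i = j then B else 0) \<le> B" using assms(3) by simp
  also have "(\<Sum>i = 1..<n. if Suc i = j then B else 0) \<le> B"
  proof -
    have "(\<Sum>i = 1..<n. if Suc i = j then B else 0) \<le> (\<Sum>i = 1..<n. if i = j - 1 then B else 0)"
      using assms(3) by (intro sum_mono) auto
    also have "\<dots> \<le> B" using assms(3) by simp
    finally show ?thesis .
  qed
  finally show ?thesis by simp
qed

lemma strip_X_small:
  assumes "i \<in> {1..<n}" "j \<in> {1..n}" "\<zeta> \<in> strip j"
  shows "cmod (X j i \<zeta>) \<le> eps + (if i = j then 1/8 else 0) + (if Suc i = j then 1/8 else 0)"
    "cmod (X j i \<zeta>) \<le> 1/8"
  using X_far_between[OF assms(1,2) disjI2 disjI2, OF strip_between[OF assms(2,3)]] X_near(2)[OF assms]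
    eps_bounds(1,4) by (auto, (cases "i = j \<or> Suc i = j"; fastforce))

lemma Ln_bound: "cmod x \<le> 1/8 \<Longrightarrow> cmod (Ln (1 - x)) \<le> 2 * cmod x"
  using norm_Ln_le[of "-x"] by simp

text \<open>The two neighbours contribute 1/4 each and everything else at most 1/100. The bound has
  to stay below \<open>ln 2\<close>, the part of \<open>marg\<close> that exceeds
  \<open>tol\<close>.\<close>

lemma u_bound: assumes j: "j \<in> {1..n}" and z: "\<zeta> \<in> strip j" shows "cmod (u j \<zeta>) \<le> 3/5"
proof -
  have "cmod (u j \<zeta>) \<le> (\<Sum>i = 1..<n. cmod (of_int (\<sigma> (Suc i)) * Ln (1 - X j i \<zeta>)))"
    unfolding u_def by (rule norm_sum)
  also have "\<dots> \<le> (\<Sum>i = 1..<n. 2 * cmod (X j i \<zeta>))"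
  proof (rule sum_mono)
    fix i assume "i \<in> {1..<n}"
    then show "cmod (of_int (\<sigma> (Suc i)) * Ln (1 - X j i \<zeta>)) \<le> 2 * cmod (X j i \<zeta>)"
      using \<sigma>_pm[of "Suc i"] Ln_bound[OF strip_X_small(2)[OF _ j z]] by (auto simp: norm_mult)
  qed
  also have "\<dots> \<le> n * (2 * eps) + 2 * (1/4)"
    by (rule sum_bound[where j = j]) (use strip_X_small(1)[OF _ j z] eps_bounds(1) in \<open>force+\<close>)
  also have "\<dots> \<le> 3/5" using eps_bounds(2) by simp
  finally show ?thesis .
qed

lemma u_Lipschitz:
  assumes j: "j \<in> {1..n}" and z: "\<zeta> \<in> strip j" "\<zeta>' \<in> strip j"
  shows "cmod (u j \<zeta> - u j \<zeta>') \<le> d j / 3 * cmod (\<zeta> - \<zeta>')"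
proof (rule field_differentiable_bound[where S = "strip j" and f = "u j" and
      f' = "\<lambda>z. \<Sum>i = 1..<n. of_int (\<sigma> (Suc i)) * (- ((if i < j then - of_nat (m i) else of_nat (m i)) * X j i z) / (1 - X j i z))"])
  have "strip j = {z. rho (j - 1) + tol (j - 1) / d j \<le> Re z} \<inter> {z. Re z \<le> rho j - tol j / d j}"
    by (auto simp: strip_def)
  then show "convex (strip j)" using convex_halfspace_Re_ge convex_halfspace_Re_le by (simp add: convex_Int)
next
  fix z assume z: "z \<in> strip j"
  have dX: "(X j i has_field_derivative ((if i < j then - of_nat (m i) else of_nat (m i)) * X j i z)) (at z)" for i
  proof (cases "i < j")
    case True
    have "((\<lambda>z. a i ^ m i * exp (- (of_nat (m i) * z))) has_field_derivative (- of_nat (m i) * (a i ^ m i * exp (- (of_nat (m i) * z))))) (at z)"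
      by (auto intro!: derivative_eq_intros)
    then show ?thesis using True by (simp add: X_def[abs_def])
  next
    case False
    have "((\<lambda>z. exp (of_nat (m i) * z) / a i ^ m i) has_field_derivative (of_nat (m i) * (exp (of_nat (m i) * z) / a i ^ m i))) (at z)"
      by (auto intro!: derivative_eq_intros DERIV_cdivide)
    then show ?thesis using False by (simp add: X_def[abs_def])
  qed
  have dL: "((\<lambda>z. of_int (\<sigma> (Suc i)) * Ln (1 - X j i z)) has_field_derivative
      of_int (\<sigma> (Suc i)) * (- ((if i < j then - of_nat (m i) else of_nat (m i)) * X j i z) / (1 - X j i z))) (at z)"
    if i: "i \<in> {1..<n}" for i
  proof -
    have "cmod (X j i z) < 1" using strip_X_small(2)[OF i j z] by simp
    then have "Re (1 - X j i z) > 0" using complex_Re_le_cmod[of "X j i z"] by simp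
    then have "1 - X j i z \<notin> \<real>\<^sub>\<le>\<^sub>0" by (auto simp: complex_nonpos_Reals_iff)
    then show ?thesis by (auto intro!: derivative_eq_intros dX simp: divide_inverse mult_ac)
  qed
  show "(u j has_field_derivative (\<Sum>i = 1..<n. of_int (\<sigma> (Suc i)) * (- ((if i < j then - of_nat (m i) else of_nat (m i)) * X j i z) / (1 - X j i z)))) (at z within strip j)"
    unfolding u_def[abs_def] by (rule DERIV_sum) (rule has_field_derivative_at_within[OF dL])
  have "cmod (\<Sum>i = 1..<n. of_int (\<sigma> (Suc i)) * (- ((if i < j then - of_nat (m i) else of_nat (m i)) * X j i z) / (1 - X j i z)))
     \<le> (\<Sum>i = 1..<n. cmod (of_int (\<sigma> (Suc i)) * (- ((if i < j then - of_nat (m i) else of_nat (m i)) * X j i z) / (1 - X j i z))))"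
    by (rule norm_sum)
  also have "\<dots> \<le> n * (4 * K * eps) + 2 * (d j / 7)"
  proof (rule sum_bound[where j = j])
    fix i assume i: "i \<in> {1..<n}"
    have x: "cmod (X j i z) \<le> 1/8" by (rule strip_X_small(2)[OF i j z])
    have "cmod (1 - X j i z) \<ge> 1 - cmod (X j i z)" using norm_triangle_ineq2[of 1 "X j i z"] by simp
    then have den: "cmod (1 - X j i z) \<ge> 7/8" using x by linarith
    have "cmod (of_int (\<sigma> (Suc i)) * (- ((if i < j then - of_nat (m i) else of_nat (m i)) * X j i z) / (1 - X j i z)))
        = m i * cmod (X j i z) / cmod (1 - X j i z)"
      using \<sigma>_pm[of "Suc i"] by (auto simp: norm_mult norm_divide)
    also have "\<dots> \<le> m i * cmod (X j i z) / (7/8)" using den by (intro divide_left_mono) auto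
    also have "\<dots> \<le> 4 * K * eps + (if i = j then d j / 7 else 0) + (if Suc i = j then d j / 7 else 0)"
    proof (cases "i = j \<or> Suc i = j")
      case True
      have "m i * cmod (X j i z) / (7/8) \<le> d j / 7" using X_near(1)[OF i j z True] by simp
      moreover have "4 * K * eps \<ge> 0" using eps_bounds(1) by simp
      ultimately show ?thesis using True by auto
    next
      case False
      then have "cmod (X j i z) \<le> eps" using X_far_between[OF i j] strip_between[OF j z] by blast
      then have "m i * cmod (X j i z) \<le> (2 * real K) * eps" using m_le[OF i] by (intro mult_mono) auto
      moreover have "real K * eps \<ge> 0" using eps_bounds(1) by simp
      ultimately show ?thesis using False by simp
    qed
    finally show "cmod (of_int (\<sigma> (Suc i)) * (- ((if i < j then - of_nat (m i) else of_nat (m i)) * X j i z) / (1 - X j i z)))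
      \<le> 4 * K * eps + (if i = j then d j / 7 else 0) + (if Suc i = j then d j / 7 else 0)" .
  qed (use eps_bounds(1) in auto)
  \<comment> \<open>The far terms add up to at most 4/100. The room \<open>d j / 21\<close> between
    \<open>2 * (d j / 7)\<close> and \<open>d j / 3\<close> is at least 2/21.\<close>
  also have "\<dots> \<le> d j / 3" using eps_bounds(3) d_ge[OF j] by simp
  finally show "cmod (\<Sum>i = 1..<n. of_int (\<sigma> (Suc i)) * (- ((if i < j then - of_nat (m i) else of_nat (m i)) * X j i z) / (1 - X j i z))) \<le> d j / 3" .
qed (use z in auto)

end

section \<open>Inverse branches of the lift, and escape near the moduli\<close>

context ring_map_bounds
begin

lemma \<sigma>_h_diff:
  assumes "j \<in> {1..n}"
  shows "d j * (rho j - \<tau>) = \<sigma> j * (V j - h j \<tau>)" "d j * (\<tau> - rho (j - 1)) = \<sigma> j * (h j \<tau> - V (j - 1))"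
proof -
  have "V (j - 1) = h j (rho (j - 1))" using assms by (auto simp: V_def)
  moreover have "V j = h j (rho j)" using h_rho[OF assms] by simp
  ultimately show "d j * (rho j - \<tau>) = \<sigma> j * (V j - h j \<tau>)" "d j * (\<tau> - rho (j - 1)) = \<sigma> j * (h j \<tau> - V (j - 1))"
    using \<sigma>_pm[of j] by (auto simp: h_def e_def algebra_simps)
qed

text \<open>At both ends of the ring the model is beyond the annulus by \<open>marg\<close>, which
  exceeds \<open>tol\<close> by more than 3/5. So where it is within 3/5 of the annulus, the
  tolerances are respected.\<close>

lemma h_in_range:
  assumes j: "j \<in> {1..n}" and h: "lo - 3/5 \<le> h j \<tau>" "h j \<tau> \<le> hi + 3/5"
  shows "d j * (rho j - \<tau>) \<ge> tol j" "d j * (\<tau> - rho (j - 1)) \<ge> tol (j - 1)"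
proof -
  have s: "\<sigma> (Suc j) = - \<sigma> j" "Suc (j - 1) = j" "j - 1 \<le> n" "j \<le> n" using \<sigma>_Suc j by auto
  have m: "marg j \<ge> tol j + 3/5" "marg (j - 1) \<ge> tol (j - 1) + 3/5" using marg_tol(1)[of j] marg_tol(1)[of "j - 1"] ln2 by linarith+
  consider "\<sigma> j = 1" | "\<sigma> j = -1" using \<sigma>_pm by blast
  then have "\<sigma> j * (V j - h j \<tau>) \<ge> tol j \<and> \<sigma> j * (h j \<tau> - V (j - 1)) \<ge> tol (j - 1)"
  proof cases
    case 1
    then show ?thesis using V_pole[of j] V_zero[of "j - 1"] s m h by simp
  next
    case 2
    then show ?thesis using V_zero[of j] V_pole[of "j - 1"] s m h by simp
  qed
  then show "d j * (rho j - \<tau>) \<ge> tol j" "d j * (\<tau> - rho (j - 1)) \<ge> tol (j - 1)"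
    using \<sigma>_h_diff[OF j, of \<tau>] by simp_all
qed

lemma e_nz: "j \<in> {1..n} \<Longrightarrow> e j \<noteq> 0"
  using abs_e[of j] d_ge[of j] by auto

lemma strip_iff:
  assumes "j \<in> {1..n}"
  shows "\<zeta> \<in> strip j \<longleftrightarrow> d j * (rho j - Re \<zeta>) \<ge> tol j \<and> d j * (Re \<zeta> - rho (j - 1)) \<ge> tol (j - 1)"
  using d_ge[OF assms] by (auto simp: strip_def field_simps)

lemma inverse_step_in_strip:
  assumes j: "j \<in> {1..n}" and w: "Re w \<in> {lo..hi}" and z: "\<zeta> \<in> strip j"
  shows "(w - C j - u j \<zeta>) / of_int (e j) \<in> strip j"
proof -
  define \<tau> where "\<tau> = Re ((w - C j - u j \<zeta>) / of_int (e j))"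
  have "\<tau> = (Re w - c j - Re (u j \<zeta>)) / e j"
  proof -
    have "(of_int (e j) :: complex) = complex_of_real (e j)" by simp
    then show ?thesis unfolding \<tau>_def by (simp only: Re_divide_of_real) (simp add: Re_C[OF j])
  qed
  then have "h j \<tau> = Re w - Re (u j \<zeta>)" using e_nz[OF j] by (simp add: h_def)
  moreover have "\<bar>Re (u j \<zeta>)\<bar> \<le> 3/5" using u_bound[OF j z] abs_Re_le_cmod[of "u j \<zeta>"] by linarith
  ultimately have "lo - 3/5 \<le> h j \<tau>" "h j \<tau> \<le> hi + 3/5" using w by auto
  from h_in_range[OF j this] show ?thesis unfolding strip_iff[OF j] \<tau>_def by simp
qed

lemma strip_nonempty: assumes j: "j \<in> {1..n}" shows "strip j \<noteq> {}"
proof -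
  have "d j * (rho j - rho (j - 1)) \<ge> tol j + tol (j - 1)"
    using gap_width[of "j - 1"] j marg_tol(1)[of j] marg_tol(1)[of "j - 1"] ln2 lo_less_hi by (cases j) auto
  then have "complex_of_real (rho (j - 1) + tol (j - 1) / d j) \<in> strip j"
    using d_ge[OF j] by (simp add: strip_iff[OF j] algebra_simps)
  then show ?thesis by blast
qed

text \<open>Solved for the linear term, the equation asks for a fixed point of a map of the strip
  into itself. Its contraction factor is 1/3, the Lipschitz constant \<open>d j / 3\<close> of
  \<open>u j\<close> divided by \<open>d j\<close>.\<close>

lemma G_ex1:
  assumes j: "j \<in> {1..n}" and w: "Re w \<in> {lo..hi}"
  shows "\<exists>!\<zeta>. \<zeta> \<in> strip j \<and> of_int (e j) * \<zeta> + C j + u j \<zeta> = w"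
proof -
  let ?g = "\<lambda>\<zeta>. (w - C j - u j \<zeta>) / of_int (e j)"
  have "\<exists>!\<zeta>\<in>strip j. ?g \<zeta> = \<zeta>"
  proof (rule Banach_fix)
    have "strip j = {z. rho (j - 1) + tol (j - 1) / d j \<le> Re z} \<inter> {z. Re z \<le> rho j - tol j / d j}"
      by (auto simp: strip_def)
    then show "complete (strip j)"
      by (simp add: complete_eq_closed closed_Int closed_halfspace_Re_ge closed_halfspace_Re_le)
    show "dist (?g x) (?g y) \<le> 1/3 * dist x y" if xy: "x \<in> strip j" "y \<in> strip j" for x y
    proof -
      have "?g x - ?g y = - ((u j x - u j y) / of_int (e j))" by (simp add: diff_divide_distrib)
      then have "dist (?g x) (?g y) = cmod (u j x - u j y) / d j"
        using abs_e[of j] unfolding dist_norm by (simp add: norm_divide) (metis of_int_abs of_int_of_nat_eq)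
      also have "\<dots> \<le> (d j / 3 * cmod (x - y)) / d j" by (intro divide_right_mono u_Lipschitz j xy) simp
      finally show "dist (?g x) (?g y) \<le> 1/3 * dist x y" using d_ge[OF j] by (simp add: dist_norm)
    qed
  qed (use inverse_step_in_strip[OF j w] strip_nonempty[OF j] in auto)
  moreover have "?g \<zeta> = \<zeta> \<longleftrightarrow> of_int (e j) * \<zeta> + C j + u j \<zeta> = w" for \<zeta>
    using e_nz[OF j] by (auto simp: field_simps)
  ultimately show ?thesis by auto
qed

definition G :: "nat \<Rightarrow> complex \<Rightarrow> complex" where
  "G j w = (THE \<zeta>. \<zeta> \<in> strip j \<and> of_int (e j) * \<zeta> + C j + u j \<zeta> = w)"

lemma G_spec:
  assumes "j \<in> {1..n}" "Re w \<in> {lo..hi}"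
  shows "G j w \<in> strip j" "of_int (e j) * G j w + C j + u j (G j w) = w"
  using theI'[OF G_ex1[OF assms]] unfolding G_def by blast+

lemma G_eqI:
  assumes "j \<in> {1..n}" "Re w \<in> {lo..hi}" "\<zeta> \<in> strip j" "of_int (e j) * \<zeta> + C j + u j \<zeta> = w"
  shows "G j w = \<zeta>"
  unfolding G_def using G_ex1[OF assms(1,2)] assms(3,4) by (intro the1_equality) auto

lemma strip_X_ne1: "i \<in> {1..<n} \<Longrightarrow> j \<in> {1..n} \<Longrightarrow> \<zeta> \<in> strip j \<Longrightarrow> X j i \<zeta> \<noteq> 1"
  using strip_X_small(2)[of i j \<zeta>] by auto

lemma f_exp_strip:
  assumes "j \<in> {1..n}" "\<zeta> \<in> strip j"
  shows "f (exp \<zeta>) = exp (of_int (e j) * \<zeta> + C j + u j \<zeta>)"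
  using f_exp_factor[OF assms(1) order_refl strip_X_ne1[OF _ assms]] by (simp add: u_def)

lemma u_periodic: "u j (\<zeta> + 2 * pi * \<i>) = u j \<zeta>"
proof -
  have "X j i (\<zeta> + 2 * pi * \<i>) = X j i \<zeta>" for i
  proof -
    have "exp (of_nat (m i) * (\<zeta> + 2 * pi * \<i>)) = exp (of_nat (m i) * \<zeta>)"
      using exp_integer_2pi[of "of_nat (m i)"] by (simp add: distrib_left exp_add mult_ac)
    then show ?thesis by (simp add: X_def exp_minus)
  qed
  then show ?thesis by (simp add: u_def)
qed

lemma strips_disjoint:
  assumes "i \<in> {1..n}" "j \<in> {1..n}" "w \<in> strip i" "z \<in> strip j" "Re w = Re z"
  shows "i = j"
proof -
  have "False" if ij: "i < j" "i \<in> {1..n}" "j \<in> {1..n}" "w \<in> strip i" "z \<in> strip j" "Re w = Re z" for i j w z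
  proof -
    have "rho i \<le> rho (j - 1)" by (rule rho_le) (use ij in auto)
    moreover have "tol i > 0" using ij ln8 by (auto simp: tol_def)
    then have "tol i / d i > 0" using d_ge[OF ij(2)] by simp
    ultimately show False using ij tol_div(1)[OF ij(3), of "j - 1"] by (auto simp: strip_def)
  qed
  then show ?thesis using assms by (metis linorder_neqE_nat)
qed

text \<open>The lift expands by at least \<open>2/3 * d i\<close>, that is by 4/3, so its inverse
  contracts by 3/4. The summand 1 in the last constant dominates the bound 3/5 of
  \<open>u\<close>.\<close>

lemma circle_ifs_G:
  assumes "cantor_code n psi idx T"
  shows "circle_ifs n psi idx T e G lo hi (3/4) ((\<Sum>j = 1..n. cmod (C j)) + 1)"
proof -
  interpret cantor_code n psi idx T by fact
  show ?thesis
  proof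
    fix i w assume i: "i \<in> {1..n}" and w: "Re w \<in> {lo..hi}"
    note G = G_spec[OF i w]
    have "rho (i - 1) \<in> {lo..hi}" "rho i \<in> {lo..hi}" using rho_range[of "i - 1"] rho_range[of i] i by auto
    then show "Re (G i w) \<in> {lo..hi}" using strip_between[OF i G(1)] by auto
    show "G i (w + of_int (e i) * (2 * pi * \<i>)) = G i w + 2 * pi * \<i>"
    proof (rule G_eqI[OF i])
      show "G i w + 2 * pi * \<i> \<in> strip i" using G(1) by (simp add: strip_def)
      show "of_int (e i) * (G i w + 2 * pi * \<i>) + C i + u i (G i w + 2 * pi * \<i>) = w + of_int (e i) * (2 * pi * \<i>)"
        unfolding u_periodic using G(2) by (simp add: algebra_simps)
    qed (use w in simp)
    have "G i w - w / of_int (e i) = - (C i + u i (G i w)) / of_int (e i)"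
      using G(2) e_nz[OF i] by (simp add: field_simps)
    then have "cmod (G i w - w / of_int (e i)) = cmod (C i + u i (G i w)) / \<bar>real_of_int (e i)\<bar>"
      by (simp add: norm_divide norm_minus_commute) (metis norm_minus_cancel minus_add_distrib diff_conv_add_uminus)
    also have "\<dots> \<le> cmod (C i + u i (G i w)) / 1"
      using abs_e[of i] d_ge[OF i] by (intro divide_left_mono) (simp_all flip: of_int_abs)
    also have "\<dots> \<le> cmod (C i) + 3/5" using norm_triangle_ineq[of "C i" "u i (G i w)"] u_bound[OF i G(1)] by simp
    also have "cmod (C i) \<le> (\<Sum>j = 1..n. cmod (C j))" by (rule member_le_sum[OF i]) auto
    finally show "cmod (G i w - w / of_int (e i)) \<le> (\<Sum>j = 1..n. cmod (C j)) + 1" by simp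
    fix w' assume w': "Re w' \<in> {lo..hi}"
    note G' = G_spec[OF i w']
    show "w = w'" if "G i w = G i w'" using that G(2) G'(2) by metis
    have "of_int (e i) * (G i w - G i w') = (w - w') - (u i (G i w) - u i (G i w'))"
    proof -
      have "(x + c + v) - (x' + c + v') - (v - v') = x - x'" for x x' c v v' :: complex by simp
      from this[of "of_int (e i) * G i w" "C i" "u i (G i w)" "of_int (e i) * G i w'" "u i (G i w')"]
      show ?thesis unfolding G(2) G'(2) right_diff_distrib by simp
    qed
    then have "cmod (of_int (e i) * (G i w - G i w')) \<le> cmod (w - w') + d i / 3 * cmod (G i w - G i w')"
      using norm_triangle_ineq4[of "w - w'" "u i (G i w) - u i (G i w')"] u_Lipschitz[OF i G(1) G'(1)] by simp
    moreover have "cmod (of_int (e i) * (G i w - G i w')) = d i * cmod (G i w - G i w')"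
      using abs_e[of i] by (simp add: norm_mult) (metis of_int_abs of_int_of_nat_eq)
    ultimately have "(2/3 * d i) * cmod (G i w - G i w') \<le> cmod (w - w')" by (simp add: algebra_simps)
    moreover have "(4/3) * cmod (G i w - G i w') \<le> (2/3 * d i) * cmod (G i w - G i w')"
      using d_ge[OF i] by (intro mult_right_mono) auto
    ultimately show "cmod (G i w - G i w') \<le> 3/4 * cmod (w - w')" by linarith
  next
    fix i j w w' assume "i \<in> {1..n}" "j \<in> {1..n}" "Re w \<in> {lo..hi}" "Re w' \<in> {lo..hi}" "Re (G i w) = Re (G j w')"
    then show "i = j" using strips_disjoint G_spec(1) by metis
  next
    fix i assume "i \<in> {1..n}"
    then show "2 \<le> \<bar>e i\<bar>" using abs_e[of i] d_ge[of i] by simp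
  qed (use lo_less_hi in auto)
qed

lemma between_index:
  assumes "\<tau> \<in> {lo..hi}"
  shows "\<exists>j \<in> {1..n}. rho (j - 1) \<le> \<tau> \<and> \<tau> \<le> rho j"
proof -
  define j where "j = (LEAST j. j \<ge> 1 \<and> \<tau> \<le> rho j)"
  have n: "n \<ge> 1 \<and> \<tau> \<le> rho n" using assms n_ge by (simp add: rho_def)
  have j: "j \<ge> 1 \<and> \<tau> \<le> rho j" unfolding j_def by (rule LeastI[of _ n]) (rule n)
  have "j \<le> n" unfolding j_def by (rule Least_le) (rule n)
  moreover have "rho (j - 1) \<le> \<tau>"
  proof (cases "j = 1")
    case True
    then show ?thesis using assms by (simp add: rho_def)
  next
    case False
    then have "\<not> (j - 1 \<ge> 1 \<and> \<tau> \<le> rho (j - 1))" unfolding j_def using j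
      by (intro not_less_Least) (auto simp: j_def)
    then show ?thesis using False j by auto
  qed
  ultimately show ?thesis using j by auto
qed

lemma small_sum:
  assumes "I \<subseteq> {1..<n}" "\<And>i. i \<in> I \<Longrightarrow> cmod (X j i \<zeta>) \<le> eps"
  shows "\<bar>Re (\<Sum>i\<in>I. of_int (\<sigma> (Suc i)) * Ln (1 - X j i \<zeta>))\<bar> \<le> 1/100"
proof -
  have "\<bar>Re (\<Sum>i\<in>I. of_int (\<sigma> (Suc i)) * Ln (1 - X j i \<zeta>))\<bar> \<le> cmod (\<Sum>i\<in>I. of_int (\<sigma> (Suc i)) * Ln (1 - X j i \<zeta>))"
    by (rule abs_Re_le_cmod)
  also have "\<dots> \<le> (\<Sum>i\<in>I. 2 * eps)"
  proof (rule sum_norm_le)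
    fix i assume i: "i \<in> I"
    have "cmod (X j i \<zeta>) \<le> 1/8" using assms(2)[OF i] eps_bounds(4) by linarith
    from Ln_bound[OF this] show "cmod (of_int (\<sigma> (Suc i)) * Ln (1 - X j i \<zeta>)) \<le> 2 * eps"
      using \<sigma>_pm[of "Suc i"] assms(2)[OF i] by (auto simp: norm_mult)
  qed
  also have "\<dots> = card I * (2 * eps)" by simp
  also have "\<dots> \<le> n * (2 * eps)"
  proof -
    have "card I \<le> card {1..<n}" by (rule card_mono) (use assms in auto)
    then show ?thesis using eps_bounds(1) by (intro mult_right_mono) auto
  qed
  also have "\<dots> \<le> 1/100" using eps_bounds(2) by simp
  finally show ?thesis .
qed

definition Poles :: "complex set" where
  "Poles = {z. \<exists>i \<in> {1..<n}. \<sigma> (Suc i) = -1 \<and> z ^ m i = a i ^ m i} \<union> (if \<sigma> 1 = -1 then {0} else {})"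

lemma X_eq_1_iff: "i \<in> {1..<n} \<Longrightarrow> X j i \<zeta> = 1 \<longleftrightarrow> exp \<zeta> ^ m i = a i ^ m i"
  using a_nz[of i] by (auto simp: X_def exp_of_nat_mult exp_of_nat2_mult exp_minus field_simps)

text \<open>Close to \<open>rho i\<close> the factor of \<open>a i\<close> is beyond control, except
  that \<open>1 - X\<close> has modulus at most 2. One bound is enough: in the numerator a small
  factor only helps, and in the denominator it only enlarges the value. Hence the escape is towards
  \<open>0\<close> or towards infinity according to the sign, unless the point is a pole.\<close>

lemma gap_escape:
  assumes i: "i \<in> {1..<n}" and j: "j = i \<or> j = Suc i"
    and b: "rho (j - 1) \<le> Re \<zeta>" "Re \<zeta> \<le> rho j"
    and near: "d j * \<bar>Re \<zeta> - rho i\<bar> \<le> ln 8"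
  shows "cmod (f (exp \<zeta>)) < exp (lo - 1/2) \<and> \<sigma> (Suc i) = 1 \<or>
    \<sigma> (Suc i) = -1 \<and> (exp \<zeta> \<in> Poles \<or> cmod (f (exp \<zeta>)) > exp (hi + 1/2))"
proof -
  have jn: "j \<in> {1..n}" using i j by auto
  have ti: "marg i = ln 32" using i by (simp add: marg_def)
  have far: "cmod (X j k \<zeta>) \<le> eps" if k: "k \<in> {1..<n} - {i}" for k
  proof (cases "k = j \<or> Suc k = j")
    case False
    then show ?thesis using X_far_between[of k j \<zeta>] jn b k by auto
  next
    case True
    \<comment> \<open>The modulus at the opposite end of the ring. The point is displaced from
      \<open>rho i\<close> by at most \<open>ln 8\<close> in the scaled distance, and the margin
      \<open>ln 32\<close> contained in the width of the ring pays for that.\<close>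
    show ?thesis
    proof (rule X_far)
      assume "k < j"
      then have kj: "Suc k = i" "j = i" using True j k by auto
      have "d i * (rho i - rho k) \<ge> (hi - lo) + marg k + marg i" using gap_width[of k] kj k by auto
      moreover have "d i * (rho i - Re \<zeta>) \<le> ln 8" using near kj b by simp
      ultimately have "d i * (Re \<zeta> - rho k) \<ge> hi - lo"
        using ti ln32 marg_tol(3)[of k] ln2 by (simp add: algebra_simps)
      also have "d i * (Re \<zeta> - rho k) \<le> m k * (Re \<zeta> - rho k)"
        using b(1) kj by (intro mult_right_mono) (auto simp: m_def)
      finally show "m k * (Re \<zeta> - rho k) \<ge> hi - lo" .
    next
      assume "\<not> k < j"
      then have kj: "k = Suc i" "j = Suc i" using True j k by auto
      have "d k * (rho k - rho i) \<ge> (hi - lo) + marg k + marg i" using gap_width[of i] kj k by auto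
      moreover have "d k * (Re \<zeta> - rho i) \<le> ln 8" using near kj b by simp
      ultimately have "d k * (rho k - Re \<zeta>) \<ge> hi - lo"
        using ti ln32 marg_tol(3)[of k] ln2 by (simp add: algebra_simps)
      also have "d k * (rho k - Re \<zeta>) \<le> m k * (rho k - Re \<zeta>)"
        using b(2) kj by (intro mult_right_mono) (auto simp: m_def)
      finally show "m k * (rho k - Re \<zeta>) \<ge> hi - lo" .
    qed (use k in auto)
  qed
  define S where "S = (\<Sum>k\<in>{1..<n} - {i}. of_int (\<sigma> (Suc k)) * Ln (1 - X j k \<zeta>))"
  have S: "\<bar>Re S\<bar> \<le> 1/100" unfolding S_def by (rule small_sum) (use far in auto)
  have "{1..<n} - ({1..<n} - {i}) = {i}" using i by auto
  then have "f (exp \<zeta>) = exp (of_int (e j) * \<zeta> + C j + S) * (1 - X j i \<zeta>) powi \<sigma> (Suc i)"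
    unfolding S_def using f_exp_factor[OF jn, of "{1..<n} - {i}" \<zeta>] far eps_bounds(4) by fastforce
  then have "cmod (f (exp \<zeta>)) = exp (Re (of_int (e j) * \<zeta> + C j + S)) * cmod (1 - X j i \<zeta>) powi \<sigma> (Suc i)"
    by (simp add: norm_mult norm_power_int)
  also have "Re (of_int (e j) * \<zeta> + C j + S) = h j (Re \<zeta>) + Re S" using Re_C[OF jn] by (simp add: h_def)
  finally have f: "cmod (f (exp \<zeta>)) = exp (h j (Re \<zeta>) + Re S) * cmod (1 - X j i \<zeta>) powi \<sigma> (Suc i)" .
  have "cmod (X j i \<zeta>) \<le> 1"
    unfolding cmod_X[OF i] using j b by auto
  then have X2: "cmod (1 - X j i \<zeta>) \<le> 2" using norm_triangle_ineq4[of 1 "X j i \<zeta>"] by simp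
  have hV: "\<bar>h j (Re \<zeta>) - V i\<bar> \<le> ln 8"
  proof -
    have "h j (rho i) = V i" using j h_rho[of i] i by (auto simp: V_def)
    then have "\<bar>h j (Re \<zeta>) - V i\<bar> = \<bar>real_of_int (e j) * (Re \<zeta> - rho i)\<bar>" by (simp add: h_def algebra_simps)
    also have "\<dots> = d j * \<bar>Re \<zeta> - rho i\<bar>" using abs_e[of j] by (simp add: abs_mult) (metis of_int_abs of_int_of_nat_eq)
    finally show ?thesis using near by simp
  qed
  consider "\<sigma> (Suc i) = 1" | "\<sigma> (Suc i) = -1" using \<sigma>_pm by blast
  then show ?thesis
  proof cases
    case 1
    have "V i \<le> lo - ln 32" using V_zero[of i] 1 i ti by simp
    then have "h j (Re \<zeta>) + Re S < (lo - 1/2) - ln 2" using hV S ln32 ln2 by linarith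
    then have "exp (h j (Re \<zeta>) + Re S) < exp (lo - 1/2) / 2" by (metis exp_diff exp_less_cancel_iff exp_ln zero_less_numeral)
    moreover have "cmod (f (exp \<zeta>)) \<le> exp (h j (Re \<zeta>) + Re S) * 2" unfolding f 1 using X2 by simp
    ultimately show ?thesis using 1 by simp
  next
    case 2
    show ?thesis
    proof (cases "X j i \<zeta> = 1")
      case True
      then show ?thesis using 2 i X_eq_1_iff[OF i] by (auto simp: Poles_def)
    next
      case False
      have "V i \<ge> hi + ln 32" using V_pole[of i] 2 i ti by simp
      then have "h j (Re \<zeta>) + Re S > (hi + 1/2) + ln 2" using hV S ln32 ln2 by linarith
      then have "exp (h j (Re \<zeta>) + Re S) > exp (hi + 1/2) * 2" by (metis exp_add exp_less_cancel_iff exp_ln zero_less_numeral)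
      moreover have "cmod (f (exp \<zeta>)) \<ge> exp (h j (Re \<zeta>) + Re S) / 2"
      proof -
        have "1 / 2 \<le> inverse (cmod (1 - X j i \<zeta>))"
          using X2 False le_imp_inverse_le[of "cmod (1 - X j i \<zeta>)" 2] by simp
        then have "exp (h j (Re \<zeta>) + Re S) * (1/2) \<le> exp (h j (Re \<zeta>) + Re S) * inverse (cmod (1 - X j i \<zeta>))"
          by (intro mult_left_mono) auto
        then show ?thesis unfolding f 2 by simp
      qed
      ultimately show ?thesis using 2 by simp
    qed
  qed
qed

text \<open>On the annulus, points outside all the strips are close to some \<open>a i\<close> in modulus and leave the annulus.\<close>

lemma strip_or_escape:
  assumes "Re \<zeta> \<in> {lo..hi}"
  shows "(\<exists>j \<in> {1..n}. \<zeta> \<in> strip j) \<or> cmod (f (exp \<zeta>)) < exp lo \<or> exp \<zeta> \<in> Poles \<or> cmod (f (exp \<zeta>)) > exp hi"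
proof -
  obtain j where j: "j \<in> {1..n}" "rho (j - 1) \<le> Re \<zeta>" "Re \<zeta> \<le> rho j" using between_index[OF assms] by blast
  have esc: ?thesis if "i \<in> {1..<n}" "j = i \<or> j = Suc i" "d j * \<bar>Re \<zeta> - rho i\<bar> \<le> ln 8" for i
  proof -
    have "exp (lo - 1/2) < exp lo" "exp hi < exp (hi + 1/2)" by simp_all
    then show ?thesis using gap_escape[OF that(1,2) j(2,3) that(3)] by linarith
  qed
  show ?thesis
  proof (cases "\<zeta> \<in> strip j")
    case False
    then consider "d j * (rho j - Re \<zeta>) < tol j" | "d j * (Re \<zeta> - rho (j - 1)) < tol (j - 1)"
      unfolding strip_iff[OF j(1)] by linarith
    then show ?thesis
    proof cases
      case 1
      have "d j * (rho j - Re \<zeta>) \<ge> 0" using j by simp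
      then have "j \<noteq> n" using 1 by (auto simp: tol_def)
      then show ?thesis using 1 j marg_tol(4)[of j] by (intro esc[of j]) auto
    next
      case 2
      have "d j * (Re \<zeta> - rho (j - 1)) \<ge> 0" using j by simp
      then have "j \<noteq> 1" using 2 by (auto simp: tol_def)
      then show ?thesis using 2 j marg_tol(4)[of "j - 1"] by (intro esc[of "j - 1"]) auto
    qed
  qed (use j in blast)
qed

text \<open>By the convention for the inverse of \<open>0\<close>, not as a limit. Thus an image of
  the form \<open>exp w'\<close> already shows that the point is not a pole.\<close>

lemma f_Poles_eq_0: assumes "z \<in> Poles" shows "f z = 0"
proof (cases "z = 0 \<and> \<sigma> 1 = -1")
  case True
  then have "e 1 \<noteq> 0" using e_nz[of 1] n_ge by simp
  then show ?thesis using True by (simp add: f_def power_int_0_left)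
next
  case False
  then obtain i where "i \<in> {1..<n}" "\<sigma> (Suc i) = -1" "z ^ m i = a i ^ m i" using assms by (auto simp: Poles_def split: if_splits)
  then have "\<exists>i\<in>{1..<n}. (z ^ m i - a i ^ m i) powi \<sigma> (Suc i) = 0" by (intro bexI[of _ i]) auto
  then have "(\<Prod>i = 1..<n. (z ^ m i - a i ^ m i) powi \<sigma> (Suc i)) = 0" by simp
  then show ?thesis by (simp add: f_def)
qed

lemma circle_dyn_f:
  assumes "cantor_code n psi idx T"
  shows "circle_dyn n psi idx T e G lo hi (3/4) ((\<Sum>j = 1..n. cmod (C j)) + 1) f"
proof -
  interpret circle_ifs n psi idx T e G lo hi "3/4" "(\<Sum>j = 1..n. cmod (C j)) + 1"
    by (rule circle_ifs_G[OF assms])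
  show ?thesis
  proof
    fix i w assume "i \<in> {1..n}" "Re w \<in> {lo..hi}"
    then show "f (exp (G i w)) = exp w" using f_exp_strip G_spec by metis
  next
    fix w w' assume w: "Re w \<in> {lo..hi}" "f (exp w) = exp w'" "Re w' \<in> {lo..hi}"
    have "cmod (f (exp w)) = exp (Re w')" using w by simp
    moreover have "exp lo \<le> exp (Re w')" "exp (Re w') \<le> exp hi" using w(3) by auto
    moreover have "exp w \<notin> Poles" using f_Poles_eq_0[of "exp w"] w(2) by auto
    ultimately obtain j where j: "j \<in> {1..n}" "w \<in> strip j" using strip_or_escape[OF w(1)] by auto
    define v where "v = of_int (e j) * w + C j + u j w"
    have v: "exp v = f (exp w)" unfolding v_def using f_exp_strip[OF j] by simp
    then have "exp (Re v) = exp (Re w')" using w(2) by (metis norm_exp_eq_Re)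
    then have "Re v \<in> {lo..hi}" using w(3) by simp
    moreover have "G j v = w" by (rule G_eqI[OF j(1) calculation j(2)]) (simp add: v_def)
    ultimately show "\<exists>i\<in>{1..n}. \<exists>v. Re v \<in> {lo..hi} \<and> w = G i v \<and> exp v = f (exp w)" using j(1) v by blast
  qed
qed

end

subsection \<open>The Julia set of the map\<close>

lemma dist_stereo_north: "z \<noteq> 0 \<Longrightarrow> dist (stereo z) north \<le> 2 / cmod z"
  and dist_stereo_0: "dist (stereo z) (stereo 0) \<le> 2 * cmod z"
proof -
  define r where "r = (cmod z)\<^sup>2"
  have r: "1 + r > 0" "r \<ge> 0" by (simp_all add: r_def add_pos_nonneg)
  have q: "(cmod (fst (stereo z)))\<^sup>2 = 4 * r / (1 + r)\<^sup>2"
    unfolding stereo_def fst_conv norm_mult norm_of_real power_mult_distrib r_def by (simp add: power_divide)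
  have s: "snd (stereo z) = (r - 1) / (1 + r)" by (simp add: stereo_def r_def add.commute)
  have nn: "0 \<le> 4 * r / (1 + r)\<^sup>2 + y\<^sup>2" for y :: real
    by (intro add_nonneg_nonneg divide_nonneg_nonneg) (use r in auto)
  have "(dist (stereo z) north)\<^sup>2 = 4 * r / (1 + r)\<^sup>2 + ((r - 1) / (1 + r) - 1)\<^sup>2"
    unfolding dist_norm by (cases "stereo z") (use q s nn in \<open>simp add: norm_Pair north_def\<close>)
  also have "(r - 1) / (1 + r) - 1 = - 2 / (1 + r)" using r by (simp add: field_simps)
  also have "4 * r / (1 + r)\<^sup>2 + (- 2 / (1 + r))\<^sup>2 = (4 * (1 + r)) / (1 + r)\<^sup>2"
    by (simp add: power_divide add_divide_distrib[symmetric] distrib_left)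
  also have "\<dots> = 4 / (1 + r)" using r by (simp add: power2_eq_square del: distrib_left_numeral)
  finally have N: "(dist (stereo z) north)\<^sup>2 = 4 / (1 + r)" .
  show "dist (stereo z) north \<le> 2 / cmod z" if "z \<noteq> 0"
  proof (rule power2_le_imp_le)
    have "4 / (1 + r) \<le> 4 / r" using that r by (intro divide_left_mono) (auto simp: r_def)
    then show "(dist (stereo z) north)\<^sup>2 \<le> (2 / cmod z)\<^sup>2" unfolding N by (simp add: r_def power_divide)
  qed simp
  have s0: "stereo 0 = (0, -1)" by (simp add: stereo_def)
  have "(dist (stereo z) (stereo 0))\<^sup>2 = 4 * r / (1 + r)\<^sup>2 + ((r - 1) / (1 + r) + 1)\<^sup>2"
    unfolding dist_norm s0 by (cases "stereo z") (use q s nn[of "(r - 1) / (1 + r) + 1"] in \<open>simp add: norm_Pair\<close>)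
  also have "(r - 1) / (1 + r) + 1 = 2 * r / (1 + r)" using r by (simp add: field_simps)
  also have "4 * r / (1 + r)\<^sup>2 + (2 * r / (1 + r))\<^sup>2 = (4 * r * (1 + r)) / (1 + r)\<^sup>2"
    by (simp add: power_divide add_divide_distrib[symmetric] distrib_left power2_eq_square)
  also have "\<dots> = 4 * r / (1 + r)" using r by (simp add: power2_eq_square)
  also have "\<dots> \<le> 4 * r" using r by (simp add: divide_le_eq mult_le_cancel_left1)
  finally have "(dist (stereo z) (stereo 0))\<^sup>2 \<le> (2 * cmod z)\<^sup>2" by (simp add: r_def power_mult_distrib)
  then show "dist (stereo z) (stereo 0) \<le> 2 * cmod z" by (rule power2_le_imp_le) simp
qed

context ring_map_bounds
begin

definition num :: "complex \<Rightarrow> complex" where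
  "num z = (if \<sigma> 1 = 1 then z ^ d 1 else 1) * (\<Prod>i = 1..<n. if \<sigma> (Suc i) = 1 then z ^ m i - a i ^ m i else 1)"

definition den :: "complex \<Rightarrow> complex" where
  "den z = (if \<sigma> 1 = 1 then 1 else z ^ d 1) * (\<Prod>i = 1..<n. if \<sigma> (Suc i) = 1 then 1 else z ^ m i - a i ^ m i)"

lemma f_eq_quotient: "f z = num z / den z"
proof -
  have 1: "z powi e 1 = (if \<sigma> 1 = 1 then z ^ d 1 else 1) / (if \<sigma> 1 = 1 then 1 else z ^ d 1)"
    using \<sigma>_pm[of 1] by (auto simp: e_def power_int_minus divide_inverse)
  have 2: "(z ^ m i - a i ^ m i) powi \<sigma> (Suc i) = (if \<sigma> (Suc i) = 1 then z ^ m i - a i ^ m i else 1) /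
      (if \<sigma> (Suc i) = 1 then 1 else z ^ m i - a i ^ m i)" for i
    using \<sigma>_pm[of "Suc i"] by (auto simp: power_int_minus divide_inverse)
  show ?thesis unfolding f_def 1 2 prod_dividef num_def den_def by simp
qed

lemma d_pos: "i \<in> {1..n} \<Longrightarrow> d i > 0"
  using d_ge[of i] by simp

lemma m_pos: "i \<in> {1..<n} \<Longrightarrow> m i > 0"
  using d_pos[of i] by (simp add: m_def)

lemma den_eq_0_iff: "den z = 0 \<longleftrightarrow> z \<in> Poles"
proof -
  have "(if \<sigma> (Suc i) = 1 then 1 else z ^ m i - a i ^ m i) = 0 \<longleftrightarrow> \<sigma> (Suc i) = -1 \<and> z ^ m i = a i ^ m i" for i
    using \<sigma>_pm[of "Suc i"] by auto
  then have "(\<Prod>i = 1..<n. if \<sigma> (Suc i) = 1 then 1 else z ^ m i - a i ^ m i) = 0 \<longleftrightarrow>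
      (\<exists>i \<in> {1..<n}. \<sigma> (Suc i) = -1 \<and> z ^ m i = a i ^ m i)" by (simp add: prod_zero_iff)
  moreover have "(if \<sigma> 1 = 1 then 1 else z ^ d 1) = 0 \<longleftrightarrow> \<sigma> 1 = -1 \<and> z = 0"
    using \<sigma>_pm[of 1] d_pos[of 1] n_ge by auto
  ultimately show ?thesis unfolding den_def Poles_def mult_eq_0_iff by auto
qed

text \<open>Numerator and denominator have no common zero, because zeros of different factors lie on
  circles of different radii.\<close>

lemma num_nonzero: assumes "z \<in> Poles" shows "num z \<noteq> 0"
proof
  assume "num z = 0"
  then consider "z = 0" "\<sigma> 1 = 1" | i where "i \<in> {1..<n}" "\<sigma> (Suc i) = 1" "z ^ m i = a i ^ m i"
    unfolding num_def by (auto simp: prod_zero_iff split: if_splits)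
  then show False
  proof cases
    case 1
    then obtain i where i: "i \<in> {1..<n}" "0 = a i ^ m i"
      using assms m_pos by (auto simp: Poles_def zero_power)
    then show False using a_nz by auto
  next
    case (2 i)
    have root: "cmod z = exp (rho i) \<and> z \<noteq> 0" if "i \<in> {1..<n}" "z ^ m i = a i ^ m i" for i
    proof -
      have "cmod z ^ m i = cmod (a i) ^ m i" using that(2) by (metis norm_power)
      then have "cmod z = cmod (a i)" using m_pos[OF that(1)] power_eq_imp_eq_base by fastforce
      then show ?thesis using cmod_a[OF that(1)] by (metis exp_not_eq_zero norm_zero)
    qed
    then obtain k where k: "k \<in> {1..<n}" "\<sigma> (Suc k) = -1" "z ^ m k = a k ^ m k"
      using assms root[OF 2(1,3)] by (auto simp: Poles_def split: if_splits)
    then have "rho i = rho k" using root[OF 2(1,3)] root[OF k(1,3)] by simp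
    then have "i = k" using rho_less[of i k] rho_less[of k i] 2(1) k(1) by (metis atLeastLessThan_iff less_irrefl less_imp_le linorder_neqE_nat)
    then show False using 2 k by simp
  qed
qed

lemma finite_Poles: "finite Poles"
proof -
  have "finite {z. z ^ m i = a i ^ m i}" if "i \<in> {1..<n}" for i using m_pos[OF that] by (simp add: finite_nth_roots)
  then have "finite (\<Union>i\<in>{1..<n}. {z. z ^ m i = a i ^ m i})" by auto
  then have "finite ((\<Union>i\<in>{1..<n}. {z. z ^ m i = a i ^ m i}) \<union> {0})" by simp
  then show ?thesis by (rule rev_finite_subset) (auto simp: Poles_def split: if_splits)
qed

lemma isCont_num: "isCont num z" and isCont_den: "isCont den z"
proof -
  have *: "isCont (\<lambda>z. if b then g z else h z) z" if "isCont g z" "isCont h z" for b and g h :: "complex \<Rightarrow> complex" and z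
    using that by (cases b) simp_all
  show "isCont num z" "isCont den z"
    unfolding num_def[abs_def] den_def[abs_def] by (intro continuous_mult continuous_prod * continuous_intros)+
qed

lemma f_outer:
  assumes "Re \<zeta> \<ge> hi"
  shows "\<exists>\<delta>. cmod (f (exp \<zeta>)) = exp (h n (Re \<zeta>) + \<delta>) \<and> \<bar>\<delta>\<bar> \<le> 1/100"
proof -
  have nn: "n \<in> {1..n}" using n_ge by simp
  have far: "cmod (X n i \<zeta>) \<le> eps" if i: "i \<in> {1..<n}" for i
  proof (rule X_far[OF i])
    have "rho (Suc i) \<le> rho n" using i by (intro rho_le) auto
    also have "rho n = hi" using n_ge by (simp add: rho_def)
    finally show "hi - lo \<le> real (m i) * (Re \<zeta> - rho i)" using assms by (intro far_left[OF i]) simp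
  qed (use i in simp)
  have ne: "X n i \<zeta> \<noteq> 1" if "i \<in> {1..<n}" for i using far[OF that] eps_bounds(4) by auto
  from f_exp_factor[OF nn order_refl ne, simplified]
  show ?thesis using small_sum[OF order_refl far] Re_C[OF nn] by (auto simp: h_def intro!: exI)
qed

lemma f_inner:
  assumes "Re \<zeta> \<le> lo"
  shows "\<exists>\<delta>. cmod (f (exp \<zeta>)) = exp (h 1 (Re \<zeta>) + \<delta>) \<and> \<bar>\<delta>\<bar> \<le> 1/100"
proof -
  have nn: "1 \<in> {1..n}" using n_ge by simp
  have far: "cmod (X 1 i \<zeta>) \<le> eps" if i: "i \<in> {1..<n}" for i
  proof (rule X_far[OF i])
    have "rho 0 \<le> rho (i - 1)" using i by (intro rho_le) auto
    then show "hi - lo \<le> real (m i) * (rho i - Re \<zeta>)" using assms by (intro far_right[OF i]) (simp add: rho_def)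
  qed (use i in simp)
  have ne: "X 1 i \<zeta> \<noteq> 1" if "i \<in> {1..<n}" for i using far[OF that] eps_bounds(4) by auto
  from f_exp_factor[OF nn order_refl ne, simplified]
  show ?thesis using small_sum[OF order_refl far] Re_C[OF nn] by (auto simp: h_def intro!: exI)
qed

lemma d_ge_2: "real (d 1) \<ge> 2" "real (d n) \<ge> 2"
  using d_ge[of 1] d_ge[of n] n_ge by simp_all

text \<open>The slope at least 2 more than preserves the logarithmic distance \<open>x\<close> from
  the annulus, and the margin \<open>ln 2\<close> at its boundary exceeds 1/2 by more than the error
  1/100. So each step adds 1/2 to the distance.\<close>

lemma f_outside:
  assumes "x \<ge> 0" "cmod z \<ge> exp (hi + x)"
  shows "\<sigma> n = 1 \<Longrightarrow> cmod (f z) > exp (hi + (x + 1/2))" "\<sigma> n = -1 \<Longrightarrow> cmod (f z) < exp (lo - (x + 1/2))"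
proof -
  have nn: "n \<in> {1..n}" using n_ge by simp
  have z: "z \<noteq> 0" using assms(2) by (metis exp_gt_zero norm_zero not_le)
  define y where "y = ln (cmod z) - hi"
  have "hi + x \<le> ln (cmod z)" using assms(2) z by (simp add: ln_ge_iff)
  then have y: "y \<ge> x" by (simp add: y_def)
  obtain \<delta> where \<delta>: "cmod (f z) = exp (h n (hi + y) + \<delta>)" "\<bar>\<delta>\<bar> \<le> 1/100"
    using f_outer[of "Ln z"] z y assms(1) by (auto simp: y_def)
  have h: "h n (hi + y) = V n + e n * y" by (simp add: V_def h_def algebra_simps)
  have dy: "d n * y \<ge> 2 * y" using d_ge_2(2) y assms(1) by (intro mult_right_mono) auto
  have mg: "marg n = ln 2" by (simp add: marg_def)
  show "cmod (f z) > exp (hi + (x + 1/2))" if s: "\<sigma> n = 1"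
  proof -
    have "V n \<ge> hi + ln 2" using V_pole[of n] \<sigma>_Suc[of n] s mg by simp
    moreover have "e n * y = d n * y" using s by (simp add: e_def)
    ultimately have "h n (hi + y) + \<delta> > hi + (x + 1/2)" unfolding h using dy y assms(1) \<delta>(2) ln2 by linarith
    then show ?thesis unfolding \<delta>(1) by simp
  qed
  show "cmod (f z) < exp (lo - (x + 1/2))" if s: "\<sigma> n = -1"
  proof -
    have "V n \<le> lo - ln 2" using V_zero[of n] \<sigma>_Suc[of n] s mg by simp
    moreover have "e n * y = - (d n * y)" using s by (simp add: e_def)
    ultimately have "h n (hi + y) + \<delta> < lo - (x + 1/2)" unfolding h using dy y assms(1) \<delta>(2) ln2 by linarith
    then show ?thesis unfolding \<delta>(1) by simp
  qed
qed

lemma f_inside: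
  assumes "x \<ge> 0" "cmod z \<le> exp (lo - x)" "z \<noteq> 0"
  shows "\<sigma> 1 = 1 \<Longrightarrow> cmod (f z) < exp (lo - (x + 1/2))" "\<sigma> 1 = -1 \<Longrightarrow> cmod (f z) > exp (hi + (x + 1/2))"
proof -
  define y where "y = lo - ln (cmod z)"
  have "ln (cmod z) \<le> lo - x" using assms(2,3) by (metis exp_gt_zero ln_exp ln_le_cancel_iff zero_less_norm_iff)
  then have y: "y \<ge> x" by (simp add: y_def)
  obtain \<delta> where \<delta>: "cmod (f z) = exp (h 1 (lo - y) + \<delta>)" "\<bar>\<delta>\<bar> \<le> 1/100"
    using f_inner[of "Ln z"] assms(3) y assms(1) by (auto simp: y_def)
  have h: "h 1 (lo - y) = V 0 - e 1 * y" using n_ge by (simp add: V_def h_def rho_def algebra_simps)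
  have dy: "d 1 * y \<ge> 2 * y" using d_ge_2(1) y assms(1) by (intro mult_right_mono) auto
  have mg: "marg 0 = ln 2" by (simp add: marg_def)
  show "cmod (f z) > exp (hi + (x + 1/2))" if s: "\<sigma> 1 = -1"
  proof -
    have "V 0 \<ge> hi + ln 2" using V_pole[of 0] s mg by simp
    moreover have "e 1 * y = - (d 1 * y)" using s by (simp add: e_def)
    ultimately have "h 1 (lo - y) + \<delta> > hi + (x + 1/2)" unfolding h using dy y assms(1) \<delta>(2) ln2 by linarith
    then show ?thesis unfolding \<delta>(1) by simp
  qed
  show "cmod (f z) < exp (lo - (x + 1/2))" if s: "\<sigma> 1 = 1"
  proof -
    have "V 0 \<le> lo - ln 2" using V_zero[of 0] s mg by simp
    moreover have "e 1 * y = d 1 * y" using s by (simp add: e_def)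
    ultimately have "h 1 (lo - y) + \<delta> < lo - (x + 1/2)" unfolding h using dy y assms(1) \<delta>(2) ln2 by linarith
    then show ?thesis unfolding \<delta>(1) by simp
  qed
qed

lemma f_at_infinity: "\<sigma> n = 1 \<Longrightarrow> filterlim f at_infinity at_infinity" "\<sigma> n = -1 \<Longrightarrow> (f \<longlongrightarrow> 0) at_infinity"
proof -
  have big: "\<forall>\<^sub>F z in at_infinity. cmod z \<ge> exp (hi + x)" for x
    by (rule eventually_at_infinityI[where c = "exp (hi + x)"])
  show "filterlim f at_infinity at_infinity" if "\<sigma> n = 1"
  proof (rule filterlim_at_infinity[THEN iffD2, rule_format, of 0])
    fix r :: real assume r: "r > 0"
    define x where "x = max 0 (ln r - hi)"
    have "\<forall>\<^sub>F z in at_infinity. cmod z \<ge> exp (hi + x)" by (rule big)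
    then show "\<forall>\<^sub>F z in at_infinity. r \<le> cmod (f z)"
    proof eventually_elim
      case (elim z)
      have "r = exp (ln r)" using r by simp
      also have "\<dots> \<le> exp (hi + (x + 1/2))" by (simp add: x_def)
      also have "\<dots> \<le> cmod (f z)" using f_outside(1)[OF _ elim that] by (simp add: x_def)
      finally show ?case .
    qed
  qed simp
  show "(f \<longlongrightarrow> 0) at_infinity" if "\<sigma> n = -1"
  proof (rule tendstoI)
    fix r :: real assume r: "r > 0"
    define x where "x = max 0 (lo - ln r)"
    have "\<forall>\<^sub>F z in at_infinity. cmod z \<ge> exp (hi + x)" by (rule big)
    then show "\<forall>\<^sub>F z in at_infinity. dist (f z) 0 < r"
    proof eventually_elim
      case (elim z)
      have "cmod (f z) < exp (lo - (x + 1/2))" using f_outside(2)[OF _ elim that] by (simp add: x_def)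
      also have "\<dots> \<le> exp (ln r)" by (simp add: x_def)
      finally show ?case using r by simp
    qed
  qed
qed

sublocale sphere_map f Poles
proof
  show "finite Poles" by (rule finite_Poles)
  show "isCont f z" if "z \<notin> Poles" for z
    unfolding f_eq_quotient[abs_def] using that isCont_num isCont_den den_eq_0_iff by (intro continuous_divide) auto
  show "filterlim f at_infinity (at z)" if "z \<in> Poles" for z
    unfolding f_eq_quotient[abs_def]
  proof (rule filterlim_divide_at_infinity[where c = "num z"])
    show "(num \<longlongrightarrow> num z) (at z)" using isCont_num by (simp add: isCont_def)
    have "(den \<longlongrightarrow> 0) (at z)" using isCont_den[of z] den_eq_0_iff[of z] that by (simp add: isCont_def)
    moreover have "\<forall>\<^sub>F w in at z. w \<notin> Poles"
    proof -
      have "open (- (Poles - {z}))" by (intro open_Compl finite_imp_closed finite_Diff finite_Poles)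
      then have "\<forall>\<^sub>F w in nhds z. w \<in> - (Poles - {z})" by (rule eventually_nhds_in_open) simp
      then show ?thesis unfolding eventually_at_filter by eventually_elim auto
    qed
    ultimately show "filterlim den (at 0) (at z)" by (simp add: filterlim_at den_eq_0_iff)
    show "num z \<noteq> 0" by (rule num_nonzero[OF that])
  qed
  show "(\<exists>w. (f \<longlongrightarrow> w) at_infinity) \<or> filterlim f at_infinity at_infinity"
    using \<sigma>_pm[of n] f_at_infinity by blast
qed

abbreviation "F \<equiv> sphere_ext f"

text \<open>The flag \<open>True\<close> stands for infinity and \<open>False\<close> for \<open>0\<close>.\<close>

definition Dset :: "bool \<Rightarrow> real \<Rightarrow> (complex \<times> real) set" where
  "Dset b x = (if b then insert north (stereo ` {z. cmod z > exp (hi + x)}) else stereo ` {z. cmod z < exp (lo - x)})"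

definition nxt :: "bool \<Rightarrow> bool" where
  "nxt b = (if b then \<sigma> n = 1 else \<sigma> 1 = -1)"

lemma not_Poles_outside: assumes "z \<noteq> 0" "cmod z > exp hi \<or> cmod z < exp lo" shows "z \<notin> Poles"
proof
  assume "z \<in> Poles"
  then obtain i where i: "i \<in> {1..<n}" "z ^ m i = a i ^ m i" using assms by (auto simp: Poles_def split: if_splits)
  then have "cmod z ^ m i = cmod (a i) ^ m i" by (metis norm_power)
  then have "cmod z = cmod (a i)" using m_pos[OF i(1)] power_eq_imp_eq_base by fastforce
  then have "cmod z = exp (rho i)" using cmod_a[OF i(1)] by simp
  then show False using rho_range[of i] i(1) assms(2) by auto
qed

lemma F_Dset: assumes "x \<ge> 0" "P \<in> Dset b x" shows "F P \<in> Dset (nxt b) (x + 1/2)"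
proof (cases b)
  case True
  show ?thesis
  proof (cases "P = north")
    case True
    show ?thesis
    proof (cases "\<sigma> n = 1")
      case T: True
      then show ?thesis using sphere_ext_north_pole[OF f_at_infinity(1)[OF T]] True \<open>b\<close> by (simp add: Dset_def nxt_def)
    next
      case False
      then have "\<sigma> n = -1" using \<sigma>_pm[of n] by simp
      then show ?thesis using sphere_ext_north[OF f_at_infinity(2)] True False \<open>b\<close> by (simp add: Dset_def nxt_def)
    qed
  next
    case False
    then obtain z where z: "P = stereo z" "cmod z > exp (hi + x)" using assms True by (auto simp: Dset_def)
    have "exp hi \<le> exp (hi + x)" using assms by simp
    then have "cmod z > exp hi" using z(2) by (rule le_less_trans)
    then have "z \<noteq> 0" "cmod z > exp hi" by (auto simp: not_less[symmetric])
    then have FP: "F P = stereo (f z)" using sphere_ext_regular not_Poles_outside z by blast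
    show ?thesis using f_outside[OF assms(1) less_imp_le[OF z(2)]] \<sigma>_pm[of n] \<open>b\<close> unfolding FP by (auto simp: Dset_def nxt_def)
  qed
next
  case False
  then obtain z where z: "P = stereo z" "cmod z < exp (lo - x)" using assms by (auto simp: Dset_def)
  show ?thesis
  proof (cases "z = 0")
    case True
    show ?thesis
    proof (cases "\<sigma> 1 = 1")
      case T: True
      then have "0 \<notin> Poles" using a_nz m_pos by (auto simp: Poles_def zero_power split: if_splits) 
      moreover have "f 0 = 0" using T d_pos[of 1] n_ge by (simp add: f_def e_def power_int_0_left)
      ultimately show ?thesis using sphere_ext_regular[of 0] z True T \<open>\<not> b\<close> by (simp add: Dset_def nxt_def)
    next
      case F: False
      then have "\<sigma> 1 = -1" using \<sigma>_pm[of 1] by simp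
      then have "0 \<in> Poles" by (simp add: Poles_def)
      then show ?thesis using sphere_ext_X[of 0] z True \<open>\<sigma> 1 = -1\<close> \<open>\<not> b\<close> by (simp add: Dset_def nxt_def)
    qed
  next
    case False
    have "exp (lo - x) \<le> exp lo" using assms by simp
    then have "cmod z < exp lo" using z(2) by linarith
    then have FP: "F P = stereo (f z)" using sphere_ext_regular not_Poles_outside z False by blast
    show ?thesis using f_inside[OF assms(1) less_imp_le[OF z(2)] False] \<sigma>_pm[of 1] \<open>\<not> b\<close> unfolding FP by (auto simp: Dset_def nxt_def)
  qed
qed

lemma F_funpow_Dset: "P \<in> Dset b 0 \<Longrightarrow> (F ^^ k) P \<in> Dset ((nxt ^^ k) b) (k / 2)"
proof (induction k)
  case (Suc k)
  then show ?case using F_Dset[of "k / 2" "(F ^^ k) P" "(nxt ^^ k) b"] by (simp add: add_divide_distrib add.commute)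
qed simp

lemma Dset_dist:
  assumes "P \<in> Dset b x"
  shows "dist P (if b then north else stereo 0) \<le> (2 * exp lo + 2 * exp (- hi)) * exp (- x)"
proof (cases "b \<and> P = north")
  case False
  show ?thesis
  proof (cases b)
    case True
    then obtain z where z: "P = stereo z" "cmod z > exp (hi + x)" using assms False by (auto simp: Dset_def)
    then have "z \<noteq> 0" by (auto simp: not_less[symmetric])
    then have "dist P north \<le> 2 / cmod z" unfolding z(1) by (rule dist_stereo_north)
    also have "\<dots> \<le> 2 / exp (hi + x)" using z(2) \<open>z \<noteq> 0\<close> by (intro divide_left_mono) auto
    also have "\<dots> = 2 * exp (- hi) * exp (- x)" by (simp add: exp_add exp_minus field_simps)
    also have "\<dots> \<le> (2 * exp lo + 2 * exp (- hi)) * exp (- x)" by (intro mult_right_mono) auto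
    finally show ?thesis using True by simp
  next
    case F: False
    then obtain z where z: "P = stereo z" "cmod z < exp (lo - x)" using assms by (auto simp: Dset_def)
    have "dist P (stereo 0) \<le> 2 * cmod z" unfolding z(1) by (rule dist_stereo_0)
    also have "\<dots> \<le> 2 * exp (lo - x)" using z(2) by simp
    also have "\<dots> = 2 * exp lo * exp (- x)" by (simp add: exp_diff exp_minus field_simps)
    also have "\<dots> \<le> (2 * exp lo + 2 * exp (- hi)) * exp (- x)" by (intro mult_right_mono) auto
    finally show ?thesis using F by simp
  qed
qed simp

lemma openin_Dset: "openin (top_of_set S2) (Dset b 0)"
proof (cases b)
  case True
  have "Dset b 0 = S2 - stereo ` cball 0 (exp hi)"
  proof (intro set_eqI iffI)
    fix P assume "P \<in> S2 - stereo ` cball 0 (exp hi)"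
    then have PS: "P \<in> S2" and nP: "P \<notin> stereo ` cball 0 (exp hi)" by auto
    show "P \<in> Dset b 0"
    proof (cases rule: S2_cases[OF PS])
      case (2 z)
      then show ?thesis using nP True by (cases "cmod z > exp hi") (auto simp: Dset_def)
    qed (use True in \<open>simp add: Dset_def\<close>)
  qed (use True north_in_S2 stereo_in_S2 stereo_neq_north in \<open>auto simp: Dset_def stereo_inject\<close>)
  moreover have "closed (stereo ` cball 0 (exp hi))"
    by (intro compact_imp_closed compact_continuous_image continuous_on_stereo compact_cball)
  ultimately show ?thesis by (simp add: openin_diff closed_subset stereo_in_S2 image_subset_iff)
next
  case False
  have "Dset b 0 = (S2 - {north}) \<inter> unstereo -` ball 0 (exp lo)"
  proof (intro set_eqI iffI)
    fix P assume "P \<in> (S2 - {north}) \<inter> unstereo -` ball 0 (exp lo)"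
    then have "P = stereo (unstereo P)" "cmod (unstereo P) < exp lo" using stereo_unstereo by auto
    then show "P \<in> Dset b 0" using False by (auto simp: Dset_def)
  qed (use False stereo_in_S2 stereo_neq_north[symmetric] in \<open>auto simp: Dset_def\<close>)
  moreover have "openin (top_of_set (S2 - {north})) ((S2 - {north}) \<inter> unstereo -` ball 0 (exp lo))"
    by (rule continuous_openin_preimage_gen[OF continuous_on_unstereo]) simp
  moreover have "openin (top_of_set S2) (S2 - {north})" by (intro openin_delete) simp
  ultimately show ?thesis using openin_trans by metis
qed

lemma escaping_fatou:
  assumes P: "P \<in> S2" and N: "(F ^^ N) P \<in> Dset b 0"
  shows "P \<in> fatou F"
proof -
  have "openin (top_of_set S2) (S2 \<inter> (F ^^ N) -` Dset b 0)"
    by (rule continuous_openin_preimage[OF continuous_on_funpow_sphere_ext _ openin_Dset]) (use funpow_sphere_ext_in_S2 in auto)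
  then obtain U where U: "open U" "S2 \<inter> (F ^^ N) -` Dset b 0 = S2 \<inter> U" by (auto simp: openin_open)
  show ?thesis
  proof (rule fatouI[OF P _ U(1), where N = N and p = "\<lambda>k. if (nxt ^^ (k - N)) b then north else stereo 0"
        and b = "\<lambda>k. (2 * exp lo + 2 * exp (- hi)) * exp (- (real (k - N) / 2))"])
    show "P \<in> U" using P N U(2) by blast
    show "(if (nxt ^^ (k - N)) b then north else stereo 0) \<in> S2" for k using north_in_S2 stereo_in_S2 by simp
    show "dist ((F ^^ k) Q) (if (nxt ^^ (k - N)) b then north else stereo 0) \<le>
        (2 * exp lo + 2 * exp (- hi)) * exp (- (real (k - N) / 2))" if "Q \<in> U \<inter> S2" "k \<ge> N" for Q k
    proof -
      have "(F ^^ N) Q \<in> Dset b 0" using that U(2) by blast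
      from F_funpow_Dset[OF this, of "k - N"] have "(F ^^ k) Q \<in> Dset ((nxt ^^ (k - N)) b) (real (k - N) / 2)"
        using that(2) by (metis funpow_add le_add_diff_inverse2 o_apply)
      then show ?thesis by (rule Dset_dist)
    qed
    have "(\<lambda>k. exp (- (real (k - N) / 2))) \<longlonglongrightarrow> 0" by real_asymp
    then show "(\<lambda>k. (2 * exp lo + 2 * exp (- hi)) * exp (- (real (k - N) / 2))) \<longlonglongrightarrow> 0"
      by (rule tendsto_mult_right_zero)
  qed
qed

lemma julia_eq:
  assumes code: "cantor_code n psi idx T"
  shows "julia F = stereo ` (\<lambda>p. circle_ifs.theta idx T e G lo (fst p) (snd p)) ` (cantor_set \<times> UNIV)"
proof -
  interpret circle_dyn n psi idx T e G lo hi "3/4" "(\<Sum>j = 1..n. cmod (C j)) + 1" f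
    by (rule circle_dyn_f[OF code])
  have "stereo ` Lam \<subseteq> julia F"
  proof (rule stereo_Lam_subset_julia[OF sphere_ext_in_S2 continuous_on_sphere_ext])
    fix z assume "z \<in> Lam"
    \<comment> \<open>\<open>f\<close> takes the value \<open>0\<close> at poles, and
      \<open>Lam\<close> is invariant and omits \<open>0\<close>; so it contains no pole.\<close>
    then have "f z \<in> Lam" using f_theta T_in by (force simp: Lam_def)
    then have "z \<notin> Poles" using f_Poles_eq_0 Lam_nonzero by metis
    then show "F (stereo z) = stereo (f z)" by (rule sphere_ext_regular)
  qed
  moreover have "julia F \<subseteq> stereo ` Lam"
  proof
    fix P assume P: "P \<in> julia F"
    then have PS: "P \<in> S2" by (simp add: julia_def)
    have nD: "(F ^^ k) P \<notin> Dset b 0" for k b using escaping_fatou[OF PS] P by (auto simp: julia_def)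
    have "\<exists>z. (F ^^ k) P = stereo z \<and> exp lo \<le> cmod z \<and> cmod z \<le> exp hi" for k
    proof (cases rule: S2_cases[OF funpow_sphere_ext_in_S2[OF PS, of k]])
      case 1
      then show ?thesis using nD[of k True] by (simp add: Dset_def)
    next
      case (2 z)
      then show ?thesis using nD[of k True] nD[of k False] by (intro exI[of _ z]) (auto simp: Dset_def not_less[symmetric])
    qed
    then have "\<forall>k. \<exists>z. (F ^^ k) P = stereo z \<and> exp lo \<le> cmod z \<and> cmod z \<le> exp hi" by blast
    then obtain z where z: "\<And>k. (F ^^ k) P = stereo (z k)" "\<And>k. exp lo \<le> cmod (z k)" "\<And>k. cmod (z k) \<le> exp hi"
      unfolding choice_iff by blast
    have step: "z (Suc k) = f (z k)" for k
    proof -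
      have F: "stereo (z (Suc k)) = F (stereo (z k))" using z(1)[of k] z(1)[of "Suc k"] by simp
      \<comment> \<open>A pole is sent to \<open>north\<close>, which is not of the form
        \<open>stereo w\<close>. Hence the orbit on the sphere is the orbit under \<open>f\<close>
        in the plane.\<close>
      then have "z k \<notin> Poles" using sphere_ext_X stereo_neq_north by metis
      then show ?thesis using sphere_ext_regular F by (simp add: stereo_inject)
    qed
    have it: "(f ^^ k) (z 0) = z k" for k by (induction k) (simp_all add: step)
    have "z 0 \<in> Lam"
    proof (rule survivor_in_Lam)
      fix k
      have nz: "z k \<noteq> 0" using z(2)[of k] by (metis exp_gt_zero norm_zero not_le)
      have "Re (Ln (z k)) \<in> {lo..hi}"
        using nz z(2,3)[of k] by (auto simp: ln_ge_iff) (metis exp_gt_zero ln_exp ln_le_cancel_iff zero_less_norm_iff)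
      then show "\<exists>w. Re w \<in> {lo..hi} \<and> (f ^^ k) (z 0) = exp w"
        using nz it by (intro exI[of _ "Ln (z k)"]) simp
    qed
    then show "P \<in> stereo ` Lam" using z(1)[of 0] by auto
  qed
  ultimately show ?thesis unfolding Lam_def by blast
qed

end

section \<open>Values of the model when the moduli follow a geometric rule\<close>

context ring_map
begin

lemma V_n: "V n = \<sigma> n * (d n * hi)"
  by (simp add: V_def h_def c_def e_def)

lemma V_0: "V 0 = V 1 - \<sigma> 1 * (d 1 * (rho 1 - lo))"
  using V_diff[of 0] n_ge by (simp add: e_def rho_def)

lemma V_last: "V (n - 1) = \<sigma> n * (d n * rho (n - 1))"
proof -
  have "Suc (n - 1) = n" "n - 1 \<noteq> n" using n_ge by auto
  then show ?thesis by (simp add: V_def h_def c_def e_def)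
qed

text \<open>A step of \<open>M / d (Suc i)\<close> in the radius changes the model by
  \<open>M\<close> up to sign, whatever \<open>d (Suc i)\<close> is, and the sign alternates with
  \<open>\<sigma>\<close>. So the model takes only two values at the inner radii.\<close>

lemma geometric_moduli:
  fixes M :: real
  assumes r: "\<And>i. i \<in> {1..n-2} \<Longrightarrow> rho i = rho (Suc i) + M / d (Suc i)" and i: "1 \<le> i" "i \<le> n - 1"
  shows "rho i = rho (n - 1) + M * (\<Sum>k = Suc i..n-1. 1 / d k)"
    "V i = (if \<sigma> (Suc i) = \<sigma> n then V (n - 1) else V (n - 1) - \<sigma> n * M)"
proof -
  have "rho i = rho (n - 1) + M * (\<Sum>k = Suc i..n-1. 1 / d k) \<and>
    V i = (if \<sigma> (Suc i) = \<sigma> n then V (n - 1) else V (n - 1) - \<sigma> n * M)"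
    using i(2,1)
  proof (induction i rule: inc_induct)
    case base
    then show ?case using n_ge by simp
  next
    case (step i)
    have ri: "rho i = rho (Suc i) + M / d (Suc i)" using step by (intro r) auto
    have "Suc i \<le> n" using step by linarith
    then have d: "d (Suc i) > 0" using d_ge[of "Suc i"] by simp
    have "V (Suc i) - V i = - (\<sigma> (Suc i) * M)"
      using V_diff[of i] step d unfolding ri by (simp add: e_def)
    then have Vi: "V i = V (Suc i) + \<sigma> (Suc i) * M" by simp
    have "(\<Sum>k = Suc i..n-1. 1 / real (d k)) = 1 / d (Suc i) + (\<Sum>k = Suc (Suc i)..n-1. 1 / d k)"
      using step by (intro sum.atLeast_Suc_atMost) auto
    then have "rho i = rho (n - 1) + M * (\<Sum>k = Suc i..n-1. 1 / d k)"
      using ri step by (simp add: algebra_simps)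
    moreover have "V i = (if \<sigma> (Suc i) = \<sigma> n then V (n - 1) else V (n - 1) - \<sigma> n * M)"
      using Vi step.IH step.prems \<sigma>_Suc[of "Suc i"] \<sigma>_pm[of "Suc i"] \<sigma>_pm[of n] by auto
    ultimately show ?case by blast
  qed
  then show "rho i = rho (n - 1) + M * (\<Sum>k = Suc i..n-1. 1 / d k)"
    "V i = (if \<sigma> (Suc i) = \<sigma> n then V (n - 1) else V (n - 1) - \<sigma> n * M)" by blast+
qed

end

subsection \<open>Choice of the parameters\<close>

text \<open>The exponent \<open>(-1) ^ (n - i - p)\<close> at \<open>j = Suc i\<close>, with sums of
  the same parity in place of differences, so that the signs alternate at all indices without
  truncation.\<close>

definition sig :: "nat \<Rightarrow> nat \<Rightarrow> nat \<Rightarrow> int" where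
  "sig p n j = (-1) ^ (n + j + p + 1)"

lemma minus_one_power_cong: "even x = even y \<Longrightarrow> (-1 :: int) ^ x = (-1) ^ y"
  by (cases "even x") auto

lemma (in ring_map) fmap_eq:
  assumes "p \<in> {0, 1}" "\<sigma> = sig p n"
  shows "fmap p n d a = f"
proof
  fix z
  have 1: "(-1 :: int) ^ (n - p) * int (d 1) = e 1"
  proof -
    \<comment> \<open>The subtractions are exact because \<open>p \<le> 1\<close>, here and, as
      \<open>i < n\<close>, for the other exponents.\<close>
    have "(-1 :: int) ^ (n - p) = (-1) ^ (n + 1 + p + 1)"
      by (rule minus_one_power_cong) (use assms(1) n_ge in auto)
    then have "(-1 :: int) ^ (n - p) = \<sigma> 1" by (simp only: assms(2) sig_def)
    then show ?thesis by (simp add: e_def)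
  qed
  have 2: "(-1 :: int) ^ (n - i - p) = \<sigma> (Suc i)" if "i \<in> {1..<n}" for i
    unfolding assms(2) sig_def by (rule minus_one_power_cong) (use assms(1) that in auto)
  have 3: "{1..n-1} = {1..<n}" using n_ge by auto
  show "fmap p n d a z = f z"
    unfolding fmap_def f_def 1 3 using 2 by (simp add: m_def)
qed

text \<open>If \<open>K\<close> is the largest of the \<open>d i\<close>, then \<open>n / K\<close>
  is at most the sum of the reciprocals, so \<open>n < K\<close>. This is the source of
  \<open>K \<ge> 4\<close>, on which the constants for \<open>p = 1\<close> rest.\<close>

lemma harmonic_bounds:
  fixes d :: "nat \<Rightarrow> nat" and n :: nat
  assumes n: "n \<ge> 3" and d: "\<forall>i \<in> {1..n}. d i > 0" and \<xi>: "(\<Sum>i = 1..n. 1 / real (d i)) < 1"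
  shows "i \<in> {1..n} \<Longrightarrow> d i \<ge> 2" "i \<in> {1..n} \<Longrightarrow> d i \<le> Max (d ` {1..n})" "Max (d ` {1..n}) \<ge> 4"
    "(\<Sum>k = 2..n-1. 1 / real (d k)) = (\<Sum>i = 1..n. 1 / real (d i)) - 1 / d 1 - 1 / d n"
proof -
  show le: "d i \<le> Max (d ` {1..n})" if "i \<in> {1..n}" for i using that by (intro Max_ge) auto
  have "real n * (1 / Max (d ` {1..n})) = (\<Sum>i = 1..n. 1 / real (Max (d ` {1..n})))" by simp
  also have "\<dots> \<le> (\<Sum>i = 1..n. 1 / real (d i))"
    using d le by (intro sum_mono divide_left_mono) (auto intro!: mult_pos_pos simp: Max_gr_iff)
  finally have "real n * (1 / Max (d ` {1..n})) < 1" using \<xi> by simp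
  moreover have "Max (d ` {1..n}) > 0" using less_le_trans[OF d[rule_format, of 1] le[of 1]] n by simp
  ultimately have "n < Max (d ` {1..n})" by (simp add: field_simps)
  then show "Max (d ` {1..n}) \<ge> 4" using n by simp
  show "d i \<ge> 2" if i: "i \<in> {1..n}" for i
  proof (rule ccontr)
    assume "\<not> d i \<ge> 2"
    then have "d i = 1" using d i by force
    moreover have "1 / real (d i) \<le> (\<Sum>i = 1..n. 1 / real (d i))" by (rule member_le_sum[OF i]) auto
    ultimately show False using \<xi> by simp
  qed
  have "(\<Sum>i = 1..n. 1 / real (d i)) = 1 / d 1 + (\<Sum>i = 2..n. 1 / real (d i))"
    using n by (subst sum.atLeast_Suc_atMost) (auto simp: numeral_2_eq_2)
  also have "(\<Sum>i = 2..n. 1 / real (d i)) = (\<Sum>k = 2..n-1. 1 / real (d k)) + 1 / d n"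
    using n by (cases n) auto
  finally show "(\<Sum>k = 2..n-1. 1 / real (d k)) = (\<Sum>i = 1..n. 1 / real (d i)) - 1 / d 1 - 1 / d n" by simp
qed

lemma ring_map_sig:
  assumes n: "n \<ge> 3" and d: "\<forall>i \<in> {1..n}. d i > 0" and \<xi>: "(\<Sum>i = 1..n. 1 / real (d i)) < 1"
    and a: "\<And>i. i \<in> {1..<n} \<Longrightarrow> a i \<noteq> (0 :: complex)"
  shows "ring_map n d (sig p n) a (Max (d ` {1..n}))"
proof
  show "sig p n 0 \<in> {1, -1}" using minus_one_power_cong[of "n + p + 1" 0] minus_one_power_cong[of "n + p + 1" 1]
    by (cases "even (n + p + 1)") (auto simp: sig_def)
qed (use harmonic_bounds[OF n d \<xi>] n a in \<open>auto simp: sig_def\<close>)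

lemma small_from_s:
  assumes "0 < s" "s \<le> 1 / (100 * (real n * real K))" "n > 0" "K > 0" "- ln s \<le> w"
  shows "real n * real K * exp (- w) \<le> 1/100"
proof -
  have "exp (- w) \<le> exp (ln s)" using assms(5) by simp
  then have "exp (- w) \<le> s" using assms(1) by simp
  then have "real n * real K * exp (- w) \<le> real n * real K * (1 / (100 * (real n * real K)))"
    using assms(2) by (intro mult_left_mono) auto
  then show ?thesis using assms(3,4) by simp
qed

lemma moduli_nonzero:
  fixes a :: "nat \<Rightarrow> complex"
  assumes n: "n \<ge> 2" and last: "cmod (a (n - 1)) = A" "A > 0" and step: "\<And>i. i \<in> {1..n-2} \<Longrightarrow> cmod (a i) = B i * cmod (a (Suc i))"
    and B: "\<And>i. B i > (0::real)" and i: "i \<in> {1..<n}"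
  shows "a i \<noteq> 0"
proof -
  have "1 \<le> i" "i \<le> n - 1" using i by auto
  from this(2,1) have "cmod (a i) > 0"
  proof (induction i rule: inc_induct)
    case (step i)
    then show ?case using assms(4)[of i] B[of i] by simp
  qed (use last in simp)
  then show ?thesis by auto
qed

lemma ln_powr_mult: "x > 0 \<Longrightarrow> c > 0 \<Longrightarrow> ln (x powr y * c) = y * ln x + ln (c :: real)"
  by (simp add: ln_mult ln_powr)

text \<open>At the inner radii the model takes the values \<open>ln s - 2 * \<kappa>\<close> and
  \<open>3 * \<kappa>\<close>, where \<open>\<kappa> = ln K \<ge> 2 * ln 2\<close>. The exponent 2
  in the moduli puts the first one below \<open>lo - ln 32\<close>, and the difference of the
  exponents 5 and 2 puts the second one above \<open>hi + ln 32 = 6 * ln 2\<close>. The choice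
  \<open>hi = ln 2\<close> makes the power \<open>d n\<close> gain the margin \<open>ln 2\<close>,
  and \<open>lo\<close> is such that the annulus has width \<open>- ln s\<close>.\<close>

lemma parameters_p1:
  fixes d :: "nat \<Rightarrow> nat" and a :: "nat \<Rightarrow> complex" and K n :: nat
  defines "K \<equiv> Max (d ` {1..n})" and "\<xi> \<equiv> \<Sum>i = 1..n. 1 / real (d i)"
  assumes n: "n \<ge> 3" and d: "\<forall>i \<in> {1..n}. d i > 0" and \<xi>: "\<xi> < 1"
    and s: "0 < s" "s \<le> 1 / (100 * (real n * real K))" and ls: "- ln s * (1 - \<xi>) \<ge> 10 * ln (real K) + 1"
    and last: "cmod (a (n - 1)) = (s / real K ^ 2) powr (1 / real (d n))"
    and step: "\<And>i. i \<in> {1..n-2} \<Longrightarrow> cmod (a i) = (s / real K ^ 5) powr (1 / real (d (Suc i))) * cmod (a (Suc i))"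
  shows "ring_map_bounds n d (sig 1 n) a (ln s + ln 2) (ln 2) K"
proof -
  note hb = harmonic_bounds[OF n d \<xi>[unfolded \<xi>_def], folded K_def \<xi>_def]
  have K0: "real K \<ge> 4" using hb(3) by simp
  define \<kappa> where "\<kappa> = ln (real K)"
  define \<l> where "\<l> = ln s"
  have l2: "ln 2 \<ge> (2/3::real)" "ln 2 \<le> (1::real)" using ln2_ge_two_thirds ln_2_less_1 by auto
  have "ln 4 \<le> \<kappa>" unfolding \<kappa>_def using K0 by (subst ln_le_cancel_iff) auto
  moreover have "ln 4 = 2 * ln (2::real)" using ln_realpow[of "2::real" 2] by simp
  ultimately have \<kappa>: "\<kappa> \<ge> 2 * ln 2" by simp
  have lL: "ln (s / real K ^ 2) = \<l> - 2 * \<kappa>" and lM: "ln (s / real K ^ 5) = \<l> - 5 * \<kappa>"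
    using s(1) K0 by (simp_all add: ln_div ln_realpow \<l>_def \<kappa>_def)
  have pos: "s / real K ^ 2 > 0" "s / real K ^ 5 > 0" using s(1) K0 by simp_all
  have a_nz: "a i \<noteq> 0" if "i \<in> {1..<n}" for i
    by (rule moduli_nonzero[OF _ last _ step _ that]) (use n pos K0 in auto)
  interpret R: ring_map n d "sig 1 n" a "ln s + ln 2" "ln 2" K
    unfolding K_def by (rule ring_map_sig[OF n d \<xi>[unfolded \<xi>_def] a_nz])
  have sn: "sig 1 n n = 1" by (simp add: sig_def)
  have rl: "R.rho (n - 1) = (\<l> - 2 * \<kappa>) / d n"
  proof -
    have "n - 1 \<noteq> n" "n - 1 \<noteq> 0" using n by auto
    then show ?thesis using last pos(1) lL by (simp add: R.rho_def ln_powr)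
  qed
  have rs: "R.rho i = R.rho (Suc i) + (\<l> - 5 * \<kappa>) / d (Suc i)" if i: "i \<in> {1..n-2}" for i
  proof -
    have "Suc i \<in> {1..<n}" using i n by (simp, linarith)
    then have nz: "cmod (a (Suc i)) > 0" using a_nz by simp
    have "R.rho i = ln (cmod (a i))" "R.rho (Suc i) = ln (cmod (a (Suc i)))"
      using \<open>Suc i \<in> {1..<n}\<close> i by (auto simp: R.rho_def)
    then show ?thesis unfolding step[OF i] ln_powr_mult[OF pos(2) nz] lM by simp
  qed
  have dn: "real (d n) \<ge> 2" "real (d 1) \<ge> 2" using hb(1)[of n] hb(1)[of 1] n by auto
  have VL: "R.V (n - 1) = \<l> - 2 * \<kappa>" unfolding R.V_last rl sn using dn by simp
  have Vm: "R.V i = (if sig 1 n (Suc i) = 1 then \<l> - 2 * \<kappa> else 3 * \<kappa>)" if "i \<in> {1..<n}" for i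
    using R.geometric_moduli(2)[OF rs, of i] that unfolding sn VL by auto
  have r1: "R.rho 1 = (\<l> - 2 * \<kappa>) / d n + (\<l> - 5 * \<kappa>) * (\<xi> - 1 / d 1 - 1 / d n)"
    using R.geometric_moduli(1)[OF rs, of 1] n hb(4) unfolding rl by (simp add: numeral_2_eq_2)
  \<comment> \<open>The innermost ring gets what the others leave. The surplus
    \<open>- ln s * (1 - \<xi>)\<close> has to pay \<open>2 * \<kappa>\<close> and
    \<open>5 * \<kappa>\<close> for the divisors in the moduli, \<open>3 * \<kappa>\<close> for the
    value to be reached and \<open>ln 2\<close> for the position of \<open>lo\<close>: hence the
    bound \<open>10 * ln K + 1\<close>.\<close>
  have Q: "d 1 * (R.rho 1 - (\<l> + ln 2)) \<ge> 3 * \<kappa> - \<l>"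
  proof -
    define b1 bn where "b1 = 1 / real (d 1)" and "bn = 1 / real (d n)"
    have b: "0 \<le> b1" "0 \<le> bn" "\<xi> - b1 - bn \<ge> 0" "d 1 * b1 = 1"
      using dn sum_nonneg[of "{2..n-1}" "\<lambda>k. 1 / real (d k)"] unfolding hb(4) b1_def bn_def by auto
    have "bn \<le> 1" using dn by (simp add: bn_def)
    then have "2 * \<kappa> * bn \<le> 2 * \<kappa> * 1" using \<kappa> l2 by (intro mult_left_mono) auto
    moreover have "5 * \<kappa> * (\<xi> - b1 - bn) \<le> 5 * \<kappa> * 1" using \<kappa> l2 b \<xi> by (intro mult_left_mono) auto
    ultimately have "- \<l> * (1 - \<xi>) - 2 * \<kappa> * bn - 5 * \<kappa> * (\<xi> - b1 - bn) - ln 2 \<ge> 3 * \<kappa>"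
      using ls l2 unfolding \<l>_def[symmetric] \<kappa>_def[symmetric] by linarith
    then have "d 1 * (- \<l> * (1 - \<xi>) - 2 * \<kappa> * bn - 5 * \<kappa> * (\<xi> - b1 - bn) - ln 2) \<ge> 1 * (3 * \<kappa>)"
      using dn \<kappa> l2 by (intro mult_mono) auto
    moreover have "d 1 * (R.rho 1 - (\<l> + ln 2)) = d 1 * (- \<l> * (1 - \<xi>) - 2 * \<kappa> * bn - 5 * \<kappa> * (\<xi> - b1 - bn) - ln 2) - \<l> * (d 1 * b1)"
    proof -
      have "R.rho 1 = (\<l> - 2 * \<kappa>) * bn + (\<l> - 5 * \<kappa>) * (\<xi> - b1 - bn)" unfolding r1 b1_def bn_def by simp
      then show ?thesis by (simp only:) (simp add: algebra_simps)
    qed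
    ultimately show ?thesis unfolding b(4) by simp
  qed
  have sig_pm: "sig 1 n i = 1 \<or> sig 1 n i = -1" for i by (rule R.\<sigma>_pm)
  have l0: "\<l> < 0"
  proof -
    have "- \<l> * (1 - \<xi>) > 0" using ls \<kappa> l2 unfolding \<l>_def[symmetric] \<kappa>_def[symmetric] by linarith
    then show ?thesis using \<xi> by (simp add: zero_less_mult_iff mult_less_0_iff)
  qed
  have l32: "ln 32 = 5 * ln (2::real)" using ln_realpow[of "2::real" 5] by simp
  have V0: "R.V 0 = R.V 1 - sig 1 n 1 * (d 1 * (R.rho 1 - (\<l> + ln 2)))" using R.V_0 by (simp add: \<l>_def)
  have V1: "R.V 1 = (if sig 1 n 1 = 1 then 3 * \<kappa> else \<l> - 2 * \<kappa>)"
    using Vm[of 1] n R.\<sigma>_Suc[of 1] sig_pm[of 1] by auto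
  have Vn: "R.V n \<ge> 2 * ln 2" using R.V_n dn l2 unfolding sn by (simp add: mult_right_mono)
  show ?thesis
  proof
    show "ln s + ln 2 < ln 2" using l0 by (simp add: \<l>_def)
    show "real n * real K * exp (- (ln 2 - (ln s + ln 2))) \<le> 1/100"
      by (rule small_from_s[OF s]) (use n K0 in auto)
    fix i assume i: "i \<le> n"
    consider "i = 0" | "i = n" | "i \<in> {1..<n}" using i by force
    note cs = this
    show "R.V i \<ge> ln 2 + R.marg i" if sg: "sig 1 n (Suc i) = -1"
      using cs
    proof cases
      case 1
      then show ?thesis using sg V0 V1 Q l2 \<kappa> by (simp add: R.marg_def)
    next
      case 2
      then show ?thesis using Vn by (simp add: R.marg_def)
    next
      case 3
      then show ?thesis using Vm[OF 3] sg \<kappa> l32 l2 by (simp add: R.marg_def)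
    qed
    show "R.V i \<le> ln s + ln 2 - R.marg i" if sg: "sig 1 n (Suc i) = 1"
      using cs
    proof cases
      case 1
      then show ?thesis using sg V0 V1 Q l2 \<kappa> by (simp add: R.marg_def \<l>_def)
    next
      case 2
      then show ?thesis using sg sn R.\<sigma>_Suc[of n] by simp
    next
      case 3
      then show ?thesis using Vm[OF 3] sg \<kappa> l32 l2 by (simp add: R.marg_def \<l>_def)
    qed
  qed
qed

text \<open>Here infinity is sent to \<open>0\<close>, so both ends of the annulus must scale with
  \<open>ln s\<close>. They are placed such that the two values of the model at the inner radii miss
  the annulus by exactly \<open>- ln s * \<alpha> / 2\<close>; the lower bound 10 makes this at
  least 5, which covers \<open>ln 32\<close>.\<close>

lemma parameters_p0:
  fixes d :: "nat \<Rightarrow> nat" and a :: "nat \<Rightarrow> complex" and K n :: nat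
  defines "K \<equiv> Max (d ` {1..n})" and "\<xi> \<equiv> \<Sum>i = 1..n. 1 / real (d i)"
  defines "\<alpha> \<equiv> (1 - \<xi>) / 3"
  assumes n: "n \<ge> 3" and d: "\<forall>i \<in> {1..n}. d i > 0" and \<xi>: "\<xi> < 1"
    and s: "0 < s" "s \<le> 1 / (100 * (real n * real K))" and ls: "- ln s * \<alpha> \<ge> 10"
    and last: "cmod (a (n - 1)) = (s powr (1 / real (d n) + \<alpha>)) powr (1 / real (d n))"
    and step: "\<And>i. i \<in> {1..n-2} \<Longrightarrow> cmod (a i) = (s powr (1 + 1 / real (d n) + 2 * \<alpha>)) powr (1 / real (d (Suc i))) * cmod (a (Suc i))"
  shows "ring_map_bounds n d (sig 0 n) a ((1 + \<alpha> / 2) * ln s) (- (1 / d n + \<alpha> / 2) * ln s) K"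
proof -
  note hb = harmonic_bounds[OF n d \<xi>[unfolded \<xi>_def], folded K_def \<xi>_def]
  have K0: "real K \<ge> 4" using hb(3) by simp
  define \<l> where "\<l> = ln s"
  have \<alpha>: "\<alpha> > 0" using \<xi> by (simp add: \<alpha>_def)
  have l2: "ln 2 \<ge> (2/3::real)" "ln 2 \<le> (1::real)" using ln2_ge_two_thirds ln_2_less_1 by auto
  define b1 bn where "b1 = 1 / real (d 1)" and "bn = 1 / real (d n)"
  have dn: "real (d n) \<ge> 2" "real (d 1) \<ge> 2" using hb(1)[of n] hb(1)[of 1] n by auto
  have b: "0 \<le> b1" "0 \<le> bn" "d 1 * b1 = 1" "d n * bn = 1" using dn unfolding b1_def bn_def by auto
  have a_nz: "a i \<noteq> 0" if "i \<in> {1..<n}" for i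
    by (rule moduli_nonzero[OF _ last _ step _ that]) (use n s in auto)
  define lo hi where "lo = (1 + \<alpha> / 2) * ln s" and "hi = - (1 / d n + \<alpha> / 2) * ln s"
  interpret R: ring_map n d "sig 0 n" a lo hi K
    unfolding K_def by (rule ring_map_sig[OF n d \<xi>[unfolded \<xi>_def] a_nz])
  have lo: "lo = (1 + \<alpha> / 2) * \<l>" and hi: "hi = - (bn + \<alpha> / 2) * \<l>" by (simp_all add: lo_def hi_def \<l>_def bn_def)
  have sn: "sig 0 n n = -1" by (simp add: sig_def)
  define M where "M = (1 + bn + 2 * \<alpha>) * \<l>"
  have rl: "R.rho (n - 1) = (bn + \<alpha>) * \<l> * bn"
  proof -
    have "n - 1 \<noteq> n" "n - 1 \<noteq> 0" using n by auto
    then show ?thesis using last s(1) by (simp add: R.rho_def ln_powr bn_def \<l>_def)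
  qed
  have rs: "R.rho i = R.rho (Suc i) + M / d (Suc i)" if i: "i \<in> {1..n-2}" for i
  proof -
    have "Suc i \<in> {1..<n}" using i n by (simp, linarith)
    then have nz: "cmod (a (Suc i)) > 0" using a_nz by simp
    have pos: "s powr (1 + 1 / real (d n) + 2 * \<alpha>) > 0" using s(1) by simp
    have "R.rho i = ln (cmod (a i))" "R.rho (Suc i) = ln (cmod (a (Suc i)))"
      using \<open>Suc i \<in> {1..<n}\<close> i by (auto simp: R.rho_def)
    then show ?thesis unfolding step[OF i] ln_powr_mult[OF pos nz]
      using s(1) by (simp add: ln_powr M_def bn_def \<l>_def)
  qed
  have VL: "R.V (n - 1) = - (bn + \<alpha>) * \<l>"
  proof -
    have "R.V (n - 1) = - ((bn + \<alpha>) * \<l> * (d n * bn))" unfolding R.V_last rl sn by simp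
    then show ?thesis unfolding b minus_mult_left by simp
  qed
  have Vm: "R.V i = (if sig 0 n (Suc i) = -1 then - (bn + \<alpha>) * \<l> else (1 + \<alpha>) * \<l>)" if "i \<in> {1..<n}" for i
    using R.geometric_moduli(2)[OF rs, of i] that unfolding sn VL M_def by (auto simp: algebra_simps)
  have r1: "R.rho 1 = (bn + \<alpha>) * \<l> * bn + M * (\<xi> - b1 - bn)"
    using R.geometric_moduli(1)[OF rs, of 1] n hb(4) unfolding rl by (simp add: numeral_2_eq_2 b1_def bn_def)
  have x3: "\<xi> = 1 - 3 * \<alpha>" by (simp add: \<alpha>_def field_simps)
  have ls': "- \<l> * \<alpha> \<ge> 10" using ls by (simp add: \<l>_def)
  have l0: "\<l> < 0" using ls' \<alpha> by (smt (verit) mult_nonneg_nonneg mult_minus_left)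
  have Q: "d 1 * (R.rho 1 - lo) \<ge> - (1 + bn + 3 * \<alpha> / 2) * \<l> + ln 2"
  proof -
    \<comment> \<open>Multiplied by \<open>d 1\<close>, the term with \<open>b1\<close> becomes the
      change of the model across the innermost ring. The first bracket is what the budget leaves
      once \<open>\<xi>\<close> is replaced by \<open>1 - 3 * \<alpha>\<close>, and it is
      positive.\<close>
    have eq: "R.rho 1 - lo = - \<l> * (3 * \<alpha> / 2 + 6 * \<alpha> * \<alpha> + 4 * \<alpha> * bn) - \<l> * (1 + bn + 2 * \<alpha>) * b1"
      unfolding r1 unfolding lo M_def x3 by (simp add: algebra_simps)
    have "d 1 * (R.rho 1 - lo) = d 1 * (- \<l> * (3 * \<alpha> / 2 + 6 * \<alpha> * \<alpha> + 4 * \<alpha> * bn)) - \<l> * (1 + bn + 2 * \<alpha>) * (d 1 * b1)"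
      unfolding eq by (simp add: algebra_simps)
    also have "\<dots> = d 1 * (- \<l> * (3 * \<alpha> / 2 + 6 * \<alpha> * \<alpha> + 4 * \<alpha> * bn)) - \<l> * (1 + bn + 2 * \<alpha>)"
      unfolding b by simp
    finally have E: "d 1 * (R.rho 1 - lo) = d 1 * (- \<l> * (3 * \<alpha> / 2 + 6 * \<alpha> * \<alpha> + 4 * \<alpha> * bn)) - \<l> * (1 + bn + 2 * \<alpha>)" .
    have "d 1 * (- \<l> * (3 * \<alpha> / 2 + 6 * \<alpha> * \<alpha> + 4 * \<alpha> * bn)) \<ge> 1 * (- \<l> * (3 * \<alpha> / 2))"
      using dn l0 \<alpha> b by (intro mult_mono) (auto intro!: mult_nonneg_nonneg mult_left_mono_neg simp: mult_nonpos_nonneg)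
    then have "d 1 * (R.rho 1 - lo) \<ge> - \<l> * (3 * \<alpha> / 2) - \<l> * (1 + bn + 2 * \<alpha>)" unfolding E by simp
    moreover have "- \<l> * (3 * \<alpha> / 2) - \<l> * (1 + bn + 2 * \<alpha>) = - (1 + bn + 3 * \<alpha> / 2) * \<l> + 2 * (- \<l> * \<alpha>)"
      by (simp add: algebra_simps)
    ultimately show ?thesis using ls' l2 by linarith
  qed
  have sig_pm: "sig 0 n i = 1 \<or> sig 0 n i = -1" for i by (rule R.\<sigma>_pm)
  have l32: "ln 32 = 5 * ln (2::real)" using ln_realpow[of "2::real" 5] by simp
  have V1: "R.V 1 = (if sig 0 n 1 = 1 then - (bn + \<alpha>) * \<l> else (1 + \<alpha>) * \<l>)"
    using Vm[of 1] n R.\<sigma>_Suc[of 1] sig_pm[of 1] by auto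
  \<comment> \<open>The summand \<open>1 / d n\<close> in \<open>hi\<close> is chosen for this: its
    \<open>d n\<close>-fold is 1, so the outer circle is sent to about \<open>ln s\<close>, and the
    \<open>\<alpha>\<close> part pushes it below \<open>lo\<close>.\<close>
  have Vn: "R.V n \<le> lo - ln 2"
  proof -
    have "R.V n = (d n * bn) * \<l> + (d n * \<alpha> / 2) * \<l>" unfolding R.V_n sn unfolding hi by (simp add: algebra_simps)
    also have "\<dots> \<le> \<l> + (2 * \<alpha> / 2) * \<l>"
      unfolding b using dn \<alpha> l0 by (intro add_mono mult_right_mono_neg) auto
    also have "\<dots> = lo - (- \<l> * \<alpha>) / 2" unfolding lo by (simp add: algebra_simps)
    finally show ?thesis using ls' l2 by linarith
  qed
  have width: "hi - lo = - \<l> * (1 + bn + \<alpha>)" unfolding hi lo by (simp add: algebra_simps)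
  have w1: "- \<l> * (1 + bn + \<alpha>) \<ge> - \<l> * 1" using l0 b \<alpha> by (intro mult_left_mono) auto
  have e1: "- (bn + \<alpha>) * \<l> = hi + (- \<l> * \<alpha>) / 2" "(1 + \<alpha>) * \<l> = lo - (- \<l> * \<alpha>) / 2"
    unfolding hi lo by (simp_all add: algebra_simps)
  have Q': "d 1 * (R.rho 1 - lo) \<ge> (hi + (- \<l> * \<alpha>) / 2) - lo + ln 2"
    using Q unfolding hi lo by (simp add: algebra_simps)
  have V0: "R.V 0 = (if sig 0 n 1 = 1 then hi + (- \<l> * \<alpha>) / 2 - d 1 * (R.rho 1 - lo)
      else lo - (- \<l> * \<alpha>) / 2 + d 1 * (R.rho 1 - lo))"
    unfolding R.V_0 V1 e1 using sig_pm[of 1] by auto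
  show ?thesis unfolding lo_def[symmetric] hi_def[symmetric]
  proof
    show "lo < hi" using width w1 l0 by linarith
    show "real n * real K * exp (- (hi - lo)) \<le> 1/100"
      by (rule small_from_s[OF s]) (use n K0 width w1 in \<open>auto simp: \<l>_def\<close>)
    fix i assume i: "i \<le> n"
    consider "i = 0" | "i = n" | "i \<in> {1..<n}" using i by force
    note cs = this
    show "R.V i \<ge> hi + R.marg i" if sg: "sig 0 n (Suc i) = -1"
      using cs
    proof cases
      case 1
      then have "R.V 0 = lo - (- \<l> * \<alpha>) / 2 + d 1 * (R.rho 1 - lo)" "R.marg i = ln 2"
        using sg V0 by (auto simp: R.marg_def)
      then show ?thesis using Q' unfolding 1 by linarith
    next
      case 2
      then show ?thesis using sg sn R.\<sigma>_Suc[of n] by simp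
    next
      case 3
      then have "R.V i = hi + (- \<l> * \<alpha>) / 2" "R.marg i = 5 * ln 2" using Vm[OF 3] sg l32 e1 by (auto simp: R.marg_def)
      then show ?thesis using ls' l2 by linarith
    qed
    show "R.V i \<le> lo - R.marg i" if sg: "sig 0 n (Suc i) = 1"
      using cs
    proof cases
      case 1
      then have "R.V 0 = hi + (- \<l> * \<alpha>) / 2 - d 1 * (R.rho 1 - lo)" "R.marg i = ln 2"
        using sg V0 by (auto simp: R.marg_def)
      then show ?thesis using Q' unfolding 1 by linarith
    next
      case 2
      then show ?thesis using Vn by (simp add: R.marg_def)
    next
      case 3
      then have "R.V i = lo - (- \<l> * \<alpha>) / 2" "R.marg i = 5 * ln 2" using Vm[OF 3] sg l32 e1 by (auto simp: R.marg_def)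
      then show ?thesis using ls' l2 by linarith
    qed
  qed
qed

section \<open>Itineraries and the topology of the Cantor set\<close>

lemma (in cantor_code) idx_funpow_cont: "continuous_on cantor_set (\<lambda>x. idx ((T ^^ j) x))"
  by (rule continuous_on_compose2[OF idx_cont continuous_on_funpow[OF T_cont T_in]]) (use T_funpow_in in auto)

text \<open>Finite words are realised by prepending symbols. A limit of such points has the infinite
  word, since each symbol depends continuously on the point and is therefore eventually constant
  along the sequence.\<close>

lemma (in cantor_code) infinite_code_exists:
  assumes w: "\<And>j. w j \<in> {1..n}"
  shows "\<exists>y \<in> cantor_set. \<forall>j. idx ((T ^^ j) y) = w j"
proof -
  have "\<forall>k. \<exists>y. y \<in> cantor_set \<and> (\<forall>j < k. idx ((T ^^ j) y) = w j)"
  proof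
    fix k
    show "\<exists>y. y \<in> cantor_set \<and> (\<forall>j < k. idx ((T ^^ j) y) = w j)"
      using code_exists[of 0 w k, OF cantor_set_zero w] by (elim exE conjE) (rule exI, rule conjI)
  qed
  then obtain y where y: "\<And>k. y k \<in> cantor_set" "\<And>k j. j < k \<Longrightarrow> idx ((T ^^ j) (y k)) = w j"
    unfolding choice_iff by blast
  obtain l r where lr: "l \<in> cantor_set" "strict_mono r" "(y \<circ> r) \<longlonglongrightarrow> l"
    using compact_cantor_set[unfolded compact_def, rule_format, of y] y(1) by blast
  have "idx ((T ^^ j) l) = w j" for j
  proof -
    have "continuous_on cantor_set (\<lambda>x. idx ((T ^^ j) x))"
      by (rule idx_funpow_cont)
    from continuous_on_tendsto_compose[OF this lr(3,1)] y(1)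
    have "(\<lambda>k. idx ((T ^^ j) (y (r k)))) \<longlonglongrightarrow> idx ((T ^^ j) l)" by (simp add: o_def)
    then have "\<forall>\<^sub>F k in sequentially. idx ((T ^^ j) (y (r k))) \<in> {idx ((T ^^ j) l)}"
      by (rule topological_tendstoD) (auto simp: open_discrete)
    moreover have "\<forall>\<^sub>F k in sequentially. k > j" by (rule eventually_gt_at_top)
    ultimately have "\<forall>\<^sub>F k in sequentially. idx ((T ^^ j) l) = w j"
    proof eventually_elim
      case (elim k)
      then show ?case using y(2)[of j "r k"] seq_suble[OF lr(2), of k] by simp
    qed
    then show ?thesis by simp
  qed
  then show ?thesis using lr(1) by blast
qed

text \<open>Cantor's diagonal argument with the symbols 1 and 2.\<close>

lemma (in cantor_code) uncountable_cantor_set: assumes "n \<ge> 2" shows "uncountable cantor_set"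
proof
  assume "countable cantor_set"
  then obtain c :: "nat \<Rightarrow> real" where c: "cantor_set = range c" using cantor_set_zero by (metis empty_iff uncountable_def)
  define w where "w j = (if idx ((T ^^ j) (c j)) = 1 then 2 else 1 :: nat)" for j
  have "w j \<in> {1..n}" for j using assms by (simp add: w_def)
  then obtain y where y: "y \<in> cantor_set" "\<And>j. idx ((T ^^ j) y) = w j" using infinite_code_exists by blast
  then obtain j where "y = c j" using c by blast
  then show False using y(2)[of j] by (simp add: w_def split: if_splits)
qed

lemma connected_nat_singleton:
  fixes S :: "nat set"
  assumes "connected S" "x \<in> S" "y \<in> S"
  shows "x = y"
proof (rule ccontr)
  assume "x \<noteq> y"
  moreover have "open {x}" "open (- {x})" by (auto simp: open_discrete)
  ultimately show False using connectedD[OF assms(1), of "{x}" "- {x}"] assms(2,3) by auto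
qed

text \<open>Every symbol of the itinerary is a continuous map into a discrete space, hence constant
  on a connected set, and the itinerary determines the point.\<close>

lemma (in cantor_code) connected_cantor_singleton:
  assumes S: "connected S" "S \<subseteq> cantor_set" and xy: "x \<in> S" "y \<in> S"
  shows "x = y"
proof -
  have "idx ((T ^^ j) x) = idx ((T ^^ j) y)" for j
  proof -
    have "continuous_on cantor_set (\<lambda>x. idx ((T ^^ j) x))"
      by (rule idx_funpow_cont)
    then have "connected ((\<lambda>x. idx ((T ^^ j) x)) ` S)"
      using S by (intro connected_continuous_image) (auto intro: continuous_on_subset)
    then show ?thesis using xy by (intro connected_nat_singleton) auto
  qed
  then have le: "\<bar>x - y\<bar> \<le> (1/3) ^ k" for k using dist_same_code[of x y k] S xy by blast
  have "(\<lambda>k. (1/3 :: real) ^ k) \<longlonglongrightarrow> 0" by (intro LIMSEQ_power_zero) auto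
  then have "\<bar>x - y\<bar> \<le> 0" by (rule tendsto_lowerbound) (use le in auto)
  then show ?thesis by simp
qed

subsection \<open>Plane continua around the origin\<close>

text \<open>\<open>Y\<close> meets \<open>W\<close> in a set that is open and closed in
  \<open>W\<close>. Applied to images \<open>Y\<close> of regions whose boundary is confined to a
  curve or to the Julia set.\<close>

lemma open_clopen_subset:
  assumes "connected W" "open Y" "closure Y \<inter> W \<subseteq> Y" "Y \<inter> W \<noteq> {}"
  shows "W \<subseteq> Y"
proof (rule ccontr)
  assume "\<not> W \<subseteq> Y"
  then show False
    using connectedD[OF assms(1,2) open_Compl[OF closed_closure[of Y]]] assms(3,4) closure_subset[of Y] by blast
qed

lemma connected_subset_outside:
  fixes A S :: "'a :: real_normed_vector set"
  assumes "connected S" "S \<inter> A = {}" "x \<in> S" "x \<in> outside A"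
  shows "S \<subseteq> outside A"
proof
  fix y assume y: "y \<in> S"
  have "connected_component (- A) x y" unfolding connected_component_def using assms y by blast
  then have "connected_component_set (- A) y = connected_component_set (- A) x" by (metis connected_component_eq mem_Collect_eq)
  then show "y \<in> outside A" using assms(4,2) y by (auto simp: outside_def)
qed

lemma connected_subset_inside:
  fixes A S :: "'a :: real_normed_vector set"
  assumes "connected S" "S \<inter> A = {}" "x \<in> S" "x \<in> inside A"
  shows "S \<subseteq> inside A"
proof
  fix y assume y: "y \<in> S"
  have "connected_component (- A) x y" unfolding connected_component_def using assms y by blast
  then have "connected_component_set (- A) y = connected_component_set (- A) x" by (metis connected_component_eq mem_Collect_eq)
  then show "y \<in> inside A" using assms(4,2) y by (auto simp: inside_def)
qed

lemma unbounded_connected_outside: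
  fixes A S :: "'a :: real_normed_vector set"
  assumes "connected S" "S \<inter> A = {}" "x \<in> S" "\<not> bounded S"
  shows "x \<in> outside A"
proof -
  have "S \<subseteq> connected_component_set (- A) x" by (rule connected_component_maximal) (use assms in auto)
  then show ?thesis using assms bounded_subset by (auto simp: outside_def)
qed

lemma ray_outside:
  fixes b :: complex
  assumes "b \<notin> A" "b \<noteq> 0" "\<And>a. a \<in> A \<Longrightarrow> cmod a \<le> cmod b"
  shows "b \<in> outside A"
proof (rule unbounded_connected_outside[where S = "(\<lambda>t. complex_of_real t * b) ` {1..}"])
  show "connected ((\<lambda>t. complex_of_real t * b) ` {1..})"
    by (intro connected_continuous_image continuous_intros) auto
  show "(\<lambda>t. complex_of_real t * b) ` {1..} \<inter> A = {}"
  proof -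
    have "complex_of_real t * b \<notin> A" if "t \<ge> 1" for t
    proof (cases "t = 1")
      case False
      then have "1 * cmod b < t * cmod b" using that assms(2) by (intro mult_strict_right_mono) auto
      then show ?thesis using assms(3)[of "complex_of_real t * b"] that by (auto simp: norm_mult)
    qed (use assms(1) in simp)
    then show ?thesis by auto
  qed
  show "b \<in> (\<lambda>t. complex_of_real t * b) ` {1..}" by (rule image_eqI[of _ _ 1]) auto
  show "\<not> bounded ((\<lambda>t. complex_of_real t * b) ` {1..})"
  proof
    assume "bounded ((\<lambda>t. complex_of_real t * b) ` {1..})"
    then obtain B where B: "\<And>t. t \<ge> 1 \<Longrightarrow> cmod (complex_of_real t * b) \<le> B" by (auto simp: bounded_iff)
    define t where "t = max 1 ((B + 1) / cmod b)"
    have "(B + 1) / cmod b * cmod b \<le> t * cmod b" by (intro mult_right_mono) (auto simp: t_def)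
    then have "B + 1 \<le> t * cmod b" using assms(2) by simp
    then show False using B[of t] by (simp add: norm_mult t_def)
  qed
qed

lemma max_modulus_point:
  fixes A :: "complex set"
  assumes "compact A" "A \<noteq> {}"
  obtains b where "b \<in> A" "\<And>a. a \<in> A \<Longrightarrow> cmod a \<le> cmod b"
  using continuous_attains_sup[OF assms continuous_on_norm[OF continuous_on_id]] by blast

lemma min_modulus_point:
  fixes A :: "complex set"
  assumes "compact A" "A \<noteq> {}"
  obtains b where "b \<in> A" "\<And>a. a \<in> A \<Longrightarrow> cmod b \<le> cmod a"
  using continuous_attains_inf[OF assms continuous_on_norm[OF continuous_on_id]] by blast

text \<open>Rotation preserves the modulus. The image of a point of largest modulus can be joined to
  infinity along a ray, the image of a point of smallest modulus to \<open>0\<close> along a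
  segment, both without meeting \<open>A\<close>. So the connected rotated set, which avoids
  \<open>A\<close>, would lie both outside and inside of it.\<close>

lemma rotation_of_surrounding_continuum:
  fixes A :: "complex set"
  assumes A: "compact A" "connected A" "0 \<in> inside A" and w: "cmod w = 1" and disj: "(\<lambda>z. w * z) ` A \<inter> A = {}"
  shows False
proof -
  let ?B = "(\<lambda>z. w * z) ` A"
  have ne: "A \<noteq> {}" "0 \<notin> A" using A(3) by (auto simp: inside_def)
  have B: "connected ?B" by (intro connected_continuous_image A continuous_intros)
  obtain b where b: "b \<in> A" "\<And>a. a \<in> A \<Longrightarrow> cmod a \<le> cmod b" using max_modulus_point A(1) ne(1) by blast
  have "w * b \<in> outside A"
    by (rule ray_outside) (use b w disj ne in \<open>auto simp: norm_mult\<close>)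
  then have out: "?B \<subseteq> outside A" using b(1) disj by (intro connected_subset_outside[OF B, of A "w * b"]) auto
  obtain c where c: "c \<in> A" "\<And>a. a \<in> A \<Longrightarrow> cmod c \<le> cmod a" using min_modulus_point A(1) ne(1) by blast
  have "closed_segment 0 (w * c) \<inter> A = {}"
  proof -
    have "z \<notin> A" if z: "z \<in> closed_segment 0 (w * c)" for z
    proof -
      obtain t where t: "0 \<le> t" "t \<le> 1" "z = complex_of_real t * (w * c)" using z by (auto simp: in_segment scaleR_conv_of_real)
      show ?thesis
      proof (cases "t = 1")
        case True
        then show ?thesis using t disj c(1) by auto
      next
        case False
        have "c \<noteq> 0" using c(1) ne by auto
        then have "t * cmod c < 1 * cmod c" using t False by (intro mult_strict_right_mono) auto
        then show ?thesis using c(2)[of z] t w by (auto simp: norm_mult)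
      qed
    qed
    then show ?thesis by blast
  qed
  then have "w * c \<in> inside A" using connected_subset_inside[of "closed_segment 0 (w * c)" A 0] A(3) by auto
  then show False using out c(1) inside_Int_outside[of A] by blast
qed

text \<open>The point \<open>b\<close> escapes along a ray, which puts all of \<open>B\<close>
  outside \<open>A\<close>. Then \<open>A\<close> together with its inside is a connected set that
  contains \<open>0\<close> and avoids \<open>B\<close>.\<close>

lemma surrounding_order:
  fixes A B :: "complex set"
  assumes A: "compact A" "connected A" "0 \<in> inside A" "connected (inside A)" "frontier (inside A) = A"
    and B: "compact B" "connected B" "0 \<in> inside B" and disj: "A \<inter> B = {}"
    and max: "b \<in> B" "\<And>a. a \<in> A \<Longrightarrow> cmod a \<le> cmod b"
  shows "B \<subseteq> outside A" "A \<subseteq> inside B"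
proof -
  have "0 \<notin> B" using B(3) by (auto simp: inside_def)
  then have "b \<in> outside A" using max disj by (intro ray_outside) auto
  then show out: "B \<subseteq> outside A" using disj max(1) by (intro connected_subset_outside[OF B(2), of A b]) auto
  have cl: "closure (inside A) = inside A \<union> A"
    using A(5) closure_Un_frontier[of "inside A"] by simp
  have "connected (inside A \<union> A)" using connected_imp_connected_closure[OF A(4)] cl by simp
  moreover have "(inside A \<union> A) \<inter> B = {}" using out inside_Int_outside[of A] disj by blast
  ultimately have "inside A \<union> A \<subseteq> inside B" using A(3) B(3) by (intro connected_subset_inside[of _ B 0]) auto
  then show "A \<subseteq> inside B" by blast
qed

text \<open>A continuum that does not separate \<open>0\<close> from infinity carries a continuous argument. A rotational symmetry
  would shift it by a constant, and finitely many iterations of the symmetry return to the start.\<close>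

lemma rotation_of_nonsurrounding_continuum:
  fixes A :: "complex set"
  assumes A: "compact A" "connected A" "0 \<in> outside A" "A \<noteq> {}"
    and w: "w ^ m = 1" "m > 0" and inv: "(\<lambda>z. w * z) ` A = A"
  shows "w = 1"
proof -
  have nA: "0 \<notin> A" using A(3) by (auto simp: outside_def)
  \<comment> \<open>Borsuk's criterion: as \<open>0\<close> is in the unbounded component of the
    complement, the radial projection of \<open>A\<close> to the circle is inessential, and
    \<open>g\<close> is the resulting argument.\<close>
  have "\<not> bounded (connected_component_set (- A) 0)" using A(3) by (auto simp: outside_def)
  then have "\<exists>c. homotopic_with_canon (\<lambda>x. True) A (sphere 0 1) (\<lambda>x. inverse (norm (x - 0)) *\<^sub>R (x - 0)) (\<lambda>x. c)"
    using Borsuk_map_essential_bounded_component[OF A(1) nA] by blast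
  then obtain g where g: "continuous_on A g" "\<And>x. x \<in> A \<Longrightarrow> inverse (norm (x - 0)) *\<^sub>R (x - 0) = exp (\<i> * complex_of_real (g x))"
    unfolding inessential_eq_continuous_logarithm_circle by blast
  have w1: "cmod w = 1" using w by (metis norm_one norm_power power_eq_1_iff norm_ge_zero not_gr_zero power_eq_imp_eq_base power_one zero_le_one)
  have gw: "exp (\<i> * complex_of_real (g (w * x) - g x)) = w" if "x \<in> A" for x
  proof -
    have "w * x \<in> A" using inv that by blast
    have "x \<noteq> 0" using that nA by auto
    have "exp (\<i> * complex_of_real (g (w * x) - g x)) = exp (\<i> * complex_of_real (g (w * x))) / exp (\<i> * complex_of_real (g x))"
      by (simp add: exp_diff[symmetric] right_diff_distrib)
    also have "\<dots> = (inverse (norm (w * x)) *\<^sub>R (w * x)) / (inverse (norm x) *\<^sub>R x)"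
      using g(2)[OF that] g(2)[OF \<open>w * x \<in> A\<close>] by simp
    also have "\<dots> = w" using \<open>x \<noteq> 0\<close> w1 by (simp add: norm_mult scaleR_conv_of_real)
    finally show ?thesis .
  qed
  \<comment> \<open>The difference is an argument of the fixed number \<open>w\<close>, so its
    values differ by multiples of \<open>2 * pi\<close>.\<close>
  have "(\<lambda>x. g (w * x) - g x) constant_on A"
  proof (rule continuous_discrete_range_constant[OF A(2)])
    have "continuous_on A (\<lambda>x. g (w * x))"
      by (rule continuous_on_compose2[OF g(1)]) (use inv in \<open>auto intro!: continuous_intros\<close>)
    then show "continuous_on A (\<lambda>x. g (w * x) - g x)" by (intro continuous_intros g(1))
    fix x assume x: "x \<in> A"
    have "2 * pi \<le> norm ((g (w * y) - g y) - (g (w * x) - g x))" if y: "y \<in> A" "g (w * y) - g y \<noteq> g (w * x) - g x" for y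
    proof -
      have "exp (\<i> * complex_of_real (g (w * y) - g y)) = exp (\<i> * complex_of_real (g (w * x) - g x))"
        using gw x y by simp
      then obtain q :: int where "\<i> * complex_of_real (g (w * y) - g y) = \<i> * complex_of_real (g (w * x) - g x) + of_int (2 * q) * pi * \<i>"
        unfolding exp_eq by auto
      then have "Im (\<i> * complex_of_real (g (w * y) - g y)) = Im (\<i> * complex_of_real (g (w * x) - g x) + of_int (2 * q) * pi * \<i>)" by simp
      then have q: "(g (w * y) - g y) - (g (w * x) - g x) = 2 * pi * q" by (simp add: algebra_simps)
      then have "q \<noteq> 0" using y(2) by auto
      then have "1 \<le> \<bar>real_of_int q\<bar>" by linarith
      then have "2 * pi * 1 \<le> 2 * pi * \<bar>real_of_int q\<bar>" by (intro mult_left_mono) auto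
      then show ?thesis unfolding q by (simp add: abs_mult)
    qed
    then show "\<exists>e>0. \<forall>y. y \<in> A \<and> g (w * y) - g y \<noteq> g (w * x) - g x \<longrightarrow> e \<le> norm ((g (w * y) - g y) - (g (w * x) - g x))"
      using pi_gt_zero by (intro exI[of _ "2 * pi"]) auto
  qed
  then obtain c where c: "\<And>x. x \<in> A \<Longrightarrow> g (w * x) - g x = c" by (auto simp: constant_on_def)
  obtain x where x: "x \<in> A" using A(4) by blast
  have it: "w ^ j * x \<in> A \<and> g (w ^ j * x) = g x + j * c" for j
  proof (induction j)
    case (Suc j)
    then have "w * (w ^ j * x) \<in> A" using inv by blast
    then show ?case using Suc c[of "w ^ j * x"] by (simp add: algebra_simps)
  qed (use x in simp)
  have "m * c = 0" using it[of m] w(1) by simp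
  then have "c = 0" using w(2) by simp
  then show ?thesis using gw[OF x] c[OF x] by simp
qed

subsection \<open>McMullen maps\<close>

definition spin :: "complex \<Rightarrow> complex \<times> real \<Rightarrow> complex \<times> real" where
  "spin w P = (w * fst P, snd P)"

lemma spin_stereo: "cmod w = 1 \<Longrightarrow> spin w (stereo z) = stereo (w * z)"
  by (simp add: spin_def stereo_def norm_mult mult_ac)

lemma spin_spin: "spin v (spin w P) = spin (v * w) P"
  by (simp add: spin_def mult.assoc)

lemma spin_1: "spin 1 P = P"
  by (simp add: spin_def)

lemma dist_spin: "cmod w = 1 \<Longrightarrow> dist (spin w P) (spin w Q) = dist P Q"
  by (cases P; cases Q) (simp add: spin_def dist_norm norm_Pair right_diff_distrib[symmetric] norm_mult)

lemma spin_in_S2: "cmod w = 1 \<Longrightarrow> spin w P \<in> S2 \<longleftrightarrow> P \<in> S2"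
  by (simp add: mem_S2_iff spin_def norm_mult)

lemma continuous_on_spin: "continuous_on A (spin w)"
  unfolding spin_def[abs_def] by (intro continuous_intros)

locale mcm =
  fixes k l :: nat and \<eta> :: complex
  assumes k2: "k \<ge> 2" and l2: "l \<ge> 2" and \<eta>: "\<eta> \<noteq> 0"
begin

definition "m = k + l"

abbreviation "g \<equiv> mcmullen k l \<eta>"
abbreviation "G \<equiv> sphere_ext g"

text \<open>An escape radius: beyond it the power \<open>k \<ge> 2\<close> contributes at least
  \<open>3 * cmod z\<close>, and the other term, of modulus at most \<open>cmod \<eta>\<close>,
  takes away less than \<open>cmod z\<close>.\<close>

definition "\<rho> = 3 + cmod \<eta>"

lemma g_expand: assumes "cmod z \<ge> \<rho>" shows "cmod (g z) \<ge> 2 * cmod z"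
proof -
  have z: "cmod z \<ge> 3" "cmod z \<ge> cmod \<eta> + 3" using assms norm_ge_zero[of \<eta>] unfolding \<rho>_def by linarith+
  then have z0: "z \<noteq> 0" by auto
  have "cmod z ^ 2 \<le> cmod z ^ k" using k2 z by (intro power_increasing) auto
  moreover have "3 * cmod z \<le> cmod z ^ 2" using z by (simp add: power2_eq_square mult_right_mono)
  moreover have "cmod (\<eta> / z ^ l) \<le> cmod \<eta> / 1"
    unfolding norm_divide norm_power using z z0 one_le_power[of "cmod z" l] by (intro divide_left_mono) auto
  moreover have "cmod (z ^ k) \<le> cmod (g z) + cmod (\<eta> / z ^ l)"
    unfolding mcmullen_def using norm_triangle_ineq4[of "z ^ k + \<eta> / z ^ l" "\<eta> / z ^ l"] by simp
  ultimately show ?thesis using z unfolding norm_power by linarith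
qed

lemma g_at_infinity: "filterlim g at_infinity at_infinity"
proof (rule filterlim_at_infinity[THEN iffD2, rule_format, of 0])
  fix r :: real assume "r > 0"
  have "\<forall>\<^sub>F z in at_infinity. cmod z \<ge> max \<rho> r" by (rule eventually_at_infinityI)
  then show "\<forall>\<^sub>F z in at_infinity. r \<le> cmod (g z)"
  proof eventually_elim
    case (elim z)
    then show ?case using g_expand[of z] \<open>r > 0\<close> by simp
  qed
qed simp

sublocale sphere_map g "{0}"
proof
  show "isCont g z" if "z \<notin> {0}" for z
    unfolding mcmullen_def[abs_def] using that by (intro continuous_intros) auto
  show "filterlim g at_infinity (at z)" if "z \<in> {0}" for z
  proof -
    have "filterlim (\<lambda>z. (z ^ (k + l) + \<eta>) / z ^ l) at_infinity (at 0)"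
    proof (rule filterlim_divide_at_infinity[where c = \<eta>])
      have "((\<lambda>z. z ^ (k + l) + \<eta>) \<longlongrightarrow> 0 ^ (k + l) + \<eta>) (at 0)" by (intro tendsto_intros)
      then show "((\<lambda>z. z ^ (k + l) + \<eta>) \<longlongrightarrow> \<eta>) (at 0)" using k2 by (simp add: zero_power)
      have "((\<lambda>z::complex. z ^ l) \<longlongrightarrow> 0 ^ l) (at 0)" by (intro tendsto_intros)
      then show "filterlim (\<lambda>z. z ^ l) (at 0) (at (0::complex))"
        using l2 by (simp add: filterlim_at zero_power eventually_at_filter)
    qed (rule \<eta>)
    moreover have ev: "\<forall>\<^sub>F z in at 0. (z ^ (k + l) + \<eta>) / z ^ l = g z"
      by (simp add: eventually_at_filter mcmullen_def power_add field_simps)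
    ultimately have "filterlim g at_infinity (at 0)" using filterlim_cong[OF refl refl ev] by blast
    then show ?thesis using that by simp
  qed
  show "(\<exists>w. (g \<longlongrightarrow> w) at_infinity) \<or> filterlim g at_infinity at_infinity" using g_at_infinity by blast
qed simp

lemma G_north: "G north = north"
  by (rule sphere_ext_north_pole[OF g_at_infinity])

lemma G_zero: "G (stereo 0) = north"
  by (rule sphere_ext_X) simp

lemma G_stereo: "z \<noteq> 0 \<Longrightarrow> G (stereo z) = stereo (g z)"
  by (rule sphere_ext_regular) simp

definition "Uinf = - stereo ` cball 0 \<rho>"

lemma open_Uinf: "open Uinf"
  unfolding Uinf_def
  by (intro open_Compl compact_imp_closed compact_continuous_image continuous_on_stereo compact_cball)

lemma Uinf_cases:
  assumes "P \<in> Uinf \<inter> S2"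
  obtains "P = north" | z where "P = stereo z" "cmod z > \<rho>"
proof -
  have PS: "P \<in> S2" using assms by simp
  then show ?thesis
  proof (cases rule: S2_cases)
    case (2 z)
    have "cmod z > \<rho>"
    proof (rule ccontr)
      assume "\<not> cmod z > \<rho>"
      then have "P \<in> stereo ` cball 0 \<rho>" using 2 by (intro image_eqI[of _ _ z]) auto
      then show False using assms by (simp add: Uinf_def)
    qed
    then show ?thesis using that(2) 2 by blast
  qed (rule that(1))
qed

lemma G_funpow_Uinf: assumes "P \<in> Uinf \<inter> S2"
  shows "(G ^^ j) P = north \<or> (\<exists>z. (G ^^ j) P = stereo z \<and> cmod z \<ge> 2 ^ j * \<rho>)"
proof (induction j)
  case 0
  show ?case by (cases rule: Uinf_cases[OF assms]) auto
next
  case (Suc j)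
  then show ?case
  proof
    assume "\<exists>z. (G ^^ j) P = stereo z \<and> cmod z \<ge> 2 ^ j * \<rho>"
    then obtain z where z: "(G ^^ j) P = stereo z" "cmod z \<ge> 2 ^ j * \<rho>" by blast
    have \<rho>: "\<rho> > 0" by (simp add: \<rho>_def add_pos_nonneg)
    have "1 * \<rho> \<le> 2 ^ j * \<rho>" using \<rho> by (intro mult_right_mono) auto
    then have "cmod z \<ge> \<rho>" using z(2) by simp
    then have "cmod (g z) \<ge> 2 * cmod z" "z \<noteq> 0" using g_expand \<rho> by auto
    then show ?thesis using z G_stereo[of z] by (intro disjI2 exI[of _ "g z"]) simp
  qed (simp add: G_north)
qed

lemma enters_Uinf_fatou:
  assumes P: "P \<in> S2" and N: "(G ^^ N) P \<in> Uinf"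
  shows "P \<in> fatou G"
proof -
  have "openin (top_of_set S2) (S2 \<inter> (G ^^ N) -` (S2 \<inter> Uinf))"
    by (rule continuous_openin_preimage[OF continuous_on_funpow_sphere_ext _ openin_open_Int[OF open_Uinf]])
       (use funpow_sphere_ext_in_S2 in auto)
  then obtain U where U: "open U" "S2 \<inter> (G ^^ N) -` (S2 \<inter> Uinf) = S2 \<inter> U" by (auto simp: openin_open)
  have \<rho>: "\<rho> > 0" by (simp add: \<rho>_def add_pos_nonneg)
  show ?thesis
  proof (rule fatouI[OF P _ U(1), where N = N and p = "\<lambda>_. north" and b = "\<lambda>j. 2 / \<rho> * (1/2) ^ (j - N)"])
    show "P \<in> U" using P N U(2) funpow_sphere_ext_in_S2[OF P] by blast
    show "north \<in> S2" by (rule north_in_S2)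
    show "dist ((G ^^ j) Q) north \<le> 2 / \<rho> * (1/2) ^ (j - N)" if "Q \<in> U \<inter> S2" "j \<ge> N" for Q j
    proof -
      have "(G ^^ N) Q \<in> Uinf \<inter> S2" using that U(2) by blast
      from G_funpow_Uinf[OF this, of "j - N"] have
        "(G ^^ j) Q = north \<or> (\<exists>z. (G ^^ j) Q = stereo z \<and> cmod z \<ge> 2 ^ (j - N) * \<rho>)"
        using that(2) by (metis funpow_add le_add_diff_inverse2 o_apply)
      then show ?thesis
      proof
        assume "\<exists>z. (G ^^ j) Q = stereo z \<and> cmod z \<ge> 2 ^ (j - N) * \<rho>"
        then obtain z where z: "(G ^^ j) Q = stereo z" "cmod z \<ge> 2 ^ (j - N) * \<rho>" by blast
        have pos: "2 ^ (j - N) * \<rho> > 0" using \<rho> by simp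
        then have "z \<noteq> 0" using z(2) by auto
        then have "dist ((G ^^ j) Q) north \<le> 2 / cmod z" unfolding z(1) by (rule dist_stereo_north)
        also have "\<dots> \<le> 2 / (2 ^ (j - N) * \<rho>)" using z(2) pos \<open>z \<noteq> 0\<close> by (intro divide_left_mono) auto
        finally show ?thesis by (simp add: power_divide mult.commute)
      qed (use \<rho> in simp)
    qed
    show "(\<lambda>j. 2 / \<rho> * (1/2) ^ (j - N)) \<longlonglongrightarrow> 0" by (intro tendsto_mult_right_zero) real_asymp
  qed
qed

lemma north_in_Uinf: "north \<in> Uinf"
  using stereo_neq_north unfolding Uinf_def by (metis ComplI imageE)

lemma north_notin_julia: "north \<notin> julia G"
  using enters_Uinf_fatou[of north 0] north_in_S2 north_in_Uinf by (simp add: julia_def)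

lemma zero_notin_julia: "stereo 0 \<notin> julia G"
  using enters_Uinf_fatou[of "stereo 0" 1] stereo_in_S2 north_in_Uinf by (simp add: julia_def G_zero)

lemma large_notin_julia: "cmod z > \<rho> \<Longrightarrow> stereo z \<notin> julia G"
  using enters_Uinf_fatou[of "stereo z" 0] stereo_in_S2[of z]
  by (force simp: julia_def Uinf_def stereo_inject image_iff)

definition J :: "complex set" where "J = {z. stereo z \<in> julia G}"

lemma J_bound: "z \<in> J \<Longrightarrow> cmod z \<le> \<rho>" "0 \<notin> J"
  using large_notin_julia zero_notin_julia by (auto simp: J_def not_less[symmetric])

lemma compact_J: "compact J"
proof -
  have "closed (stereo -` julia G)"
    using continuous_closed_vimage[OF closed_julia] isCont_stereo by blast
  moreover have "J = stereo -` julia G" by (auto simp: J_def)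
  moreover have "bounded J" using J_bound by (auto simp: bounded_iff)
  ultimately show ?thesis by (simp add: compact_eq_bounded_closed)
qed

lemma g_rotate: assumes "w ^ m = 1" shows "g (w * z) = w ^ k * g z"
proof -
  have w: "w ^ k * w ^ l = 1" using assms by (simp add: m_def power_add)
  then have "w \<noteq> 0" using l2 by (auto simp: zero_power)
  then have "1 / w ^ l = w ^ k" using w by (simp add: field_simps)
  moreover have "\<eta> / (w * z) ^ l = (1 / w ^ l) * (\<eta> / z ^ l)" by (simp add: power_mult_distrib)
  ultimately have "\<eta> / (w * z) ^ l = w ^ k * (\<eta> / z ^ l)" by simp
  then show ?thesis by (simp add: mcmullen_def power_mult_distrib algebra_simps)
qed

lemma root_cmod: assumes "w ^ m = 1" shows "cmod w = 1"
proof -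
  have "m > 0" using k2 by (simp add: m_def)
  moreover have "cmod w ^ m = 1 ^ m" using assms by (metis norm_one norm_power power_one)
  ultimately show ?thesis by (intro power_eq_imp_eq_base[of "cmod w" m 1]) auto
qed

lemma root_power: "w ^ m = 1 \<Longrightarrow> (w ^ j) ^ m = (1 :: complex)"
  by (metis mult.commute power_mult power_one)

lemma G_spin: assumes w: "w ^ m = 1" and P: "P \<in> S2" shows "G (spin w P) = spin (w ^ k) (G P)"
proof -
  have n: "spin v north = north" for v by (simp add: spin_def north_def)
  have c: "cmod w = 1" "cmod (w ^ k) = 1" using root_cmod root_power w by auto
  show ?thesis
  proof (cases rule: S2_cases[OF P])
    case 1
    then show ?thesis by (simp add: n G_north)
  next
    case (2 z)
    show ?thesis
    proof (cases "z = 0")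
      case True
      then show ?thesis using 2 c by (simp add: spin_stereo G_zero n)
    next
      case False
      moreover have "w \<noteq> 0" using c by auto
      ultimately show ?thesis using 2 c g_rotate[OF w] by (simp add: spin_stereo G_stereo)
    qed
  qed
qed

lemma G_funpow_spin: assumes w: "w ^ m = 1" and P: "P \<in> S2"
  shows "(G ^^ j) (spin w P) = spin (w ^ (k ^ j)) ((G ^^ j) P)"
proof (induction j)
  case (Suc j)
  have "(G ^^ Suc j) (spin w P) = G (spin (w ^ (k ^ j)) ((G ^^ j) P))" using Suc by simp
  also have "\<dots> = spin ((w ^ (k ^ j)) ^ k) (G ((G ^^ j) P))"
    by (rule G_spin[OF root_power[OF w] funpow_sphere_ext_in_S2[OF P]])
  finally show ?case by (simp add: power_mult[symmetric] mult.commute)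
qed simp

text \<open>Rotation by \<open>w\<close> before \<open>j\<close> steps is rotation by
  \<open>w ^ (k ^ j)\<close> after them. This factor depends on \<open>j\<close> but has finitely
  many values, so it is constant along a further subsequence, and the limit is rotated by that
  constant.\<close>

lemma fatou_spin:
  assumes w: "w ^ m = 1" and P: "P \<in> fatou G"
  shows "spin w P \<in> fatou G"
proof -
  have c: "cmod w = 1" using root_cmod w by simp
  have m0: "m > 0" using k2 by (simp add: m_def)
  define v where "v = w ^ (m - 1)"
  have "w * w ^ (m - 1) = w ^ m" using m0 by (simp add: power_eq_if)
  then have vw: "v * w = 1" "w * v = 1" using w by (auto simp: v_def mult.commute)
  have cv: "cmod v = 1" using root_cmod root_power[OF w] by (simp add: v_def)
  obtain U where U: "P \<in> S2" "open U" "P \<in> U" "normal_iterates_on G (U \<inter> S2)" using P by (auto simp: fatou_def)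
  define U' where "U' = spin v -` U"
  have "open U'" unfolding U'_def by (rule open_vimage[OF U(2) continuous_on_spin])
  moreover have "spin w P \<in> U'" using U(3) by (simp add: U'_def spin_spin vw spin_1)
  moreover have "spin w P \<in> S2" using U(1) spin_in_S2[OF c] by simp
  moreover have "normal_iterates_on G (U' \<inter> S2)"
    unfolding normal_iterates_on_def
  proof
    fix r :: "nat \<Rightarrow> nat"
    obtain s h where s: "strict_mono s" "\<forall>C. compact C \<and> C \<subseteq> U \<inter> S2 \<longrightarrow> uniform_limit C (\<lambda>j. G ^^ r (s j)) h sequentially"
      using U(4)[unfolded normal_iterates_on_def, rule_format, of r] by (elim exE conjE)
    have "\<not> filterlim (\<lambda>j. k ^ r (s j) mod m) at_top sequentially"
    proof
      assume "filterlim (\<lambda>j. k ^ r (s j) mod m) at_top sequentially"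
      then have "\<forall>\<^sub>F j in sequentially. m \<le> k ^ r (s j) mod m" by (auto simp: filterlim_at_top)
      then have "\<forall>\<^sub>F j in sequentially. False"
      proof eventually_elim
        case (elim j)
        then show ?case using mod_less_divisor[OF m0, of "k ^ r (s j)"] by simp
      qed
      then show False by simp
    qed
    then obtain v0 s' where s': "strict_mono (s' :: nat \<Rightarrow> nat)" "\<forall>j. k ^ r (s (s' j)) mod m = v0"
      using constant_or_divergent_subseq[of "\<lambda>j. k ^ r (s j) mod m"] by blast
    define q where "q = w ^ v0"
    have cq: "cmod q = 1" using root_cmod root_power[OF w] by (simp add: q_def)
    have wq: "w ^ (k ^ r (s (s' j))) = q" for j
    proof -
      have "w ^ (k ^ r (s (s' j))) = w ^ (m * (k ^ r (s (s' j)) div m) + v0)" using s'(2) by (metis mult_div_mod_eq)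
      then show ?thesis using w by (simp add: power_add power_mult q_def)
    qed
    have "uniform_limit C (\<lambda>j. G ^^ r ((s \<circ> s') j)) (\<lambda>Q. spin q (h (spin v Q))) sequentially"
      if C: "compact C" "C \<subseteq> U' \<inter> S2" for C
    proof (rule uniform_limitI)
      fix \<epsilon> :: real assume \<epsilon>: "\<epsilon> > 0"
      have "compact (spin v ` C)" by (intro compact_continuous_image continuous_on_spin C)
      moreover have "spin v ` C \<subseteq> U \<inter> S2" using C(2) spin_in_S2[OF cv] by (auto simp: U'_def)
      ultimately have "uniform_limit (spin v ` C) (\<lambda>j. G ^^ r (s j)) h sequentially" using s(2) by blast
      then have "\<forall>\<^sub>F j in sequentially. \<forall>Q\<in>spin v ` C. dist ((G ^^ r (s j)) Q) (h Q) < \<epsilon>" by (rule uniform_limitD) (rule \<epsilon>)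
      from eventually_subseq[OF s'(1) this]
      show "\<forall>\<^sub>F j in sequentially. \<forall>Q\<in>C. dist ((G ^^ r ((s \<circ> s') j)) Q) (spin q (h (spin v Q))) < \<epsilon>"
      proof eventually_elim
        case (elim j)
        show ?case
        proof
          fix Q assume Q: "Q \<in> C"
          have "spin v Q \<in> S2" using Q C(2) spin_in_S2[OF cv] by auto
          then have "(G ^^ r ((s \<circ> s') j)) (spin w (spin v Q)) = spin q ((G ^^ r ((s \<circ> s') j)) (spin v Q))"
            using G_funpow_spin[OF w, of "spin v Q" "r ((s \<circ> s') j)"] wq by simp
          then have "(G ^^ r ((s \<circ> s') j)) Q = spin q ((G ^^ r ((s \<circ> s') j)) (spin v Q))"
            by (simp add: spin_spin vw spin_1)
          then show "dist ((G ^^ r ((s \<circ> s') j)) Q) (spin q (h (spin v Q))) < \<epsilon>"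
            using elim Q by (simp add: dist_spin[OF cq])
        qed
      qed
    qed
    moreover have "strict_mono (s \<circ> s')" using s(1) s'(1) by (simp add: strict_mono_o)
    ultimately show "\<exists>s g. strict_mono s \<and> (\<forall>C. compact C \<and> C \<subseteq> U' \<inter> S2 \<longrightarrow> uniform_limit C (\<lambda>k. G ^^ r (s k)) g sequentially)"
      by blast
  qed
  ultimately show ?thesis unfolding fatou_def by blast
qed

lemma J_rotate: assumes w: "w ^ m = 1" and z: "z \<in> J" shows "w * z \<in> J"
proof (rule ccontr)
  assume "w * z \<notin> J"
  then have F: "stereo (w * z) \<in> fatou G" using stereo_in_S2 by (auto simp: J_def julia_def)
  have m0: "m > 0" using k2 by (simp add: m_def)
  have "w ^ (m - 1) * w = w ^ m" using m0 by (simp add: power_eq_if mult.commute)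
  then have v: "w ^ (m - 1) * (w * z) = z" using w by (simp add: mult.assoc[symmetric])
  have "spin (w ^ (m - 1)) (stereo (w * z)) \<in> fatou G" by (rule fatou_spin[OF root_power[OF w] F])
  then have "stereo z \<in> fatou G" unfolding spin_stereo[OF root_cmod[OF root_power[OF w]]] v .
  then show False using z by (simp add: J_def julia_def)
qed

lemma g_holomorphic: "0 \<notin> S \<Longrightarrow> g holomorphic_on S"
  unfolding mcmullen_def[abs_def] by (intro holomorphic_intros) auto

text \<open>Montel's theorem for the iterates in the plane, carried to the sphere by the uniform
  continuity of \<open>stereo\<close> on a disc. Orbits must avoid the pole: division by zero gives
  \<open>g 0 = 0\<close>, so that \<open>g\<close> represents the map on the sphere only away from
  \<open>0\<close>.\<close>

lemma bounded_orbits_notin_J: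
  assumes N: "open N" "P \<in> N"
    and nz: "\<And>q j. q \<in> N \<Longrightarrow> (g ^^ j) q \<noteq> 0" and bd: "\<And>q j. q \<in> N \<Longrightarrow> cmod ((g ^^ j) q) \<le> M"
  shows "P \<notin> J"
proof -
  have hol: "(g ^^ j) holomorphic_on N" for j
  proof (induction j)
    case (Suc j)
    have "g \<circ> (g ^^ j) holomorphic_on N"
      by (rule holomorphic_on_compose[OF Suc g_holomorphic]) (use nz in auto)
    then show ?case by (simp add: o_def)
  qed (simp add: holomorphic_on_id[unfolded id_def])
  have Gj: "(G ^^ j) (stereo q) = stereo ((g ^^ j) q)" if "q \<in> N" for j q
    by (induction j) (simp_all add: G_stereo nz[OF that])
  have "openin (top_of_set (S2 - {north})) ((S2 - {north}) \<inter> unstereo -` N)"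
    by (rule continuous_openin_preimage_gen[OF continuous_on_unstereo N(1)])
  moreover have "openin (top_of_set S2) (S2 - {north})" by (intro openin_delete) simp
  ultimately have "openin (top_of_set S2) ((S2 - {north}) \<inter> unstereo -` N)" using openin_trans by metis
  then obtain U where U: "open U" "(S2 - {north}) \<inter> unstereo -` N = S2 \<inter> U" by (auto simp: openin_open)
  have PU: "stereo P \<in> S2 \<inter> U" unfolding U(2)[symmetric] using N(2) stereo_in_S2 stereo_neq_north by simp
  have "normal_iterates_on G (U \<inter> S2)"
    unfolding normal_iterates_on_def
  proof
    fix r :: "nat \<Rightarrow> nat"
    obtain h s where h: "strict_mono (s :: nat \<Rightarrow> nat)"
      "\<And>K. compact K \<Longrightarrow> K \<subseteq> N \<Longrightarrow> uniform_limit K ((\<lambda>j. g ^^ r j) \<circ> s) h sequentially"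
    proof (rule Montel[OF N(1), of "range (\<lambda>j. g ^^ j)" "\<lambda>j. g ^^ r j"])
      show "\<exists>B. \<forall>h\<in>range (\<lambda>j. g ^^ j). \<forall>z\<in>K. cmod (h z) \<le> B" if "K \<subseteq> N" for K
        using bd that by (intro exI[of _ M]) auto
    qed (use hol in auto)
    have "uniform_limit C (\<lambda>j. G ^^ r (s j)) (\<lambda>Q. stereo (h (unstereo Q))) sequentially"
      if C: "compact C" "C \<subseteq> U \<inter> S2" for C
    proof -
      have CN: "C \<subseteq> S2 - {north}" "unstereo ` C \<subseteq> N" using C(2) U(2) by blast+
      have cont: "continuous_on C unstereo" by (rule continuous_on_subset[OF continuous_on_unstereo CN(1)])
      have K: "uniform_limit (unstereo ` C) ((\<lambda>j. g ^^ r j) \<circ> s) h sequentially"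
        by (rule h(2)[OF compact_continuous_image[OF cont C(1)] CN(2)])
      have "uniform_limit C (\<lambda>j Q. (g ^^ r (s j)) (unstereo Q)) (\<lambda>Q. h (unstereo Q)) sequentially"
        by (rule uniform_limit_compose'[OF K, where h = unstereo and B = C, unfolded o_def]) simp
      then have "uniform_limit C (\<lambda>j Q. stereo ((g ^^ r (s j)) (unstereo Q))) (\<lambda>Q. stereo (h (unstereo Q))) sequentially"
      proof (rule uniform_limit_compose_uniformly_continuous_on[where B = "cball 0 M"])
        show "uniformly_continuous_on (cball 0 M) stereo"
          by (intro compact_uniformly_continuous continuous_on_stereo compact_cball)
        show "\<forall>\<^sub>F j in sequentially. \<forall>Q\<in>C. (g ^^ r (s j)) (unstereo Q) \<in> cball 0 M"
          using bd CN(2) by (intro always_eventually) (auto simp: image_subset_iff)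
      qed simp
      moreover have "(G ^^ r (s j)) Q = stereo ((g ^^ r (s j)) (unstereo Q))" if "Q \<in> C" for j Q
      proof -
        have "Q \<in> S2" "Q \<noteq> north" "unstereo Q \<in> N" using that CN by blast+
        then have "unstereo Q \<in> N" "stereo (unstereo Q) = Q" using stereo_unstereo by blast+
        then show ?thesis using Gj by metis
      qed
      ultimately show ?thesis by (subst uniform_limit_cong'[where g = "\<lambda>j Q. stereo ((g ^^ r (s j)) (unstereo Q))"]) auto
    qed
    then show "\<exists>s g. strict_mono s \<and> (\<forall>C. compact C \<and> C \<subseteq> U \<inter> S2 \<longrightarrow> uniform_limit C (\<lambda>k. G ^^ r (s k)) g sequentially)"
      using h(1) by blast
  qed
  then have "stereo P \<in> fatou G" unfolding fatou_def using PU U(1) by blast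
  then show ?thesis by (simp add: J_def julia_def)
qed

lemma g_eq_roots: assumes "z \<noteq> 0" "g z = v" shows "poly (monom 1 m + monom (- v) l + [:\<eta>:]) z = 0"
proof -
  have "z ^ m + \<eta> = v * z ^ l"
    using assms by (auto simp: mcmullen_def m_def power_add field_simps)
  then show ?thesis by (simp add: poly_monom algebra_simps)
qed

text \<open>Multiplication by \<open>z ^ l\<close> turns the equation into a polynomial one of
  degree \<open>m\<close>; its leading coefficient is 1, because \<open>l < m\<close>.\<close>

lemma card_preimages: "finite {z. z \<noteq> 0 \<and> g z = v}" "card {z. z \<noteq> 0 \<and> g z = v} \<le> m"
proof -
  let ?p = "monom 1 m + monom (- v) l + [:\<eta>:]"
  have "coeff [:\<eta>:] m = 0" "l \<noteq> m" using k2 by (auto simp: m_def intro!: coeff_eq_0)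
  then have "coeff ?p m = 1" by simp
  then have p0: "?p \<noteq> 0" by (metis coeff_0 zero_neq_one)
  have deg: "degree ?p \<le> m"
    using k2 by (intro degree_add_le) (auto intro: order.trans[OF degree_monom_le] simp: m_def)
  have sub: "{z. z \<noteq> 0 \<and> g z = v} \<subseteq> {z. poly ?p z = 0}" using g_eq_roots by auto
  then show "finite {z. z \<noteq> 0 \<and> g z = v}" using poly_roots_finite[OF p0] by (rule finite_subset)
  have "card {z. z \<noteq> 0 \<and> g z = v} \<le> card {z. poly ?p z = 0}" by (rule card_mono[OF poly_roots_finite[OF p0] sub])
  also have "\<dots> \<le> degree ?p" by (rule card_poly_roots_bound[OF p0])
  finally show "card {z. z \<noteq> 0 \<and> g z = v} \<le> m" using deg by simp
qed

lemma open_image_g: assumes "open V" "0 \<notin> V" shows "open (g ` V)"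
proof (rule open_mapping_thm[of g "- {0}"])
  show "g holomorphic_on - {0}" by (rule g_holomorphic) simp
  show "connected (- {0::complex})" by (rule connected_punctured_universe) simp
  show "\<not> g constant_on - {0}"
  proof
    assume "g constant_on - {0}"
    then obtain v where "\<And>z. z \<noteq> 0 \<Longrightarrow> g z = v" by (auto simp: constant_on_def)
    then have "{z. z \<noteq> 0 \<and> g z = v} = - {0}" by auto
    then have "finite (- {0::complex})" using card_preimages(1)[of v] by simp
    then show False by (simp add: infinite_UNIV_char_0)
  qed
qed (use assms in auto)

end

section \<open>Exclusion of a conjugacy with a McMullen map\<close>

text \<open>The assumptions say that \<open>\<gamma>\<close> parametrises the Julia set of the McMullen map by the Cantor set times
  the circle, in the way a conjugacy would induce. They are contradictory.\<close>

locale mcm_conj = mcm k l \<eta> + cantor_code n psi idx T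
  for k l \<eta> n psi idx T +
  fixes e :: "nat \<Rightarrow> int" and \<gamma> :: "real \<Rightarrow> real \<Rightarrow> complex"
  assumes n3: "n \<ge> 3"
    and e2: "i \<in> {1..n} \<Longrightarrow> \<bar>e i\<bar> \<ge> 2"
    and \<gamma>_cont: "continuous_on (cantor_set \<times> UNIV) (\<lambda>p. \<gamma> (fst p) (snd p))"
    and \<gamma>_eq_iff: "x \<in> cantor_set \<Longrightarrow> x' \<in> cantor_set \<Longrightarrow> \<gamma> x t = \<gamma> x' t' \<longleftrightarrow> x = x' \<and> (\<exists>q::int. t = t' + 2 * pi * q)"
    and \<gamma>_J: "J = (\<lambda>p. \<gamma> (fst p) (snd p)) ` (cantor_set \<times> UNIV)"
    and g_\<gamma>: "x \<in> cantor_set \<Longrightarrow> g (\<gamma> x t) = \<gamma> (T x) (real_of_int (e (idx x)) * t)"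
begin

definition \<Gamma> :: "real \<Rightarrow> complex set" where "\<Gamma> x = range (\<gamma> x)"

lemma \<gamma>_in_J: "x \<in> cantor_set \<Longrightarrow> \<gamma> x t \<in> J"
  unfolding \<gamma>_J by (intro image_eqI[of _ _ "(x, t)"]) auto

lemma J_cases: assumes "z \<in> J" obtains x t where "x \<in> cantor_set" "z = \<gamma> x t"
  using assms unfolding \<gamma>_J by auto

lemma \<Gamma>_subset: "x \<in> cantor_set \<Longrightarrow> \<Gamma> x \<subseteq> J"
  using \<gamma>_in_J by (auto simp: \<Gamma>_def)

lemma g_J: "z \<in> J \<Longrightarrow> g z \<in> J"
  by (erule J_cases) (simp add: g_\<gamma> \<gamma>_in_J T_in)

lemma \<Gamma>_disjoint: "x \<in> cantor_set \<Longrightarrow> x' \<in> cantor_set \<Longrightarrow> x \<noteq> x' \<Longrightarrow> \<Gamma> x \<inter> \<Gamma> x' = {}"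
  using \<gamma>_eq_iff by (fastforce simp: \<Gamma>_def)

lemma \<gamma>_reduce: assumes "x \<in> cantor_set" shows "\<exists>s \<in> {0..2*pi}. \<gamma> x t = \<gamma> x s"
  using reduce_angle[of t] \<gamma>_eq_iff[OF assms assms] by blast

definition loop :: "real \<Rightarrow> real \<Rightarrow> complex" where "loop x t = \<gamma> x (2 * pi * t)"

lemma path_image_loop: assumes "x \<in> cantor_set" shows "path_image (loop x) = \<Gamma> x"
proof
  show "\<Gamma> x \<subseteq> path_image (loop x)"
  proof
    fix z assume "z \<in> \<Gamma> x"
    then obtain t where "z = \<gamma> x t" by (auto simp: \<Gamma>_def)
    then obtain s where s: "s \<in> {0..2*pi}" "z = \<gamma> x s" using \<gamma>_reduce[OF assms, of t] by blast
    then have "s / (2 * pi) \<in> {0..1}" "z = loop x (s / (2 * pi))" by (auto simp: loop_def field_simps)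
    then show "z \<in> path_image (loop x)" by (auto simp: path_image_def)
  qed
qed (auto simp: path_image_def loop_def \<Gamma>_def)

lemma simple_loop: assumes x: "x \<in> cantor_set" shows "simple_path (loop x)" "pathfinish (loop x) = pathstart (loop x)"
proof -
  have "continuous_on {0..1} (\<lambda>t. (x, 2 * pi * t))" by (intro continuous_intros)
  then have "continuous_on {0..1} (loop x)"
    unfolding loop_def[abs_def] using x
    by (intro continuous_on_compose2[OF \<gamma>_cont, of "{0..1}" "\<lambda>t. (x, 2 * pi * t)", unfolded fst_conv snd_conv]) auto
  moreover have "s = t \<or> s = 0 \<and> t = 1 \<or> s = 1 \<and> t = 0" if st: "s \<in> {0..1}" "t \<in> {0..1}" "loop x s = loop x t" for s t
  proof -
    obtain q :: int where "2 * pi * s = 2 * pi * t + 2 * pi * q" using st(3) \<gamma>_eq_iff[OF x x] by (auto simp: loop_def)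
    then have "2 * pi * s = 2 * pi * (t + q)" by (simp add: algebra_simps)
    then have q: "s = t + q" by simp
    then have "\<bar>real_of_int q\<bar> \<le> 1" using st(1,2) by auto
    then have "q = -1 \<or> q = 0 \<or> q = 1" by linarith
    then show ?thesis using q st(1,2) by auto
  qed
  ultimately show "simple_path (loop x)" by (auto simp: simple_path_def path_def loop_free_def)
  show "pathfinish (loop x) = pathstart (loop x)"
    unfolding pathfinish_def pathstart_def loop_def \<gamma>_eq_iff[OF x x] by (intro conjI exI[of _ 1]) auto
qed

lemma \<Gamma>_props:
  assumes x: "x \<in> cantor_set"
  shows "compact (\<Gamma> x)" "connected (\<Gamma> x)" "\<Gamma> x \<noteq> {}" "inside (\<Gamma> x) \<noteq> {}" "open (inside (\<Gamma> x))"
    "connected (inside (\<Gamma> x))" "open (outside (\<Gamma> x))" "connected (outside (\<Gamma> x))"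
    "bounded (inside (\<Gamma> x))" "\<not> bounded (outside (\<Gamma> x))" "inside (\<Gamma> x) \<union> outside (\<Gamma> x) = - \<Gamma> x"
    "frontier (inside (\<Gamma> x)) = \<Gamma> x" "frontier (outside (\<Gamma> x)) = \<Gamma> x"
  using Jordan_inside_outside[OF simple_loop[OF x]] compact_simple_path_image[OF simple_loop(1)[OF x]]
    connected_simple_path_image[OF simple_loop(1)[OF x]] unfolding path_image_loop[OF x]
  by (auto simp: \<Gamma>_def)

lemma zero_notin_\<Gamma>: "x \<in> cantor_set \<Longrightarrow> 0 \<notin> \<Gamma> x"
  using \<Gamma>_subset J_bound(2) by blast

text \<open>The projection of the Julia set to the Cantor set is continuous, since the preimage of a
  closed set is the image of a compact one. A connected set therefore projects to one point.\<close>

lemma connected_in_\<Gamma>: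
  assumes S: "connected S" "S \<subseteq> J" and z: "z \<in> S" "z \<in> \<Gamma> x" and x: "x \<in> cantor_set"
  shows "S \<subseteq> \<Gamma> x"
proof -
  define code where "code z = (SOME x. x \<in> cantor_set \<and> z \<in> \<Gamma> x)" for z
  have code: "code (\<gamma> x t) = x" if "x \<in> cantor_set" for x t
  proof -
    have "code (\<gamma> x t) \<in> cantor_set \<and> \<gamma> x t \<in> \<Gamma> (code (\<gamma> x t))"
      unfolding code_def by (rule someI[of _ x]) (use that in \<open>auto simp: \<Gamma>_def\<close>)
    then show ?thesis using \<gamma>_eq_iff[OF that] by (auto simp: \<Gamma>_def)
  qed
  have "continuous_on J code"
  proof (subst continuous_on_closed_vimage[OF compact_imp_closed[OF compact_J]], intro allI impI)
    fix B :: "real set" assume B: "closed B"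
    have "code -` B \<inter> J = (\<lambda>p. \<gamma> (fst p) (snd p)) ` ((B \<inter> cantor_set) \<times> {0..2*pi})"
    proof (intro set_eqI iffI)
      fix z assume z: "z \<in> code -` B \<inter> J"
      then have zJ: "z \<in> J" by simp
      obtain x t where xt: "x \<in> cantor_set" "z = \<gamma> x t" by (rule J_cases[OF zJ])
      obtain s where s: "s \<in> {0..2*pi}" "z = \<gamma> x s" using \<gamma>_reduce[OF xt(1), of t] xt(2) by blast
      have "x \<in> B" using z xt code by simp
      then show "z \<in> (\<lambda>p. \<gamma> (fst p) (snd p)) ` ((B \<inter> cantor_set) \<times> {0..2*pi})"
        using s xt by (intro image_eqI[of _ _ "(x, s)"]) auto
    qed (auto simp: code \<gamma>_in_J)
    moreover have "compact ((\<lambda>p. \<gamma> (fst p) (snd p)) ` ((B \<inter> cantor_set) \<times> {0..2*pi}))"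
      by (intro compact_continuous_image continuous_on_subset[OF \<gamma>_cont] compact_Times closed_Int_compact B compact_cantor_set compact_Icc) auto
    ultimately show "closed (code -` B \<inter> J)" by (simp add: compact_imp_closed)
  qed
  then have con: "connected (code ` S)" using S by (intro connected_continuous_image) (auto intro: continuous_on_subset)
  have sub: "code ` S \<subseteq> cantor_set"
  proof
    fix y assume "y \<in> code ` S"
    then obtain z where "z \<in> J" "y = code z" using S(2) by auto
    then show "y \<in> cantor_set" using code by (metis J_cases)
  qed
  show ?thesis
  proof
    fix y assume y: "y \<in> S"
    then have yJ: "y \<in> J" using S(2) by blast
    obtain x' t where xt: "x' \<in> cantor_set" "y = \<gamma> x' t" by (rule J_cases[OF yJ])
    have "code y = code z" by (rule connected_cantor_singleton[OF con sub]) (use y z in auto)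
    moreover have "code z = x" using z(2) code[OF x] by (auto simp: \<Gamma>_def)
    ultimately have "x' = x" using code[OF xt(1)] xt(2) by simp
    then show "y \<in> \<Gamma> x" using xt(2) by (simp add: \<Gamma>_def)
  qed
qed

lemma components_J: assumes "A \<in> components J" shows "\<exists>x \<in> cantor_set. A = \<Gamma> x"
proof -
  have A: "connected A" "A \<subseteq> J" "A \<noteq> {}" 
    by (rule in_components_connected[OF assms] in_components_subset[OF assms] in_components_nonempty[OF assms])+
  then obtain z where z: "z \<in> A" by blast
  then have zJ: "z \<in> J" using A by blast
  obtain x t where xt: "x \<in> cantor_set" "z = \<gamma> x t" by (rule J_cases[OF zJ])
  have zx: "z \<in> \<Gamma> x" using xt by (simp add: \<Gamma>_def)
  have "A \<subseteq> \<Gamma> x" by (rule connected_in_\<Gamma>[OF A(1,2) z zx xt(1)])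
  moreover have "\<Gamma> x \<subseteq> A"
    by (rule components_maximal[OF assms \<Gamma>_props(2)[OF xt(1)] \<Gamma>_subset[OF xt(1)]]) (use z zx in blast)
  ultimately show ?thesis using xt(1) by blast
qed

lemma rotate_connected: "connected S \<Longrightarrow> connected ((\<lambda>z. w * z) ` S)" for w :: complex
  by (intro connected_continuous_image continuous_intros)

lemma root_inverse: assumes "w ^ m = 1" obtains v :: complex where "v ^ m = 1" "v * w = 1" "w * v = 1"
proof -
  have "m > 0" using k2 by (simp add: m_def)
  then have "w ^ (m - 1) * w = w ^ m" by (simp add: power_eq_if mult.commute)
  then show ?thesis using that[of "w ^ (m - 1)"] root_power[OF assms] assms by (simp add: mult.commute)
qed

lemma rotate_\<Gamma>:
  assumes w: "w ^ m = 1" and x: "x \<in> cantor_set"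
  shows "\<exists>x' \<in> cantor_set. (\<lambda>z. w * z) ` \<Gamma> x = \<Gamma> x'"
proof -
  have sub: "\<exists>x' \<in> cantor_set. (\<lambda>z. w * z) ` \<Gamma> x \<subseteq> \<Gamma> x'" if w: "w ^ m = 1" and x: "x \<in> cantor_set" for w x
  proof -
    have wJ: "w * \<gamma> x 0 \<in> J" by (rule J_rotate[OF w \<gamma>_in_J[OF x]])
    obtain x' t where xt: "x' \<in> cantor_set" "w * \<gamma> x 0 = \<gamma> x' t" by (rule J_cases[OF wJ])
    have "(\<lambda>z. w * z) ` \<Gamma> x \<subseteq> \<Gamma> x'"
    proof (rule connected_in_\<Gamma>[OF rotate_connected[OF \<Gamma>_props(2)[OF x]] _ _ _ xt(1)])
      show "(\<lambda>z. w * z) ` \<Gamma> x \<subseteq> J" using J_rotate[OF w] \<Gamma>_subset[OF x] by blast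
      show "w * \<gamma> x 0 \<in> (\<lambda>z. w * z) ` \<Gamma> x" unfolding \<Gamma>_def by blast
      show "w * \<gamma> x 0 \<in> \<Gamma> x'" using xt(2) by (simp add: \<Gamma>_def)
    qed
    then show ?thesis using xt(1) by blast
  qed
  obtain v where v: "v ^ m = 1" "v * w = 1" "w * v = 1" using root_inverse[OF w] .
  obtain x' where x': "x' \<in> cantor_set" "(\<lambda>z. w * z) ` \<Gamma> x \<subseteq> \<Gamma> x'" using sub[OF w x] by blast
  \<comment> \<open>Rotating back leads to \<open>\<Gamma> x\<close> again, so the inclusion just
    found is an equality.\<close>
  obtain x'' where x'': "x'' \<in> cantor_set" "(\<lambda>z. v * z) ` \<Gamma> x' \<subseteq> \<Gamma> x''" using sub[OF v(1) x'(1)] by blast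
  have "\<gamma> x 0 \<in> \<Gamma> x" by (simp add: \<Gamma>_def)
  then have "v * (w * \<gamma> x 0) \<in> \<Gamma> x''" using x'(2) x''(2) by blast
  then have "\<gamma> x 0 \<in> \<Gamma> x''" using v by (simp add: mult.assoc[symmetric])
  then have "x'' = x" using \<Gamma>_disjoint[OF x x''(1)] by (auto simp: \<Gamma>_def)
  have "\<Gamma> x' \<subseteq> (\<lambda>z. w * z) ` \<Gamma> x"
  proof
    fix z assume "z \<in> \<Gamma> x'"
    then have "v * z \<in> \<Gamma> x" using x''(2) \<open>x'' = x\<close> by blast
    moreover have "z = w * (v * z)" using v by (simp add: mult.assoc[symmetric])
    ultimately show "z \<in> (\<lambda>z. w * z) ` \<Gamma> x" by (intro image_eqI[of _ _ "v * z"])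
  qed
  then show ?thesis using x' by blast
qed

lemma surrounding_rotate:
  assumes w: "w ^ m = 1" and x: "x \<in> cantor_set" and s: "0 \<in> inside (\<Gamma> x)"
  shows "(\<lambda>z. w * z) ` \<Gamma> x = \<Gamma> x"
proof -
  obtain x' where x': "x' \<in> cantor_set" "(\<lambda>z. w * z) ` \<Gamma> x = \<Gamma> x'" using rotate_\<Gamma>[OF w x] by blast
  have "x' = x"
  proof (rule ccontr)
    assume "x' \<noteq> x"
    then have "(\<lambda>z. w * z) ` \<Gamma> x \<inter> \<Gamma> x = {}" unfolding x'(2) using \<Gamma>_disjoint[OF x'(1) x] by blast
    then show False
      using rotation_of_surrounding_continuum[OF \<Gamma>_props(1,2)[OF x] s root_cmod[OF w]] by blast
  qed
  then show ?thesis using x' by simp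
qed

definition preim :: "real \<Rightarrow> real set" where "preim y = (\<lambda>i. psi i y) ` {1..n}"

lemma preim_subset: "y \<in> cantor_set \<Longrightarrow> x \<in> preim y \<Longrightarrow> x \<in> cantor_set"
  using psi_in by (auto simp: preim_def)

lemma g_\<Gamma>_preim: assumes y: "y \<in> cantor_set" and x: "x \<in> preim y" shows "g ` \<Gamma> x \<subseteq> \<Gamma> y"
proof -
  obtain i where i: "i \<in> {1..n}" "x = psi i y" using x by (auto simp: preim_def)
  show ?thesis using g_\<gamma>[OF psi_in[OF i(1) y]] T_psi[OF i(1) y] unfolding i(2) \<Gamma>_def by auto
qed

lemma preim_iff: assumes y: "y \<in> cantor_set" and x: "x \<in> cantor_set" and z: "z \<in> \<Gamma> x" "g z \<in> \<Gamma> y"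
  shows "x \<in> preim y"
proof -
  obtain t where t: "z = \<gamma> x t" using z(1) by (auto simp: \<Gamma>_def)
  then have "g z \<in> \<Gamma> (T x)" using g_\<gamma>[OF x] by (auto simp: \<Gamma>_def)
  then have "T x = y" using \<Gamma>_disjoint[OF T_in[OF x] y] z(2) by blast
  then have "x = psi (idx x) y" using psi_T[OF x] by simp
  then show ?thesis using idx_in[OF x] unfolding preim_def by blast
qed

lemma card_preim: assumes y: "y \<in> cantor_set" shows "card (preim y) = n"
proof -
  have "inj_on (\<lambda>i. psi i y) {1..n}" 
    by (rule inj_on_inverseI[where g = idx]) (rule idx_psi[OF _ y])
  then show ?thesis unfolding preim_def by (simp add: card_image)
qed

text \<open>Each of the \<open>n\<close> preimage curves covers its image with a degree of modulus
  at least 2, so a point of a curve has at least \<open>2 * n\<close> preimages, while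
  \<open>g\<close> takes a value at most \<open>m\<close> times. The witnesses on each curve are the
  angles \<open>0\<close> and \<open>2 * pi / e\<close>.\<close>

lemma n_less_m: "n < m"
proof -
  let ?v = "\<gamma> 0 0"
  let ?pt = "\<lambda>(x, b). \<gamma> x (2 * pi * of_bool b / of_int (e (idx x)))"
  have y: "0 \<in> cantor_set" by (rule cantor_set_zero)
  have inj: "inj_on ?pt (preim 0 \<times> UNIV)"
  proof (rule inj_onI, clarify)
    fix x x' :: real and b b' :: bool
    assume x: "x \<in> preim 0" "x' \<in> preim 0" and eq: "\<gamma> x (2 * pi * of_bool b / of_int (e (idx x))) = \<gamma> x' (2 * pi * of_bool b' / of_int (e (idx x')))"
    have xc: "x \<in> cantor_set" "x' \<in> cantor_set" using preim_subset[OF y] x by auto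
    define E where "E = real_of_int (e (idx x))"
    have E: "\<bar>E\<bar> \<ge> 2" using e2[OF idx_in[OF xc(1)]] unfolding E_def by linarith
    obtain q :: int where q: "x = x'" "2 * pi * of_bool b / E = 2 * pi * of_bool b' / E + 2 * pi * q"
      using eq \<gamma>_eq_iff[OF xc] E_def by auto
    have "2 * pi * of_bool b = 2 * pi * (of_bool b' + q * E)" using q(2) E by (auto simp: field_simps)
    then have "of_bool b - of_bool b' = q * E" by simp
    moreover have "\<bar>of_bool b - of_bool b' :: real\<bar> \<le> 1" by (cases b; cases b') auto
    ultimately have le: "\<bar>real_of_int q\<bar> * \<bar>E\<bar> \<le> 1" by (simp add: abs_mult)
    have "q = 0"
    proof (rule ccontr)
      assume "q \<noteq> 0"
      then have "1 \<le> \<bar>real_of_int q\<bar>" by linarith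
      then have "1 * 2 \<le> \<bar>real_of_int q\<bar> * \<bar>E\<bar>" using E by (intro mult_mono) auto
      then show False using le by simp
    qed
    then have "of_bool b = (of_bool b' :: real)" using \<open>of_bool b - of_bool b' = q * E\<close> by simp
    then show "x = x' \<and> b = b'" using q(1) by (cases b; cases b') simp_all
  qed
  have sub: "?pt ` (preim 0 \<times> UNIV) \<subseteq> {z. z \<noteq> 0 \<and> g z = ?v}"
  proof clarify
    fix x :: real and b :: bool assume x: "x \<in> preim 0"
    have xc: "x \<in> cantor_set" by (rule preim_subset[OF y x])
    have T: "T x = 0" using x T_psi[OF _ y] by (auto simp: preim_def)
    have e0: "e (idx x) \<noteq> 0" using e2[OF idx_in[OF xc]] by auto
    have "g (\<gamma> x (2 * pi * of_bool b / of_int (e (idx x)))) = \<gamma> 0 (2 * pi * of_bool b)" using g_\<gamma>[OF xc] T e0 by simp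
    also have "\<dots> = \<gamma> 0 0" unfolding \<gamma>_eq_iff[OF y y] by (intro conjI exI[of _ "of_bool b"]) auto
    finally show "\<gamma> x (2 * pi * of_bool b / of_int (e (idx x))) \<noteq> 0 \<and> g (\<gamma> x (2 * pi * of_bool b / of_int (e (idx x)))) = \<gamma> 0 0"
      using \<gamma>_in_J[OF xc] J_bound(2) by metis
  qed
  have "card (preim 0 \<times> (UNIV :: bool set)) = n * 2" using card_preim[OF y] by (simp add: card_cartesian_product)
  then have "n * 2 = card (?pt ` (preim 0 \<times> UNIV))" using card_image[OF inj] by simp
  also have "\<dots> \<le> card {z. z \<noteq> 0 \<and> g z = ?v}" by (rule card_mono[OF card_preimages(1) sub])
  also have "\<dots> \<le> m" by (rule card_preimages(2))
  finally show ?thesis using n3 by simp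
qed

lemma roots_card: "card {w :: complex. w ^ m = 1} = m"
  using n_less_m by (intro card_roots_unity_eq) simp

lemma preim_surrounding:
  assumes y: "y \<in> cantor_set" and s: "0 \<in> inside (\<Gamma> y)" and x: "x \<in> preim y"
  shows "0 \<in> inside (\<Gamma> x)"
proof (rule ccontr)
  assume ns: "0 \<notin> inside (\<Gamma> x)"
  have xc: "x \<in> cantor_set" by (rule preim_subset[OF y x])
  have m0: "m > 0" using n_less_m by simp
  have out: "0 \<in> outside (\<Gamma> x)" using ns \<Gamma>_props(11)[OF xc] zero_notin_\<Gamma>[OF xc] by blast
  have "\<forall>w. \<exists>x'. w ^ m = 1 \<longrightarrow> x' \<in> cantor_set \<and> (\<lambda>z. w * z) ` \<Gamma> x = \<Gamma> x'" using rotate_\<Gamma>[OF _ xc] by blast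
  then obtain r where r: "\<And>w. w ^ m = 1 \<Longrightarrow> r w \<in> cantor_set \<and> (\<lambda>z. w * z) ` \<Gamma> x = \<Gamma> (r w)" by metis
  have "inj_on r {w. w ^ m = 1}"
  proof (rule inj_onI)
    fix w w' assume w: "w \<in> {w. w ^ m = 1}" "w' \<in> {w. w ^ m = 1}" and eq: "r w = r w'"
    then have w1: "w ^ m = 1" "w' ^ m = 1" by auto
    obtain v where v: "v ^ m = 1" "v * w' = 1" "w' * v = 1" using root_inverse[OF w1(2)] .
    have "(\<lambda>z. v * z) ` (\<lambda>z. w * z) ` \<Gamma> x = (\<lambda>z. v * z) ` (\<lambda>z. w' * z) ` \<Gamma> x" using r[OF w1(1)] r[OF w1(2)] eq by simp
    then have "(\<lambda>z. (v * w) * z) ` \<Gamma> x = \<Gamma> x" using v by (simp add: image_image mult.assoc[symmetric])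
    moreover have "(v * w) ^ m = 1" using v w1 by (simp add: power_mult_distrib)
    ultimately have "v * w = 1"
      using rotation_of_nonsurrounding_continuum[OF \<Gamma>_props(1,2)[OF xc] out \<Gamma>_props(3)[OF xc] _ m0] by blast
    then show "w = w'" using v by (metis mult.assoc mult.right_neutral mult.left_neutral)
  qed
  then have "card (r ` {w. w ^ m = 1}) = m" by (simp add: card_image roots_card)
  moreover have "r ` {w. w ^ m = 1} \<subseteq> preim y"
  proof
    fix u assume "u \<in> r ` {w. w ^ m = 1}"
    then obtain w where w: "w ^ m = 1" "u = r w" by blast
    have "\<gamma> x 0 \<in> \<Gamma> x" by (simp add: \<Gamma>_def)
    then have "w * \<gamma> x 0 \<in> \<Gamma> (r w)" using r[OF w(1)] by blast
    moreover have "g (w * \<gamma> x 0) \<in> \<Gamma> y"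
    proof -
      have "g (\<gamma> x 0) \<in> \<Gamma> y" using g_\<Gamma>_preim[OF y x] by (auto simp: \<Gamma>_def)
      \<comment> \<open>\<open>w ^ k\<close> is again an \<open>m\<close>-th root of unity, and
        \<open>\<Gamma> y\<close> surrounds \<open>0\<close>, so it is invariant. All rotates of
        \<open>\<Gamma> x\<close> are thus preimage curves of the same
        \<open>\<Gamma> y\<close>.\<close>
      then have "w ^ k * g (\<gamma> x 0) \<in> \<Gamma> y" using surrounding_rotate[OF root_power[OF w(1)] y s] by blast
      then show ?thesis using g_rotate[OF w(1)] by simp
    qed
    ultimately show "u \<in> preim y" using preim_iff[OF y] r[OF w(1)] w(2) by blast
  qed
  moreover have "finite (preim y)" by (simp add: preim_def)
  ultimately have "m \<le> card (preim y)" using card_mono by metis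
  then show False using card_preim[OF y] n_less_m by simp
qed

text \<open>The rotation maps the curve onto itself, hence permutes the two components of its
  complement, and it cannot exchange the bounded with the unbounded one.\<close>

lemma inside_rotate:
  assumes w: "w ^ m = 1" and x: "x \<in> cantor_set" and s: "0 \<in> inside (\<Gamma> x)" and z: "z \<in> inside (\<Gamma> x)"
  shows "w * z \<in> inside (\<Gamma> x)"
proof (rule ccontr)
  assume ni: "w * z \<notin> inside (\<Gamma> x)"
  obtain v where v: "v ^ m = 1" "v * w = 1" "w * v = 1" using root_inverse[OF w] .
  have inv: "(\<lambda>z. w * z) ` \<Gamma> x = \<Gamma> x" "(\<lambda>z. v * z) ` \<Gamma> x = \<Gamma> x" using surrounding_rotate[OF _ x s] w v by auto
  have vw: "v * (w * z) = z" "w * (v * z) = z" for z using v by (simp_all add: mult.assoc[symmetric])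
  have nG: "w * z \<notin> \<Gamma> x"
  proof
    assume "w * z \<in> \<Gamma> x"
    then have "v * (w * z) \<in> \<Gamma> x" using inv(2) by blast
    then show False using z vw(1) by (auto simp: inside_def)
  qed
  then have "w * z \<in> outside (\<Gamma> x)" using ni \<Gamma>_props(11)[OF x] by blast
  define S where "S = (\<lambda>z. v * z) ` outside (\<Gamma> x)"
  have "S \<inter> \<Gamma> x = {}"
  proof -
    have False if "u \<in> outside (\<Gamma> x)" "v * u \<in> \<Gamma> x" for u
    proof -
      have "w * (v * u) \<in> \<Gamma> x" using that(2) inv(1) by blast
      then show False using that(1) vw(2) by (auto simp: outside_def)
    qed
    then show ?thesis by (auto simp: S_def)
  qed
  moreover have "connected S" unfolding S_def by (rule rotate_connected[OF \<Gamma>_props(8)[OF x]])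
  moreover have "z \<in> S" unfolding S_def using \<open>w * z \<in> outside (\<Gamma> x)\<close> vw(1)[of z] by (metis image_eqI)
  moreover have "\<not> bounded S"
  proof
    assume "bounded S"
    then have "bounded ((\<lambda>z. w * z) ` S)"
      using root_cmod[OF w] unfolding bounded_iff by (auto simp: norm_mult)
    moreover have "(\<lambda>z. w * z) ` S = outside (\<Gamma> x)" unfolding S_def image_image vw(2) by simp
    ultimately show False using \<Gamma>_props(10)[OF x] by simp
  qed
  ultimately have "z \<in> outside (\<Gamma> x)" using unbounded_connected_outside by blast
  then show False using z inside_Int_outside by blast
qed

lemma zeros_same_side:
  assumes x: "x \<in> cantor_set" and s: "0 \<in> inside (\<Gamma> x)" and z: "g z = 0" "z \<noteq> 0" "g u = 0" "u \<noteq> 0"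
    and zi: "z \<in> inside (\<Gamma> x)"
  shows "u \<in> inside (\<Gamma> x)"
proof -
  have zero: "z ^ m = - \<eta>" if "g z = 0" "z \<noteq> 0" for z
  proof -
    have "z ^ k * z ^ l + \<eta> = 0" using that by (simp add: mcmullen_def field_simps)
    then show ?thesis by (simp add: m_def power_add add_eq_0_iff2)
  qed
  have "(u / z) ^ m = 1" using zero[OF z(1,2)] zero[OF z(3,4)] \<eta> by (simp add: power_divide)
  from inside_rotate[OF this x s zi] show ?thesis using z by simp
qed

text \<open>Between two preimages of a curve around the origin there must be a zero of \<open>g\<close>: otherwise the image of
  the region between them would be open with boundary on the curve, bounded, and would avoid the origin.\<close>

lemma no_zero_between:
  assumes y: "y \<in> cantor_set" "0 \<in> inside (\<Gamma> y)" and x: "x \<in> preim y" "x' \<in> preim y" "x \<noteq> x'"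
    and max: "b \<in> \<Gamma> x'" "\<And>a. a \<in> \<Gamma> x \<Longrightarrow> cmod a \<le> cmod b"
    and nz: "\<And>z. g z = 0 \<Longrightarrow> z \<noteq> 0 \<Longrightarrow> z \<in> inside (\<Gamma> x) \<longleftrightarrow> z \<in> inside (\<Gamma> x')"
  shows False
proof -
  have xc: "x \<in> cantor_set" "x' \<in> cantor_set" using preim_subset[OF y(1)] x by auto
  have s: "0 \<in> inside (\<Gamma> x)" "0 \<in> inside (\<Gamma> x')" using preim_surrounding[OF y] x by auto
  have disj: "\<Gamma> x \<inter> \<Gamma> x' = {}" by (rule \<Gamma>_disjoint[OF xc x(3)])
  have ord: "\<Gamma> x' \<subseteq> outside (\<Gamma> x)"
    by (rule surrounding_order(1)[OF \<Gamma>_props(1,2)[OF xc(1)] s(1) \<Gamma>_props(6,12)[OF xc(1)] \<Gamma>_props(1,2)[OF xc(2)] s(2) disj max])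
  define W where "W = inside (\<Gamma> x') \<inter> outside (\<Gamma> x)"
  have W: "open W" unfolding W_def by (intro open_Int \<Gamma>_props xc)
  have "b \<in> closure (inside (\<Gamma> x'))" using max(1) \<Gamma>_props(12)[OF xc(2)] closure_Un_frontier[of "inside (\<Gamma> x')"] by blast
  moreover have "b \<in> outside (\<Gamma> x)" using ord max(1) by blast
  ultimately have Wne: "W \<noteq> {}" unfolding W_def
    using open_Int_closure_eq_empty[OF \<Gamma>_props(7)[OF xc(1)], of "inside (\<Gamma> x')"] by blast
  have "closure W \<subseteq> closure (inside (\<Gamma> x')) \<inter> closure (outside (\<Gamma> x))"
    unfolding W_def by (intro Int_greatest closure_mono) auto
  also have "\<dots> \<subseteq> (inside (\<Gamma> x') \<union> \<Gamma> x') \<inter> (outside (\<Gamma> x) \<union> \<Gamma> x)"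
    using \<Gamma>_props(12)[OF xc(2)] \<Gamma>_props(13)[OF xc(1)] closure_Un_frontier[of "inside (\<Gamma> x')"] closure_Un_frontier[of "outside (\<Gamma> x)"]
    by auto
  also have "\<dots> \<subseteq> W \<union> \<Gamma> x \<union> \<Gamma> x'" unfolding W_def by blast
  finally have clW: "closure W \<subseteq> W \<union> \<Gamma> x \<union> \<Gamma> x'" .
  have W0: "0 \<notin> W" unfolding W_def using s(1) inside_Int_outside by blast
  then have cl0: "0 \<notin> closure W" using clW zero_notin_\<Gamma> xc by blast
  have "bounded W" unfolding W_def using \<Gamma>_props(9)[OF xc(2)] by (simp add: bounded_Int)
  then have "compact (closure W)" by (simp add: compact_closure)
  then have comp: "compact (g ` closure W)"
    by (intro compact_continuous_image holomorphic_on_imp_continuous_on g_holomorphic cl0)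
  define Y where "Y = g ` W"
  have Yo: "open Y" unfolding Y_def by (rule open_image_g[OF W W0])
  have "closure Y \<subseteq> g ` closure W"
    unfolding Y_def by (intro closure_minimal image_mono closure_subset compact_imp_closed comp)
  also have "\<dots> \<subseteq> Y \<union> \<Gamma> y" using clW g_\<Gamma>_preim[OF y(1) x(1)] g_\<Gamma>_preim[OF y(1) x(2)] unfolding Y_def by blast
  finally have clY: "closure Y \<subseteq> Y \<union> \<Gamma> y" .
  have bY: "bounded Y" unfolding Y_def
    by (rule bounded_subset[OF compact_imp_bounded[OF comp]]) (intro image_mono closure_subset)
  have "0 \<notin> Y"
  proof
    assume "0 \<in> Y"
    then obtain z where z: "z \<in> W" "g z = 0" by (auto simp: Y_def)
    then have "z \<noteq> 0" using W0 by auto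
    then show False using nz[OF z(2)] z(1) inside_Int_outside unfolding W_def by blast
  qed
  \<comment> \<open>As the boundary of \<open>Y\<close> lies on \<open>\<Gamma> y\<close>, each of
    the two sides is contained in \<open>Y\<close> or disjoint from it. The inside is not contained
    because of \<open>0\<close>, the outside because \<open>Y\<close> is bounded.\<close>
  have Yin: "Y \<inter> inside (\<Gamma> y) = {}"
  proof (rule ccontr)
    assume "Y \<inter> inside (\<Gamma> y) \<noteq> {}"
    moreover have "closure Y \<inter> inside (\<Gamma> y) \<subseteq> Y" using clY by (auto simp: inside_def)
    ultimately have "inside (\<Gamma> y) \<subseteq> Y" using open_clopen_subset[OF \<Gamma>_props(6)[OF y(1)] Yo] by blast
    then show False using y(2) \<open>0 \<notin> Y\<close> by blast
  qed
  have Yout: "Y \<inter> outside (\<Gamma> y) = {}"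
  proof (rule ccontr)
    assume "Y \<inter> outside (\<Gamma> y) \<noteq> {}"
    moreover have "closure Y \<inter> outside (\<Gamma> y) \<subseteq> Y" using clY by (auto simp: outside_def)
    ultimately have "outside (\<Gamma> y) \<subseteq> Y" using open_clopen_subset[OF \<Gamma>_props(8)[OF y(1)] Yo] by blast
    then show False using \<Gamma>_props(10)[OF y(1)] bounded_subset[OF bY] by blast
  qed
  \<comment> \<open>A nonempty open set cannot lie on a curve that is the frontier of its
    inside.\<close>
  have "Y \<subseteq> \<Gamma> y" using Yin Yout \<Gamma>_props(11)[OF y(1)] by blast
  obtain p where p: "p \<in> Y" using Wne by (auto simp: Y_def)
  then have "p \<in> closure (inside (\<Gamma> y))"
    using \<open>Y \<subseteq> \<Gamma> y\<close> \<Gamma>_props(12)[OF y(1)] closure_Un_frontier[of "inside (\<Gamma> y)"] by blast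
  then show False using open_Int_closure_eq_empty[OF Yo, of "inside (\<Gamma> y)"] p Yin by blast
qed

lemma not_surrounding: assumes y: "y \<in> cantor_set" shows "0 \<notin> inside (\<Gamma> y)"
proof
  assume s: "0 \<in> inside (\<Gamma> y)"
  have "\<exists>u. u ^ m = - \<eta>"
  proof -
    have "exp (Ln (- \<eta>) / m) ^ m = exp (of_nat m * (Ln (- \<eta>) / m))" by (simp only: exp_of_nat_mult)
    also have "\<dots> = - \<eta>" using n_less_m \<eta> by simp
    finally show ?thesis by blast
  qed
  then obtain u where u: "u ^ m = - \<eta>" by blast
  have u0: "u \<noteq> 0" using u \<eta> n_less_m by (auto simp: zero_power)
  have "u ^ k * u ^ l + \<eta> = 0" using u by (simp add: m_def power_add)
  then have gu: "g u = 0" using u0 by (simp add: mcmullen_def field_simps)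
  let ?st = "\<lambda>x. u \<in> inside (\<Gamma> x)"
  \<comment> \<open>Three or more curves and two possible positions of the zeros. With only two
    curves the zeros could lie between them.\<close>
  have "card (?st ` preim y) \<le> card (UNIV :: bool set)" by (rule card_mono) auto
  then have "card (?st ` preim y) < card (preim y)" using card_preim[OF y] n3 by simp
  then have "\<not> inj_on ?st (preim y)" by (rule pigeonhole)
  then obtain x x' where x: "x \<in> preim y" "x' \<in> preim y" "x \<noteq> x'" "?st x = ?st x'" by (auto simp: inj_on_def)
  have same: "z \<in> inside (\<Gamma> x1) \<longleftrightarrow> u \<in> inside (\<Gamma> x1)" if "x1 \<in> preim y" "g z = 0" "z \<noteq> 0" for z x1
    using zeros_same_side[OF preim_subset[OF y that(1)] preim_surrounding[OF y s that(1)]] that gu u0 by blast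
  have nz: "z \<in> inside (\<Gamma> x) \<longleftrightarrow> z \<in> inside (\<Gamma> x')" if "g z = 0" "z \<noteq> 0" for z
    using same[OF x(1) that] same[OF x(2) that] x(4) by blast
  have xc: "x \<in> cantor_set" "x' \<in> cantor_set" using preim_subset[OF y] x by auto
  obtain b where b: "b \<in> \<Gamma> x" "\<And>a. a \<in> \<Gamma> x \<Longrightarrow> cmod a \<le> cmod b" using max_modulus_point \<Gamma>_props(1,3)[OF xc(1)] by blast
  obtain b' where b': "b' \<in> \<Gamma> x'" "\<And>a. a \<in> \<Gamma> x' \<Longrightarrow> cmod a \<le> cmod b'" using max_modulus_point \<Gamma>_props(1,3)[OF xc(2)] by blast
  show False
  proof (cases "cmod b \<le> cmod b'")
    case True
    then have "cmod a \<le> cmod b'" if "a \<in> \<Gamma> x" for a using b(2)[OF that] by linarith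
    then show False using no_zero_between[OF y s x(1-3) b'(1)] nz by blast
  next
    case False
    then have "cmod a \<le> cmod b" if "a \<in> \<Gamma> x'" for a using b'(2)[OF that] by linarith
    then show False using no_zero_between[OF y s x(2,1) _ b(1)] x(3) nz by blast
  qed
qed

text \<open>A compact set separates two points only if one of its components does. The components of
  the Julia set are the curves, none of which separates \<open>0\<close> from a point beyond the
  escape radius.\<close>

lemma zero_outside_J: "0 \<in> outside J"
proof -
  define R where "R = complex_of_real (\<rho> + 1)"
  have R: "cmod R = \<rho> + 1" unfolding R_def norm_of_real by (simp add: \<rho>_def)
  have "cmod R > 0" using R norm_ge_zero[of \<eta>] unfolding \<rho>_def by linarith
  then have R0: "R \<noteq> 0" by auto
  have RJ: "R \<notin> J" using J_bound(1)[of R] R by auto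
  have Rout: "R \<in> outside A" if "A \<subseteq> J" for A
    by (rule ray_outside) (use RJ R0 that J_bound(1) R in force)+
  have "connected_component (- J) 0 R"
  proof (rule ccontr)
    assume "\<not> connected_component (- J) 0 R"
    then obtain A where A: "A \<in> components J" "\<not> connected_component (- A) 0 R"
      using separation_by_component_closed_pointwise[OF compact_imp_closed[OF compact_J]] by metis
    then obtain x where x: "x \<in> cantor_set" "A = \<Gamma> x" using components_J by blast
    have "0 \<in> outside A" using not_surrounding[OF x(1)] \<Gamma>_props(11)[OF x(1)] zero_notin_\<Gamma>[OF x(1)] x(2) by blast
    moreover have "R \<in> outside A" using Rout \<Gamma>_subset[OF x(1)] x(2) by simp
    moreover have "outside A \<subseteq> - A" by (auto simp: outside_def)
    ultimately have "connected_component (- A) 0 R"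
      unfolding connected_component_def using \<Gamma>_props(8)[OF x(1)] x(2) by blast
    then show False using A(2) by simp
  qed
  then have "connected_component_set (- J) 0 = connected_component_set (- J) R" by (metis connected_component_eq mem_Collect_eq)
  then show ?thesis using Rout[OF order_refl] J_bound(2) by (auto simp: outside_def)
qed

text \<open>Let \<open>W\<close> be the component of the complement around a counterexample. It is
  bounded and avoids the pole, so its image is open, bounded and has its boundary in the invariant
  set \<open>J\<close>. Meeting the connected unbounded region, the image would have to contain
  it.\<close>

lemma outside_J_backward: assumes "g q \<in> outside J" shows "q \<in> outside J"
proof (rule ccontr)
  assume nq: "q \<notin> outside J"
  have qJ: "q \<notin> J" using g_J assms by (auto simp: outside_def)
  then have qi: "q \<in> inside J" using nq inside_Un_outside[of J] by blast
  define W where "W = connected_component_set (- J) q"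
  have Wo: "open W" unfolding W_def by (intro open_connected_component open_Compl compact_imp_closed compact_J)
  have Wb: "bounded W" using qi by (simp add: W_def inside_def)
  have qW: "q \<in> W" unfolding W_def using qJ by simp
  have "W \<subseteq> inside J" unfolding W_def
    by (rule connected_subset_inside[OF connected_connected_component _ _ qi])
       (use qJ connected_component_subset[of "- J" q] in auto)
  then have W0: "0 \<notin> W" using zero_outside_J inside_Int_outside by blast
  have clW: "closure W \<subseteq> W \<union> J"
  proof
    fix z assume z: "z \<in> closure W"
    show "z \<in> W \<union> J"
    proof (rule ccontr)
      assume n: "z \<notin> W \<union> J"
      then have o: "open (connected_component_set (- J) z)" "z \<in> connected_component_set (- J) z"
        by (auto intro: open_connected_component open_Compl compact_imp_closed compact_J)
      have "connected_component_set (- J) z \<inter> W = {}"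
        using n unfolding W_def by (metis UnI1 connected_component_nonoverlap o(2) connected_component_eq_empty connected_component_eq)
      then show False using z open_Int_closure_eq_empty[OF o(1), of W] o(2) by blast
    qed
  qed
  have cl0: "0 \<notin> closure W" using clW W0 J_bound(2) by blast
  have comp: "compact (g ` closure W)"
    using Wb by (intro compact_continuous_image holomorphic_on_imp_continuous_on g_holomorphic cl0) (simp add: compact_closure)
  define Y where "Y = g ` W"
  have Yo: "open Y" unfolding Y_def by (rule open_image_g[OF Wo W0])
  have "closure Y \<subseteq> g ` closure W"
    unfolding Y_def by (intro closure_minimal image_mono closure_subset compact_imp_closed comp)
  also have "\<dots> \<subseteq> Y \<union> J" using clW g_J unfolding Y_def by blast
  finally have clY: "closure Y \<inter> outside J \<subseteq> Y" by (auto simp: outside_def)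
  have "connected (outside J)" using compact_imp_bounded[OF compact_J] by (intro connected_outside) auto
  then have "outside J \<subseteq> Y" using open_clopen_subset[OF _ Yo clY] assms qW unfolding Y_def by blast
  moreover have "bounded Y" unfolding Y_def
    by (rule bounded_subset[OF compact_imp_bounded[OF comp]]) (intro image_mono closure_subset)
  ultimately have "bounded (outside J)" using bounded_subset by blast
  moreover have "\<not> bounded (outside J)" using unbounded_outside[OF compact_imp_bounded[OF compact_J]] by blast
  ultimately show False by simp
qed

text \<open>Points inside a curve do not lie in the unbounded region, and by the preceding lemma
  neither do their iterates. That region contains \<open>0\<close> and everything beyond the escape
  radius, so the orbits are bounded and avoid the pole.\<close>

lemma inside_\<Gamma>_disjoint_J: assumes x: "x \<in> cantor_set" shows "inside (\<Gamma> x) \<inter> J = {}"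
proof (rule ccontr)
  assume "inside (\<Gamma> x) \<inter> J \<noteq> {}"
  then obtain P where P: "P \<in> inside (\<Gamma> x)" "P \<in> J" by blast
  have nout: "(g ^^ j) q \<notin> outside J" if q: "q \<in> inside (\<Gamma> x)" for q j
  proof (induction j)
    case 0
    show ?case using q outside_mono[OF \<Gamma>_subset[OF x]] inside_Int_outside[of "\<Gamma> x"] unfolding funpow_0 by blast
  next
    case (Suc j)
    then show ?case using outside_J_backward by auto
  qed
  have "P \<notin> J"
  proof (rule bounded_orbits_notin_J[OF \<Gamma>_props(5)[OF x] P(1)])
    fix q j assume q: "q \<in> inside (\<Gamma> x)"
    show "(g ^^ j) q \<noteq> 0" using nout[OF q, of j] zero_outside_J by auto
    show "cmod ((g ^^ j) q) \<le> \<rho>"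
    proof (rule ccontr)
      assume n: "\<not> cmod ((g ^^ j) q) \<le> \<rho>"
      then have "(g ^^ j) q \<in> outside J"
        using J_bound(1) by (intro ray_outside) (force simp: \<rho>_def)+
      then show False using nout[OF q] by blast
    qed
  qed
  then show False using P(2) by blast
qed

lemma contradiction: False
proof -
  let ?D = "(\<lambda>x. inside (\<Gamma> x)) ` cantor_set"
  have disj: "inside (\<Gamma> x) \<inter> inside (\<Gamma> y) = {}" if x: "x \<in> cantor_set" and y: "y \<in> cantor_set" and xy: "x \<noteq> y" for x y
  proof (rule ccontr)
    assume "inside (\<Gamma> x) \<inter> inside (\<Gamma> y) \<noteq> {}"
    then obtain p where p: "p \<in> inside (\<Gamma> x)" "p \<in> inside (\<Gamma> y)" by blast
    \<comment> \<open>Neither inside meets the other curve, since the curves lie in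
      \<open>J\<close>. Two insides that meet are therefore equal, and so are their frontiers, the
      curves.\<close>
    have "inside (\<Gamma> x) \<subseteq> inside (\<Gamma> y)"
      by (rule connected_subset_inside[OF \<Gamma>_props(6)[OF x] _ p]) (use inside_\<Gamma>_disjoint_J[OF x] \<Gamma>_subset[OF y] in blast)
    moreover have "inside (\<Gamma> y) \<subseteq> inside (\<Gamma> x)"
      by (rule connected_subset_inside[OF \<Gamma>_props(6)[OF y] _ p(2,1)]) (use inside_\<Gamma>_disjoint_J[OF y] \<Gamma>_subset[OF x] in blast)
    ultimately have "frontier (inside (\<Gamma> x)) = frontier (inside (\<Gamma> y))" by (intro arg_cong[of _ _ frontier] equalityI)
    then have "\<Gamma> x = \<Gamma> y" unfolding \<Gamma>_props(12)[OF x] \<Gamma>_props(12)[OF y] .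
    then show False using \<Gamma>_disjoint[OF x y xy] \<Gamma>_props(3)[OF x] by blast
  qed
  have "countable ?D"
  proof (rule countable_disjoint_open_subsets)
    show "pairwise disjnt ?D"
      using disj unfolding pairwise_def disjnt_def by blast
  qed (use \<Gamma>_props(5) in auto)
  moreover have "inj_on (\<lambda>x. inside (\<Gamma> x)) cantor_set"
  proof (rule inj_onI, rule ccontr)
    fix x y assume "x \<in> cantor_set" "y \<in> cantor_set" "inside (\<Gamma> x) = inside (\<Gamma> y)" "x \<noteq> y"
    then show False using disj[of x y] \<Gamma>_props(4)[of x] by blast
  qed
  ultimately have "countable cantor_set" by (simp add: countable_image_inj_eq)
  then show False using uncountable_cantor_set n3 by simp
qed

end

section \<open>Conclusion\<close>

context ring_map_bounds
begin

lemma julia_cantor_circles: "cantor_set_of_circles (julia F)"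
proof -
  obtain psi idx T where code: "cantor_code n psi idx T" using cantor_code_exists[OF n_ge] by blast
  interpret D: circle_dyn n psi idx T e G lo hi "3/4" "(\<Sum>j = 1..n. cmod (C j)) + 1" f
    by (rule circle_dyn_f[OF code])
  show ?thesis unfolding cantor_set_of_circles_def julia_eq[OF code] by (rule D.theta_image_homeomorphic)
qed

text \<open>The homeomorphism transports the parametrisation of one Julia set to the other, and the
  conjugacy transports the relation between the angles. The Julia set of the McMullen map omits
  \<open>north\<close> and the pole, so the transported curves live in the plane and the formula for
  the map applies to them.\<close>

lemma not_conjugate_mcmullen:
  assumes n3: "n \<ge> 3" and kl: "k \<ge> 2" "l \<ge> 2" "\<eta> \<noteq> 0"
  shows "\<not> conjugate_on_julia F (sphere_ext (mcmullen k l \<eta>))"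
proof
  assume "conjugate_on_julia F (sphere_ext (mcmullen k l \<eta>))"
  then obtain h' h'' where h: "homeomorphism (julia F) (julia (sphere_ext (mcmullen k l \<eta>))) h' h''"
    and conj: "\<And>P. P \<in> julia F \<Longrightarrow> h' (F P) = sphere_ext (mcmullen k l \<eta>) (h' P)"
    unfolding conjugate_on_julia_def by blast
  interpret M: mcm k l \<eta> by standard (rule kl)+
  obtain psi idx T where code: "cantor_code n psi idx T" using cantor_code_exists[OF n_ge] by blast
  interpret D: circle_dyn n psi idx T e G lo hi "3/4" "(\<Sum>j = 1..n. cmod (C j)) + 1" f
    by (rule circle_dyn_f[OF code])
  have JF: "julia F = stereo ` D.Lam" unfolding julia_eq[OF code] D.Lam_def ..
  have Lam: "D.theta x t \<in> D.Lam" if "x \<in> cantor_set" for x t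
    unfolding D.Lam_def using that by (intro image_eqI[of _ _ "(x, t)"]) auto
  have th: "stereo (D.theta x t) \<in> julia F" if "x \<in> cantor_set" for x t using JF Lam[OF that] by blast
  have hJ: "h' P \<in> julia M.G" if "P \<in> julia F" for P using h that by (auto simp: homeomorphism_def)
  have hS: "h' P \<in> S2 - {north}" if "P \<in> julia F" for P
    using subsetD[OF julia_subset hJ[OF that]] hJ[OF that] M.north_notin_julia by auto
  define \<gamma> where "\<gamma> x t = unstereo (h' (stereo (D.theta x t)))" for x t
  have st: "stereo (\<gamma> x t) = h' (stereo (D.theta x t))" if "x \<in> cantor_set" for x t
    unfolding \<gamma>_def using hS[OF th[OF that, of t]] by (intro stereo_unstereo) auto
  interpret mcm_conj k l \<eta> n psi idx T e \<gamma>
  proof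
    show "\<bar>e i\<bar> \<ge> 2" if "i \<in> {1..n}" for i by (rule D.e_ge[OF that])
    have c1: "continuous_on (cantor_set \<times> UNIV) (\<lambda>p. stereo (D.theta (fst p) (snd p)))"
      by (rule continuous_on_compose2[OF continuous_on_stereo[of UNIV] D.theta_cont]) simp
    have c2: "continuous_on (cantor_set \<times> UNIV) (\<lambda>p. h' (stereo (D.theta (fst p) (snd p))))"
      by (rule continuous_on_compose2[OF _ c1, of "julia F"]) (use h th in \<open>auto simp: homeomorphism_def\<close>)
    show "continuous_on (cantor_set \<times> UNIV) (\<lambda>p. \<gamma> (fst p) (snd p))"
      unfolding \<gamma>_def by (rule continuous_on_compose2[OF continuous_on_unstereo c2], rule image_subsetI, rule hS[OF th]) auto
    show "\<gamma> x t = \<gamma> x' t' \<longleftrightarrow> x = x' \<and> (\<exists>q::int. t = t' + 2 * pi * q)" if x: "x \<in> cantor_set" "x' \<in> cantor_set" for x x' t t'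
    proof -
      have "\<gamma> x t = \<gamma> x' t' \<longleftrightarrow> h' (stereo (D.theta x t)) = h' (stereo (D.theta x' t'))"
        using st[OF x(1), of t] st[OF x(2), of t'] stereo_inject[of "\<gamma> x t" "\<gamma> x' t'"] by metis
      also have "\<dots> \<longleftrightarrow> stereo (D.theta x t) = stereo (D.theta x' t')"
        using h th[OF x(1)] th[OF x(2)] unfolding homeomorphism_def by metis
      finally show ?thesis unfolding stereo_inject D.theta_eq_iff[OF x] .
    qed
    show "M.J = (\<lambda>p. \<gamma> (fst p) (snd p)) ` (cantor_set \<times> UNIV)"
    proof (intro set_eqI iffI)
      fix z assume "z \<in> M.J"
      then have z: "stereo z \<in> julia M.G" by (simp add: M.J_def)
      then have "h'' (stereo z) \<in> julia F" "h' (h'' (stereo z)) = stereo z" using h by (auto simp: homeomorphism_def)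
      then obtain p where p: "p \<in> cantor_set \<times> UNIV" "h'' (stereo z) = stereo (D.theta (fst p) (snd p))"
        unfolding JF D.Lam_def by auto
      then have "z = \<gamma> (fst p) (snd p)" using \<open>h' (h'' (stereo z)) = stereo z\<close> by (simp add: \<gamma>_def)
      then show "z \<in> (\<lambda>p. \<gamma> (fst p) (snd p)) ` (cantor_set \<times> UNIV)" using p(1) by blast
    next
      fix z assume "z \<in> (\<lambda>p. \<gamma> (fst p) (snd p)) ` (cantor_set \<times> UNIV)"
      then obtain p where p: "p \<in> cantor_set \<times> UNIV" "z = \<gamma> (fst p) (snd p)" by blast
      then have "fst p \<in> cantor_set" by auto
      then show "z \<in> M.J" unfolding M.J_def p(2) using st hJ[OF th] by simp
    qed
    fix x t assume x: "x \<in> cantor_set"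
    have nz: "\<gamma> x t \<noteq> 0"
    proof
      assume "\<gamma> x t = 0"
      then have "stereo 0 \<in> julia M.G" using st[OF x, of t] hJ[OF th[OF x, of t]] by simp
      then show False using M.zero_notin_julia by simp
    qed
    have tz: "D.theta x t \<notin> Poles"
    proof
      assume P: "D.theta x t \<in> Poles"
      have "f (D.theta x t) \<in> D.Lam" using D.f_theta[OF x] Lam[OF D.T_in[OF x]] by simp
      then show False using f_Poles_eq_0[OF P] D.Lam_nonzero by simp
    qed
    have "stereo (mcmullen k l \<eta> (\<gamma> x t)) = M.G (stereo (\<gamma> x t))" using M.G_stereo[OF nz] by simp
    also have "\<dots> = h' (F (stereo (D.theta x t)))" unfolding st[OF x] by (rule conj[OF th[OF x], symmetric])
    also have "\<dots> = stereo (\<gamma> (T x) (real_of_int (e (idx x)) * t))"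
      using sphere_ext_regular[OF tz] D.f_theta[OF x] st[OF D.T_in[OF x]] by simp
    finally show "mcmullen k l \<eta> (\<gamma> x t) = \<gamma> (T x) (real_of_int (e (idx x)) * t)" unfolding stereo_inject .
  qed (rule n3)
  show False by (rule contradiction)
qed

end

theorem theorem2p7:
  fixes p n :: nat and d :: "nat \<Rightarrow> nat"
  assumes "p \<in> {0, 1}" and "n \<ge> 3"
    and "\<forall>i \<in> {1..n}. d i > 0"
    and "(\<Sum>i = 1..n. 1 / real (d i)) < 1"
  shows "\<exists>s0 > 0. \<forall>s. 0 < s \<and> s < s0 \<longrightarrow>
    (\<forall>a :: nat \<Rightarrow> complex.
      (let \<xi> = (\<Sum>i = 1..n. 1 / real (d i)); K = real (Max (d ` {1..n})) in
        (if p = 1 then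
           cmod (a (n - 1)) = (s / K ^ 2) powr (1 / real (d n)) \<and>
           (\<forall>i \<in> {1..n-2}. cmod (a i) = (s / K ^ 5) powr (1 / real (d (Suc i))) * cmod (a (Suc i)))
         else
           cmod (a (n - 1)) = (s powr (1 / real (d n) + (1 - \<xi>) / 3)) powr (1 / real (d n)) \<and>
           (\<forall>i \<in> {1..n-2}. cmod (a i) =
              (s powr (1 + 1 / real (d n) + 2 * (1 - \<xi>) / 3)) powr (1 / real (d (Suc i))) * cmod (a (Suc i)))))
      \<longrightarrow>
      cantor_set_of_circles (julia (sphere_ext (fmap p n d a))) \<and>
      (\<forall>k l :: nat. \<forall>\<eta> :: complex. k \<ge> 2 \<and> l \<ge> 2 \<and> \<eta> \<noteq> 0 \<longrightarrow>
         \<not> conjugate_on_julia (sphere_ext (fmap p n d a)) (sphere_ext (mcmullen k l \<eta>))))"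
  proof -
  define \<xi> K where "\<xi> = (\<Sum>i = 1..n. 1 / real (d i))" and "K = Max (d ` {1..n})"
  note n = assms(2) and d = assms(3) and \<xi> = assms(4)[folded \<xi>_def]
  have K: "K \<ge> 4" using harmonic_bounds(3)[OF assms(2-4)] by (simp add: K_def)
  \<comment> \<open>The first bound makes the influence of distant factors small. The other two give
    \<open>- ln s * (1 - \<xi>)\<close> the lower bounds \<open>10 * ln K + 1\<close> for
    \<open>p = 1\<close> and 30, three times the 10 required with
    \<open>\<alpha> = (1 - \<xi>) / 3\<close>, for \<open>p = 0\<close>.\<close>
  define s0 where "s0 = min (1 / (100 * (real n * real K)))
    (min (exp (- ((10 * ln (real K) + 1) / (1 - \<xi>)))) (exp (- (30 / (1 - \<xi>)))))"
  have "s0 > 0" using n K by (simp add: s0_def)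
  moreover have "cantor_set_of_circles (julia (sphere_ext (fmap p n d a))) \<and>
      (\<forall>k l :: nat. \<forall>\<eta> :: complex. k \<ge> 2 \<and> l \<ge> 2 \<and> \<eta> \<noteq> 0 \<longrightarrow>
         \<not> conjugate_on_julia (sphere_ext (fmap p n d a)) (sphere_ext (mcmullen k l \<eta>)))"
    if s: "0 < s" "s < s0" and a: "if p = 1 then
           cmod (a (n - 1)) = (s / real K ^ 2) powr (1 / real (d n)) \<and>
           (\<forall>i \<in> {1..n-2}. cmod (a i) = (s / real K ^ 5) powr (1 / real (d (Suc i))) * cmod (a (Suc i)))
         else
           cmod (a (n - 1)) = (s powr (1 / real (d n) + (1 - \<xi>) / 3)) powr (1 / real (d n)) \<and>
           (\<forall>i \<in> {1..n-2}. cmod (a i) =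
              (s powr (1 + 1 / real (d n) + 2 * (1 - \<xi>) / 3)) powr (1 / real (d (Suc i))) * cmod (a (Suc i)))"
    for s :: real and a :: "nat \<Rightarrow> complex"
  proof -
    have ls: "- ln s * (1 - \<xi>) \<ge> c" if "s < exp (- (c / (1 - \<xi>)))" for c
    proof -
      have "ln s < - (c / (1 - \<xi>))" using that s(1) by (metis exp_gt_zero ln_exp ln_less_cancel_iff)
      then have "c / (1 - \<xi>) \<le> - ln s" by simp
      then show ?thesis using \<xi> by (simp add: pos_divide_le_eq)
    qed
    have s1: "s \<le> 1 / (100 * (real n * real K))" using s(2) by (simp add: s0_def)
    have "\<exists>lo hi. ring_map_bounds n d (sig p n) a lo hi K"
    proof (cases "p = 1")
      case True
      have "- ln s * (1 - \<xi>) \<ge> 10 * ln (real K) + 1" by (rule ls) (use s(2) in \<open>simp add: s0_def\<close>)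
      then show ?thesis using parameters_p1[OF n d assms(4) s(1) s1[unfolded K_def], of a] a True
        unfolding K_def \<xi>_def by auto
    next
      case False
      then have p: "p = 0" using assms(1) by simp
      have "- ln s * (1 - \<xi>) \<ge> 30" by (rule ls) (use s(2) in \<open>simp add: s0_def\<close>)
      then have "- ln s * ((1 - \<xi>) / 3) \<ge> 10" by simp
      then show ?thesis using parameters_p0[OF n d assms(4) s(1) s1[unfolded K_def], of a] a p
        unfolding K_def \<xi>_def by auto
    qed
    then obtain lo hi where b: "ring_map_bounds n d (sig p n) a lo hi K" by blast
    interpret R: ring_map_bounds n d "sig p n" a lo hi K by (rule b)
    have "fmap p n d a = R.f" by (rule R.fmap_eq[OF assms(1) refl])
    then show ?thesis using R.julia_cantor_circles R.not_conjugate_mcmullen[OF n] by simp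
  qed
  ultimately show ?thesis unfolding Let_def \<xi>_def K_def by (intro exI[of _ s0]) blast
qed

end
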